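(* Let $X$ be an irreducible reduced hypersurface of degree $d\geq 3$ in $\mathbb{P}^N$ over $\mathbb{C}$, and let $\mathcal{S}$ be the set of $(N-2)$-dimensional linear subspaces $\Lambda$ of $\mathbb{P}^N$ contained in $X$ such that a general element of $\Lambda$ is a star point of $X$. Assume that $\mathcal{S}$ has at least two elements and that there exists a linear subspace $L$ of $\mathbb{P}^N$ of dimension $N-3$ such that every $\Lambda\in\mathcal{S}$ contains $L$. Then: (i) if $\mathcal{S}$ has at least $d$ elements, then $X$ is a cone with vertex $L$ over a plane curve; (ii) $\mathcal{S}$ has at most $3d$ elements. Moreover, equality in (ii) holds when $X$ is the cone, with vertex an $(N-3)$-dimensional linear subspace, over the Fermat curve of degree $d$ in a plane disjoint from the vertex.
   Context: The ground field is $\mathbb{C}$. A smooth point $P$ of an irreducible reduced hypersurface $X\subset\mathbb{P}^N$ of degree $d\geq 3$ is called a star point on $X$ if the scheme $T_P(X)\cap X$ is a cone with vertex $P$, where $T_P(X)\subset\mathbb{P}^N$ is the embedded tangent hyperplane to $X$ at $P$; that is, in homogeneous coordinates $(Y_0:\dots:Y_{N-1})$ on $T_P(X)$ with $P=(1:0:\dots:0)$, the scheme $T_P(X)\cap X$ is defined by a form of degree $d$ not involving $Y_0$. "A general element of $\Lambda$" means all points of some nonempty Zariski open subset of $\Lambda$. The empty set is regarded as the linear subspace of dimension $-1$. $X$ is a cone with vertex $L$ over a plane curve if there are a plane $V\subset\mathbb{P}^N$ disjoint from $L$ and a curve $\Gamma\subset V$ such that $X$ is the union of the subspaces $\langle Q,L\rangle$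 for $Q\in\Gamma$. The Fermat curve of degree $d$ is the plane curve $x^d+y^d+z^d=0$. *)

theory Defs
  imports "HOL-Analysis.Analysis" "HOL-Library.Poly_Mapping"
    "HOL-Computational_Algebra.Factorial_Ring"
begin

type_synonym 'i mpoly = "('i \<Rightarrow>\<^sub>0 nat) \<Rightarrow>\<^sub>0 complex"

definition mConst :: "complex \<Rightarrow> 'i mpoly" where
  "mConst c = Poly_Mapping.single 0 c"

definition mVar :: "'i \<Rightarrow> 'i mpoly" where
  "mVar i = Poly_Mapping.single (Poly_Mapping.single i 1) 1"

definition monom_value :: "('i \<Rightarrow>\<^sub>0 nat) \<Rightarrow> ('i \<Rightarrow> 'a::comm_semiring_1) \<Rightarrow> 'a" where
  "monom_value m x = (\<Prod>i\<in>Poly_Mapping.keys m. x i ^ Poly_Mapping.lookup m i)"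

definition meval :: "'i mpoly \<Rightarrow> ('i \<Rightarrow> complex) \<Rightarrow> complex" where
  "meval F x = (\<Sum>m\<in>Poly_Mapping.keys F. Poly_Mapping.lookup F m * monom_value m x)"

definition msubst :: "'i mpoly \<Rightarrow> ('i \<Rightarrow> 'j mpoly) \<Rightarrow> 'j mpoly" where
  "msubst F s = (\<Sum>m\<in>Poly_Mapping.keys F. mConst (Poly_Mapping.lookup F m) * monom_value m s)"

definition mpderiv :: "'i \<Rightarrow> 'i mpoly \<Rightarrow> 'i mpoly" where
  "mpderiv i F = (\<Sum>m\<in>Poly_Mapping.keys F.
     Poly_Mapping.single (m - Poly_Mapping.single i 1)
       (of_nat (Poly_Mapping.lookup m i) * Poly_Mapping.lookup F m))"

definition mvars :: "'i mpoly \<Rightarrow> 'i set" where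
  "mvars F = (\<Union>m\<in>Poly_Mapping.keys F. Poly_Mapping.keys m)"

text \<open>As usual, the zero polynomial is homogeneous of every degree.\<close>

definition homogeneous :: "nat \<Rightarrow> 'i mpoly \<Rightarrow> bool" where
  "homogeneous e F \<longleftrightarrow>
     (\<forall>m\<in>Poly_Mapping.keys F. (\<Sum>i\<in>Poly_Mapping.keys m. Poly_Mapping.lookup m i) = e)"

text \<open>
  Projective \<open>N\<close>-space is the space of lines in \<open>complex ^ 'n\<close> with \<open>CARD('n) = N + 1\<close>.
  A point is given by a vector of homogeneous coordinates, i.e. a nonzero vector; a set of
  points is given by the set of all nonzero vectors representing its elements.
  A linear subspace is given by the vector subspace lying over it, so that the empty set
  corresponds to \<open>{0}\<close>, of dimension \<open>-1\<close>, inclusion is inclusion, and two linear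
  subspaces are disjoint iff the vector subspaces meet in \<open>{0}\<close>.
\<close>

definition proj_dim :: "(complex ^ 'n) set \<Rightarrow> int" where
  "proj_dim W = int (vec.dim W) - 1"

definition proj_zeros :: "'n mpoly \<Rightarrow> (complex ^ 'n) set" where
  "proj_zeros F = {v. v \<noteq> 0 \<and> meval F (($) v) = 0}"

definition zariski_open_in :: "(complex ^ 'n) set \<Rightarrow> (complex ^ 'n) set \<Rightarrow> bool" where
  "zariski_open_in W U \<longleftrightarrow>
     (\<exists>A :: 'n mpoly set. (\<forall>f\<in>A. \<exists>e. homogeneous e f) \<and>
        U = {v \<in> W. v \<noteq> 0 \<and> (\<exists>f\<in>A. meval f (($) v) \<noteq> 0)})"

definition general_element :: "(complex ^ 'n) set \<Rightarrow> (complex ^ 'n \<Rightarrow> bool) \<Rightarrow> bool" where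
  "general_element W Q \<longleftrightarrow> (\<exists>U. zariski_open_in W U \<and> U \<noteq> {} \<and> (\<forall>P\<in>U. Q P))"

text \<open>
  A basis \<open>b 0, \<dots>, b (k - 1)\<close> of \<open>W\<close> is the same thing as a system of homogeneous coordinates
  \<open>Y\<^sub>0, \<dots>, Y\<^bsub>k-1\<^esub>\<close> on the linear subspace \<open>W\<close>: the point with coordinates \<open>y\<close> is
  \<open>\<Sum>j<k. y j *s b j\<close>.
\<close>

definition coord_system :: "(complex ^ 'n) set \<Rightarrow> nat \<Rightarrow> (nat \<Rightarrow> complex ^ 'n) \<Rightarrow> bool" where
  "coord_system W k b \<longleftrightarrow>
     inj_on b {..<k} \<and> vec.independent (b ` {..<k}) \<and> vec.span (b ` {..<k}) = W"

text \<open>The restriction of \<open>F\<close> to a linear subspace, written in the coordinates given by \<open>b\<close>.\<close>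

definition restrict_poly :: "'n mpoly \<Rightarrow> nat \<Rightarrow> (nat \<Rightarrow> complex ^ 'n) \<Rightarrow> nat mpoly" where
  "restrict_poly F k b = msubst F (\<lambda>i. \<Sum>j<k. mConst (b j $ i) * mVar j)"

text \<open>
  An irreducible reduced hypersurface is represented by its equation, an irreducible form
  (unique up to a nonzero constant factor).
\<close>

definition irreducible_hypersurface :: "nat \<Rightarrow> 'n mpoly \<Rightarrow> bool" where
  "irreducible_hypersurface d F \<longleftrightarrow> homogeneous d F \<and> irreducible F"

definition smooth_point :: "'n mpoly \<Rightarrow> complex ^ 'n \<Rightarrow> bool" where
  "smooth_point F P \<longleftrightarrow> P \<in> proj_zeros F \<and> (\<exists>i. meval (mpderiv i F) (($) P) \<noteq> 0)"

definition tangent_hyperplane :: "'n::finite mpoly \<Rightarrow> complex ^ 'n \<Rightarrow> (complex ^ 'n) set" where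
  "tangent_hyperplane F P = {v. (\<Sum>i\<in>UNIV. meval (mpderiv i F) (($) P) * v $ i) = 0}"

text \<open>
  The scheme cut out on the tangent hyperplane, with coordinates \<open>Y\<^sub>0, \<dots>, Y\<^bsub>N-1\<^esub>\<close>, is
  the one defined by the restriction of \<open>F\<close>.  It is defined by a form \<open>G\<close> iff \<open>G\<close> and that
  restriction generate the same ideal, i.e. divide each other (a principal ideal in at
  least two variables is saturated).
\<close>

definition star_point :: "nat \<Rightarrow> 'n::finite mpoly \<Rightarrow> complex ^ 'n \<Rightarrow> bool" where
  "star_point d F P \<longleftrightarrow> smooth_point F P \<and>
     (\<exists>b G. let N = CARD('n) - 1; F' = restrict_poly F N b in
        coord_system (tangent_hyperplane F P) N b \<and> b 0 = P \<and>
        G \<noteq> 0 \<and> homogeneous d G \<and> mvars G \<subseteq> {1..<N} \<and>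
        G dvd F' \<and> F' dvd G)"

text \<open>The set \<open>\<S>\<close>; here \<open>proj_dim UNIV = N\<close>.\<close>

definition star_subspaces :: "nat \<Rightarrow> 'n::finite mpoly \<Rightarrow> (complex ^ 'n) set set" where
  "star_subspaces d F =
     {W. vec.subspace W \<and> proj_dim W = proj_dim (UNIV :: (complex ^ 'n) set) - 2 \<and>
         W - {0} \<subseteq> proj_zeros F \<and> general_element W (star_point d F)}"

definition proj_cone :: "(complex ^ 'n) set \<Rightarrow> (complex ^ 'n) set \<Rightarrow> (complex ^ 'n) set" where
  "proj_cone L \<Gamma> = (\<Union>Q\<in>\<Gamma>. vec.span (insert Q L) - {0})"

definition curve_in_coords :: "(nat \<Rightarrow> complex ^ 'n) \<Rightarrow> nat mpoly \<Rightarrow> (complex ^ 'n) set" where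
  "curve_in_coords b G =
     {v. v \<noteq> 0 \<and> (\<exists>y. v = (\<Sum>j<3. y j *s b j) \<and> meval G y = 0)}"

definition plane_curve :: "(complex ^ 'n) set \<Rightarrow> (complex ^ 'n) set \<Rightarrow> bool" where
  "plane_curve V \<Gamma> \<longleftrightarrow>
     (\<exists>b G e. coord_system V 3 b \<and> G \<noteq> 0 \<and> e \<ge> 1 \<and> homogeneous e G \<and> mvars G \<subseteq> {..<3} \<and>
        \<Gamma> = curve_in_coords b G)"

definition fermat_curve :: "nat \<Rightarrow> (complex ^ 'n) set \<Rightarrow> (complex ^ 'n) set \<Rightarrow> bool" where
  "fermat_curve d V \<Gamma> \<longleftrightarrow>
     (\<exists>b. coord_system V 3 b \<and> \<Gamma> = curve_in_coords b (mVar 0 ^ d + mVar 1 ^ d + mVar 2 ^ d))"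

definition complementary_plane :: "(complex ^ 'n) set \<Rightarrow> (complex ^ 'n) set \<Rightarrow> bool" where
  "complementary_plane L V \<longleftrightarrow> vec.subspace V \<and> proj_dim V = 2 \<and> V \<inter> L = {0}"

definition cone_over_plane_curve :: "(complex ^ 'n) set \<Rightarrow> (complex ^ 'n) set \<Rightarrow> bool" where
  "cone_over_plane_curve X L \<longleftrightarrow>
     (\<exists>V \<Gamma>. complementary_plane L V \<and> plane_curve V \<Gamma> \<and> X = proj_cone L \<Gamma>)"

end

theory Submission
  imports Defs
begin

text \<open>
  Along a subspace \<open>\<Lambda>\<close> of star points the tangent hyperplane \<open>\<alpha> = 0\<close> is constant, and the equation of
  \<open>X\<close> becomes \<open>\<phi> = \<alpha> A + c \<mu>\<^sup>d\<close> with \<open>\<Lambda> = {\<alpha> = \<mu> = 0}\<close> and \<open>A\<close> not identically zero on \<open>\<Lambda>\<close>.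
  For \<open>u\<close> in the common subspace \<open>L\<close> the polynomial \<open>\<phi>(v + u) - \<phi>(v)\<close> has degree less than \<open>d\<close> in \<open>v\<close>
  and is divisible by every \<open>\<alpha>\<close>; so \<open>d\<close> subspaces force \<open>\<phi>\<close> to be invariant under \<open>L\<close>.

  In that case let \<open>h\<close> be the Hessian determinant of the plane section, of degree \<open>3(d - 2)\<close>. On
  \<open>\<alpha> = 0\<close> it is \<open>\<mu>\<^bsup>d-2\<^esup>\<close> times a square that does not vanish identically on \<open>\<Lambda>\<close>. Since \<open>\<alpha> = 0\<close> meets
  \<open>X\<close> only in \<open>\<Lambda>\<close>, a special case of Noether's \<open>AF + BG\<close> theorem holds for the ideals \<open>(\<phi>, \<alpha>\<^bsup>d-2\<^esup>)\<close> and
  puts \<open>h\<^sup>d\<close> into \<open>(\<phi>, \<Prod> \<alpha>\<^bsup>d-2\<^esup>)\<close>. With more than \<open>3d\<close> factors, comparing degrees makes \<open>h\<close> vanish on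
  \<open>X\<close>, which is false near \<open>\<Lambda>\<close>. This replaces Bezout's theorem for a curve and its Hessian.

  Polynomials are handled as functions on \<open>complex ^ 'n\<close>, so that density arguments along lines
  replace the algebra of polynomial rings.
\<close>

section \<open>Evaluation of polynomials\<close>

text \<open>The exponents are orders of vanishing. Modulo L, X is a plane curve and each \<Lambda>
  is a smooth point of it where the tangent line \<alpha> = 0 meets the curve d times, a total flex.
  On the curve \<mu> has order 1 there, \<alpha> order d, and the Hessian h order d - 2. So h^d and
  \<alpha>^(d-2) both have order d(d - 2), which is why the d-th power of h is compared with
  \<alpha>^(d-2). The degree of h^d is 3d(d - 2) and m subspaces contribute degree m(d - 2), whence
  the threshold m = 3d.

  The curve may be singular elsewhere, and the star condition is only known at general points of
  each \<Lambda>. Hence every local statement is phrased through a function that is nonzero at some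
  point of \<Lambda>, and cancelling such a function is the only local algebra that occurs.

  The Hessian argument presupposes invariance under L, which costs nothing: a counterexample to the
  bound has more than d subspaces. In the Fermat case the same bound is combined with 3d explicit
  subspaces, after invariance of the equation under L has placed L inside every star
  subspace.\<close>

lemma monom_value_supset:
  assumes "finite A" "Poly_Mapping.keys m \<subseteq> A"
  shows "monom_value m x = (\<Prod>i\<in>A. x i ^ Poly_Mapping.lookup m i)"
  unfolding monom_value_def
  by (rule prod.mono_neutral_left) (use assms in \<open>auto simp: in_keys_iff\<close>)

lemma monom_value_add: "monom_value (m + n) x = monom_value m x * monom_value n x"
proof -
  let ?A = "Poly_Mapping.keys m \<union> Poly_Mapping.keys n"
  have "Poly_Mapping.keys (m + n) \<subseteq> ?A" by (rule keys_add)
  then show ?thesis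
    by (simp add: monom_value_supset[of ?A] lookup_add power_add prod.distrib)
qed

lemma monom_value_zero [simp]: "monom_value 0 x = 1"
  by (simp add: monom_value_def)

lemma monom_value_single [simp]: "monom_value (Poly_Mapping.single i k) x = x i ^ k"
  by (simp add: monom_value_def)

lemma meval_supset:
  assumes "finite A" "Poly_Mapping.keys F \<subseteq> A"
  shows "meval F x = (\<Sum>m\<in>A. Poly_Mapping.lookup F m * monom_value m x)"
  unfolding meval_def
  by (rule sum.mono_neutral_left) (use assms in \<open>auto simp: in_keys_iff\<close>)

lemma meval_zero [simp]: "meval 0 x = 0"
  by (simp add: meval_def)

lemma meval_add [simp]: "meval (F + G) x = meval F x + meval G x"
proof -
  let ?A = "Poly_Mapping.keys F \<union> Poly_Mapping.keys G"
  have "Poly_Mapping.keys (F + G) \<subseteq> ?A" by (rule keys_add)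
  then show ?thesis
    by (simp add: meval_supset[of ?A] lookup_add sum.distrib algebra_simps)
qed

lemma meval_sum [simp]: "meval (\<Sum>a\<in>A. F a) x = (\<Sum>a\<in>A. meval (F a) x)"
  by (induction A rule: infinite_finite_induct) auto

lemma meval_single [simp]: "meval (Poly_Mapping.single m c) x = c * monom_value m x"
  by (simp add: meval_def)

lemma mpoly_as_sum:
  "(F :: 'i mpoly) = (\<Sum>m\<in>Poly_Mapping.keys F. Poly_Mapping.single m (Poly_Mapping.lookup F m))"
  by (rule poly_mapping_eqI)
     (auto simp: lookup_sum lookup_single when_def in_keys_iff sum.delta' cong: sum.cong)

lemma mpoly_induct [case_names single add]:
  assumes "\<And>m c. P (Poly_Mapping.single m c :: 'i mpoly)"
    and "\<And>F G. P F \<Longrightarrow> P G \<Longrightarrow> P (F + G)"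
  shows "P F"
proof -
  \<comment> \<open>The term with coefficient 0 is the zero polynomial and starts the
    induction.\<close>
  have "finite A \<Longrightarrow> P (\<Sum>m\<in>A. Poly_Mapping.single m (Poly_Mapping.lookup F m))" for A
    by (induction A rule: finite_induct) (use assms(1)[of _ 0] assms in auto)
  from this[OF finite_keys[of F]] show ?thesis
    by (subst mpoly_as_sum)
qed

lemma meval_mult [simp]: "meval (F * G) x = meval F x * meval G x"
proof (induction F rule: mpoly_induct)
  case (single m c)
  show ?case
    by (induction G rule: mpoly_induct)
       (auto simp: mult_single monom_value_add algebra_simps)
qed (auto simp: algebra_simps)

lemma meval_mConst [simp]: "meval (mConst c) x = c"
  by (simp add: mConst_def)

lemma meval_mVar [simp]: "meval (mVar i) x = x i"
  by (simp add: mVar_def)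

lemma meval_one [simp]: "meval 1 x = 1"
  using meval_single[of 0 1 x] by simp

lemma meval_power [simp]: "meval (F ^ k) x = meval F x ^ k"
  by (induction k) auto

lemma meval_prod [simp]: "meval (\<Prod>a\<in>A. F a) x = (\<Prod>a\<in>A. meval (F a) x)"
  by (induction A rule: infinite_finite_induct) auto

lemma meval_msubst: "meval (msubst F s) x = meval F (\<lambda>i. meval (s i) x)"
  by (simp add: msubst_def monom_value_def meval_def[of F])

lemma meval_dvd: "F dvd G \<Longrightarrow> meval F x = 0 \<Longrightarrow> meval G x = 0"
  by (auto elim!: dvdE)

text \<open>With all variables but \<open>x j\<close> frozen, the sum is a univariate polynomial
  that vanishes identically. Its coefficients are the same kind of sum over the monomials with a
  prescribed exponent of \<open>j\<close>, and those are still separated by their exponents on the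
  remaining variables.\<close>

lemma sum_monom_values_eq_0:
  assumes "finite I" "finite K"
    and "\<And>m n. m \<in> K \<Longrightarrow> n \<in> K \<Longrightarrow> (\<And>i. i \<in> I \<Longrightarrow> Poly_Mapping.lookup m i = Poly_Mapping.lookup n i) \<Longrightarrow> m = n"
    and "\<And>x. (\<Sum>m\<in>K. c m * (\<Prod>i\<in>I. x i ^ Poly_Mapping.lookup m i)) = (0::complex)"
    and "m \<in> K"
  shows "c m = 0"
  using assms
proof (induction I arbitrary: K m rule: finite_induct)
  case empty
  then have "K = {m}" by auto
  then show ?case using empty(3)[of undefined] by simp
next
  case (insert j I)
  let ?K = "{n \<in> K. Poly_Mapping.lookup n j = Poly_Mapping.lookup m j}"
  show ?case
  proof (rule insert.IH[of ?K m])
    fix x :: "'a \<Rightarrow> complex"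
    define S where "S k = (\<Sum>n | n \<in> K \<and> Poly_Mapping.lookup n j = k. c n * (\<Prod>i\<in>I. x i ^ Poly_Mapping.lookup n i))" for k
    define p where "p = (\<Sum>n\<in>K. monom (c n * (\<Prod>i\<in>I. x i ^ Poly_Mapping.lookup n i)) (Poly_Mapping.lookup n j))"
    have "poly p t = 0" for t
    proof -
      have "poly p t = (\<Sum>n\<in>K. c n * (\<Prod>i\<in>insert j I. (x(j := t)) i ^ Poly_Mapping.lookup n i))"
        unfolding p_def poly_sum
      proof (rule sum.cong[OF refl])
        fix n
        have "(\<Prod>i\<in>I. (x(j := t)) i ^ Poly_Mapping.lookup n i) = (\<Prod>i\<in>I. x i ^ Poly_Mapping.lookup n i)"
          by (rule prod.cong) (use insert.hyps in auto)
        then show "poly (monom (c n * (\<Prod>i\<in>I. x i ^ Poly_Mapping.lookup n i)) (Poly_Mapping.lookup n j)) t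
            = c n * (\<Prod>i\<in>insert j I. (x(j := t)) i ^ Poly_Mapping.lookup n i)"
          using insert.hyps by (simp add: poly_monom)
      qed
      then show ?thesis using insert.prems(3) by simp
    qed
    then have "p = 0" using poly_all_0_iff_0 by blast
    then have "0 = coeff p (Poly_Mapping.lookup m j)" by simp
    also have "\<dots> = (\<Sum>n\<in>K. if Poly_Mapping.lookup n j = Poly_Mapping.lookup m j then c n * (\<Prod>i\<in>I. x i ^ Poly_Mapping.lookup n i) else 0)"
      unfolding p_def coeff_sum by (simp add: coeff_monom)
    also have "\<dots> = (\<Sum>n\<in>?K. c n * (\<Prod>i\<in>I. x i ^ Poly_Mapping.lookup n i))"
      using insert.prems(1) by (simp add: sum.inter_filter)
    finally show "(\<Sum>n\<in>?K. c n * (\<Prod>i\<in>I. x i ^ Poly_Mapping.lookup n i)) = 0" by simp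
  next
    show "\<And>n n'. n \<in> ?K \<Longrightarrow> n' \<in> ?K \<Longrightarrow> (\<And>i. i \<in> I \<Longrightarrow> Poly_Mapping.lookup n i = Poly_Mapping.lookup n' i) \<Longrightarrow> n = n'"
      using insert.prems(2) by (metis (mono_tags, lifting) insert_iff mem_Collect_eq)
  qed (use insert.prems in auto)
qed

lemma meval_eq_0_imp:
  fixes F :: "'i mpoly"
  assumes "\<And>x. meval F x = 0"
  shows "F = 0"
proof -
  let ?K = "Poly_Mapping.keys F" and ?I = "mvars F"
  have fin: "finite ?I" by (simp add: mvars_def)
  have sub: "Poly_Mapping.keys m \<subseteq> ?I" if "m \<in> ?K" for m
    using that by (auto simp: mvars_def)
  have "Poly_Mapping.lookup F m = 0" if "m \<in> ?K" for m
  proof (rule sum_monom_values_eq_0[OF fin, of ?K])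
    show "(\<Sum>m\<in>?K. Poly_Mapping.lookup F m * (\<Prod>i\<in>?I. x i ^ Poly_Mapping.lookup m i)) = 0" for x
      using assms[of x] sub by (simp add: meval_def monom_value_supset[OF fin] cong: sum.cong)
    show "\<And>m n. m \<in> ?K \<Longrightarrow> n \<in> ?K \<Longrightarrow> (\<And>i. i \<in> ?I \<Longrightarrow> Poly_Mapping.lookup m i = Poly_Mapping.lookup n i) \<Longrightarrow> m = n"
      using sub by (intro poly_mapping_eqI) (metis in_keys_iff subsetD)
  qed (use that in auto)
  then show ?thesis by (metis in_keys_iff poly_mapping_eqI lookup_zero)
qed

lemma meval_eqD:
  assumes "\<And>x. meval F x = meval G x"
  shows "F = (G :: 'i mpoly)"
proof -
  have "meval (F + mConst (-1) * G) x = 0" for x using assms by simp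
  then have "F + mConst (-1) * G = 0" by (rule meval_eq_0_imp)
  moreover have "mConst (-1) * G = - G"
    unfolding mConst_def by (metis mult_minus1 single_one single_uminus)
  ultimately show ?thesis by simp
qed

section \<open>Homogeneity and the variables of a polynomial\<close>

definition mdeg :: "('i \<Rightarrow>\<^sub>0 nat) \<Rightarrow> nat" where
  "mdeg m = (\<Sum>i\<in>Poly_Mapping.keys m. Poly_Mapping.lookup m i)"

lemma mdeg_add: "mdeg (m + n) = mdeg m + mdeg n"
proof -
  let ?A = "Poly_Mapping.keys m \<union> Poly_Mapping.keys n"
  have *: "mdeg p = (\<Sum>i\<in>?A. Poly_Mapping.lookup p i)" if "Poly_Mapping.keys p \<subseteq> ?A" for p
    unfolding mdeg_def by (rule sum.mono_neutral_left) (use that in \<open>auto simp: in_keys_iff\<close>)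
  show ?thesis
    using *[of m] *[of n] *[OF keys_add] by (simp add: lookup_add sum.distrib)
qed

lemma homogeneous_iff: "homogeneous e F \<longleftrightarrow> (\<forall>m\<in>Poly_Mapping.keys F. mdeg m = e)"
  by (simp add: homogeneous_def mdeg_def)

lemma homogeneous_mult:
  assumes "homogeneous a F" "homogeneous b G"
  shows "homogeneous (a + b) (F * G)"
  unfolding homogeneous_iff
proof
  fix m assume "m \<in> Poly_Mapping.keys (F * G)"
  then obtain p q where "m = p + q" "p \<in> Poly_Mapping.keys F" "q \<in> Poly_Mapping.keys G"
    using keys_mult[of F G] by blast
  then show "mdeg m = a + b" using assms by (auto simp: mdeg_add homogeneous_iff)
qed

lemma homogeneous_sum:
  assumes "\<And>a. a \<in> A \<Longrightarrow> homogeneous e (F a)"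
  shows "homogeneous e (\<Sum>a\<in>A. F a)"
  using assms
proof (induction A rule: infinite_finite_induct)
  case (insert a A)
  then show ?case using keys_add[of "F a" "sum F A"] by (auto simp: homogeneous_iff)
qed (auto simp: homogeneous_iff)

lemma homogeneous_mConst: "homogeneous 0 (mConst c)"
  by (auto simp: homogeneous_iff mConst_def mdeg_def)

lemma homogeneous_mVar: "homogeneous 1 (mVar i)"
  by (auto simp: homogeneous_iff mVar_def mdeg_def)

lemma homogeneous_one: "homogeneous 0 1"
  by (auto simp: homogeneous_iff mdeg_def)

lemma homogeneous_power: "homogeneous e F \<Longrightarrow> homogeneous (k * e) (F ^ k)"
proof (induction k)
  case 0
  show ?case using homogeneous_one by simp
next
  case (Suc k)
  then show ?case using homogeneous_mult[of e F "k * e" "F ^ k"] by simp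
qed

lemma homogeneous_prod:
  assumes "\<And>a. a \<in> A \<Longrightarrow> homogeneous (e a) (F a)"
  shows "homogeneous (\<Sum>a\<in>A. e a) (\<Prod>a\<in>A. F a)"
  using assms
  by (induction A rule: infinite_finite_induct) (auto intro: homogeneous_one homogeneous_mult)

lemma homogeneous_msubst:
  assumes "homogeneous d F" "\<And>i. homogeneous 1 (s i)"
  shows "homogeneous d (msubst F s)"
  unfolding msubst_def
proof (rule homogeneous_sum)
  fix m assume "m \<in> Poly_Mapping.keys F"
  then have "d = (\<Sum>i\<in>Poly_Mapping.keys m. Poly_Mapping.lookup m i * 1)"
    using assms(1) by (simp add: homogeneous_def)
  then have "homogeneous d (monom_value m s)"
    unfolding monom_value_def by (simp only:) (intro homogeneous_prod homogeneous_power assms(2))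
  then show "homogeneous d (mConst (Poly_Mapping.lookup F m) * monom_value m s)"
    using homogeneous_mult[OF homogeneous_mConst] by fastforce
qed

lemma homogeneous_linear: "homogeneous 1 (\<Sum>i\<in>A. mConst (c i) * mVar i)"
  by (rule homogeneous_sum) (use homogeneous_mult[OF homogeneous_mConst homogeneous_mVar] in auto)

lemma meval_homogeneous:
  assumes "homogeneous d F"
  shows "meval F (\<lambda>i. t * x i) = t ^ d * meval F x"
proof -
  have "monom_value m (\<lambda>i. t * x i) = t ^ d * monom_value m x" if "m \<in> Poly_Mapping.keys F" for m
    using assms that by (simp add: homogeneous_def monom_value_def power_mult_distrib prod.distrib flip: power_sum)
  then show ?thesis by (simp add: meval_def sum_distrib_left mult_ac)
qed

lemma mvars_add: "mvars (F + G) \<subseteq> mvars F \<union> mvars G"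
  using keys_add[of F G] by (fastforce simp: mvars_def)

lemma mvars_mult: "mvars (F * G) \<subseteq> mvars F \<union> mvars G"
proof
  fix i assume "i \<in> mvars (F * G)"
  then obtain m where "m \<in> Poly_Mapping.keys (F * G)" and i: "i \<in> Poly_Mapping.keys m"
    by (auto simp: mvars_def)
  then obtain p q where "m = p + q" "p \<in> Poly_Mapping.keys F" "q \<in> Poly_Mapping.keys G"
    using keys_mult[of F G] by blast
  then show "i \<in> mvars F \<union> mvars G"
    using keys_add[of p q] i by (auto simp: mvars_def)
qed

lemma mvars_mConst [simp]: "mvars (mConst c) = {}"
  by (simp add: mvars_def mConst_def)

lemma mvars_mVar [simp]: "mvars (mVar i) = {i}"
  by (simp add: mvars_def mVar_def)

lemma mvars_sum: "(\<And>a. a \<in> A \<Longrightarrow> mvars (F a) \<subseteq> I) \<Longrightarrow> mvars (\<Sum>a\<in>A. F a) \<subseteq> I"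
proof (induction A rule: infinite_finite_induct)
  case (insert a A)
  then show ?case using mvars_add[of "F a" "sum F A"] by auto
qed (auto simp: mvars_def)

lemma mvars_power: "mvars F \<subseteq> I \<Longrightarrow> mvars (F ^ k) \<subseteq> I"
proof (induction k)
  case (Suc k)
  then show ?case using mvars_mult[of F "F ^ k"] by auto
qed (auto simp: mvars_def)

lemma mvars_prod: "(\<And>a. a \<in> A \<Longrightarrow> mvars (F a) \<subseteq> I) \<Longrightarrow> mvars (\<Prod>a\<in>A. F a) \<subseteq> I"
proof (induction A rule: infinite_finite_induct)
  case (insert a A)
  then show ?case using mvars_mult[of "F a" "prod F A"] by auto
qed (auto simp: mvars_def)

lemma mvars_msubst:
  assumes "\<And>i. mvars (s i) \<subseteq> I"
  shows "mvars (msubst F s) \<subseteq> I"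
  unfolding msubst_def
proof (rule mvars_sum)
  fix m
  have "mvars (monom_value m s) \<subseteq> I"
    unfolding monom_value_def by (intro mvars_prod mvars_power assms)
  then show "mvars (mConst (Poly_Mapping.lookup F m) * monom_value m s) \<subseteq> I"
    using mvars_mult[of "mConst (Poly_Mapping.lookup F m)" "monom_value m s"] by auto
qed

lemma meval_restrict_poly:
  "meval (restrict_poly F k b) y = meval F (($) (\<Sum>j<k. y j *s b j))"
proof -
  have "($) (\<Sum>j<k. y j *s b j) = (\<lambda>i. \<Sum>j<k. y j * b j $ i)"
    by (rule ext) simp
  then show ?thesis by (simp add: restrict_poly_def meval_msubst mult.commute)
qed

lemma homogeneous_restrict_poly: "homogeneous d F \<Longrightarrow> homogeneous d (restrict_poly F k b)"
  unfolding restrict_poly_def by (intro homogeneous_msubst homogeneous_linear)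

lemma mvars_restrict_poly: "mvars (restrict_poly F k b) \<subseteq> {..<k}"
  unfolding restrict_poly_def
proof (rule mvars_msubst, rule mvars_sum)
  show "mvars (mConst (b j $ i) * mVar j) \<subseteq> {..<k}" if "j \<in> {..<k}" for i j
    using mvars_mult[of "mConst (b j $ i)" "mVar j"] that by auto
qed

section \<open>Polynomial functions and directional derivatives\<close>

notation scalar_product (infixl "\<odot>" 75)

lemma scalar_product_add_right [simp]: "a \<odot> (v + w) = a \<odot> v + a \<odot> (w :: complex ^ 'n)"
  by (simp add: scalar_product_def sum.distrib algebra_simps)

lemma scalar_product_scale_right [simp]: "a \<odot> (c *s v) = c * (a \<odot> (v :: complex ^ 'n))"
  by (simp add: scalar_product_def sum_distrib_left mult_ac)

lemma scalar_product_zero_right [simp]: "a \<odot> (0 :: complex ^ 'n) = 0"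
  by (simp add: scalar_product_def)

lemma scalar_product_diff_right [simp]: "a \<odot> (v - w) = a \<odot> v - a \<odot> (w :: complex ^ 'n)"
  by (simp add: scalar_product_def sum_subtractf algebra_simps)

lemma scalar_product_sum_right [simp]:
  "a \<odot> (\<Sum>i\<in>I. f i) = (\<Sum>i\<in>I. a \<odot> (f i :: complex ^ 'n))"
  by (induction I rule: infinite_finite_induct) auto

text \<open>Closure under the ring operations gives rule induction: restriction to lines,
  composition, division by linear forms and differentiation are all proved without coefficients or
  degrees.\<close>

inductive polyfun :: "(complex ^ 'n \<Rightarrow> complex) \<Rightarrow> bool" where
  const: "polyfun (\<lambda>v. c)"
| coord: "polyfun (\<lambda>v. v $ i)"
| add: "polyfun f \<Longrightarrow> polyfun g \<Longrightarrow> polyfun (\<lambda>v. f v + g v)"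
| mult: "polyfun f \<Longrightarrow> polyfun g \<Longrightarrow> polyfun (\<lambda>v. f v * g v)"

lemma polyfun_uminus: "polyfun f \<Longrightarrow> polyfun (\<lambda>v. - f v)"
  using polyfun.mult[OF polyfun.const[of "-1"], of f] by simp

lemma polyfun_diff: "polyfun f \<Longrightarrow> polyfun g \<Longrightarrow> polyfun (\<lambda>v. f v - g v)"
  using polyfun.add[OF _ polyfun_uminus, of f g] by simp

lemma polyfun_power: "polyfun f \<Longrightarrow> polyfun (\<lambda>v. f v ^ k)"
  by (induction k) (auto intro: polyfun.intros)

lemma polyfun_sum: "(\<And>i. i \<in> I \<Longrightarrow> polyfun (f i)) \<Longrightarrow> polyfun (\<lambda>v. \<Sum>i\<in>I. f i v)"
  by (induction I rule: infinite_finite_induct) (auto intro: polyfun.intros)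

lemma polyfun_prod: "(\<And>i. i \<in> I \<Longrightarrow> polyfun (f i)) \<Longrightarrow> polyfun (\<lambda>v. \<Prod>i\<in>I. f i v)"
  by (induction I rule: infinite_finite_induct) (auto intro: polyfun.intros)

lemma polyfun_scalar_product: "polyfun (\<lambda>v. a \<odot> v)"
  unfolding scalar_product_def by (intro polyfun_sum polyfun.intros)

lemmas polyfun_intros = polyfun.const polyfun.coord polyfun.add polyfun.mult polyfun_uminus
  polyfun_diff polyfun_power polyfun_sum polyfun_prod polyfun_scalar_product

lemma polyfun_meval: "polyfun (\<lambda>v :: complex ^ 'n. meval F (($) v))"
  unfolding meval_def monom_value_def by (intro polyfun_intros)

lemma polyfun_compose:
  assumes "polyfun f" "\<And>i. polyfun (\<lambda>v. g v $ i)"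
  shows "polyfun (\<lambda>v. f (g v))"
  using assms(1) by induction (auto intro: polyfun.intros assms(2))

lemma polyfun_affine:
  assumes "polyfun f"
  shows "polyfun (\<lambda>v. f (v + u))" "polyfun (\<lambda>v. f (c *s v))" "polyfun (\<lambda>v. f (v - (a \<odot> v) *s u))"
  by (auto intro!: polyfun_compose[OF assms] polyfun_intros)

text \<open>The bridge to univariate polynomials: degree and root counting are only ever used along
  lines.\<close>

lemma polyfun_line:
  assumes "polyfun f"
  obtains p where "\<And>t. f (x + t *s b) = poly p t"
proof -
  have "\<exists>p. \<forall>t. f (x + t *s b) = poly p t"
    using assms
  proof induction
    case (const c)
    show ?case by (rule exI[of _ "[:c:]"]) simp
  next
    case (coord i)
    show ?case by (rule exI[of _ "[:x $ i, b $ i:]"]) simp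
  next
    case (add f g)
    then show ?case by (metis poly_add)
  next
    case (mult f g)
    then show ?case by (metis poly_mult)
  qed
  then show ?thesis using that by blast
qed

lemma polyfun_continuous:
  assumes "polyfun f" "\<And>i. continuous_on S (\<lambda>z. g z $ i)"
  shows "continuous_on S (\<lambda>z. f (g z))"
  using assms(1) by induction (auto intro!: continuous_intros assms(2))

lemma poly_eq_0_if_eventually:
  fixes p q :: "complex poly"
  assumes "p \<noteq> 0" "\<And>t. poly p t \<noteq> 0 \<Longrightarrow> poly q t = 0"
  shows "q = 0"
proof -
  have "poly (p * q) t = 0" for t using assms(2) by auto
  then have "p * q = 0" using poly_all_0_iff_0 by blast
  then show ?thesis using assms(1) by simp
qed

text \<open>The line from p to v stays in W. On it f is a nonzero univariate polynomial, so g
  vanishes at all but finitely many of its points, hence at v. This plays the role of irreducibility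
  of W in the Zariski topology.\<close>

lemma polyfun_dense:
  assumes "polyfun f" "polyfun g" "vec.subspace W" "p \<in> W" "f p \<noteq> 0"
    and "\<And>v. v \<in> W \<Longrightarrow> f v \<noteq> 0 \<Longrightarrow> g v = 0" and "v \<in> W"
  shows "g v = 0"
proof -
  obtain r where r: "\<And>t. f (p + t *s (v - p)) = poly r t" using polyfun_line[OF assms(1)] by blast
  obtain s where s: "\<And>t. g (p + t *s (v - p)) = poly s t" using polyfun_line[OF assms(2)] by blast
  have "poly r 0 \<noteq> 0" using r[of 0] assms(5) by simp
  then have "r \<noteq> 0" by auto
  moreover have "p + t *s (v - p) \<in> W" for t
    using assms by (intro vec.subspace_add vec.subspace_scale vec.subspace_diff)
  ultimately have "s = 0"
    using poly_eq_0_if_eventually[of r s] assms(6) r s by metis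
  then show ?thesis using s[of 1] by simp
qed

lemma polyfun_dense2:
  assumes "polyfun f" "polyfun g" "vec.subspace W" "\<And>v. v \<in> W \<Longrightarrow> f v * g v = 0"
  shows "(\<forall>v\<in>W. f v = 0) \<or> (\<forall>v\<in>W. g v = 0)"
  using polyfun_dense[OF assms(1-3)] assms(4) by (metis mult_eq_0_iff)

text \<open>If \<open>a \<odot> u = 1\<close>, the shifted argument is the projection of v along u
  to the hyperplane a = 0, so this is division by a linear form with the restriction to the
  hyperplane as remainder.\<close>

lemma polyfun_split_linear:
  assumes "polyfun f"
  shows "\<exists>g. polyfun g \<and> (\<forall>v. f v = f (v - (a \<odot> v) *s u) + (a \<odot> v) * g v)"
  using assms
proof induction
  case (const c)
  show ?case by (rule exI[of _ "\<lambda>_. 0"]) (auto intro: polyfun.const)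
next
  case (coord i)
  show ?case by (rule exI[of _ "\<lambda>_. u $ i"]) (auto intro: polyfun.const)
next
  case (add f g)
  then obtain f' g' where
    *: "polyfun f'" "\<And>v. f v = f (v - (a \<odot> v) *s u) + (a \<odot> v) * f' v"
    "polyfun g'" "\<And>v. g v = g (v - (a \<odot> v) *s u) + (a \<odot> v) * g' v" by blast
  have "f v + g v = f (v - (a \<odot> v) *s u) + g (v - (a \<odot> v) *s u) + (a \<odot> v) * (f' v + g' v)" for v
    by (subst *(2), subst *(4)) (simp add: algebra_simps)
  moreover have "polyfun (\<lambda>v. f' v + g' v)" using * by (intro polyfun.add)
  ultimately show ?case by blast
next
  case (mult f g)
  then obtain f' g' where *:
    "polyfun f'" "\<And>v. f v = f (v - (a \<odot> v) *s u) + (a \<odot> v) * f' v"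
    "polyfun g'" "\<And>v. g v = g (v - (a \<odot> v) *s u) + (a \<odot> v) * g' v" by blast
  let ?h = "\<lambda>v. f (v - (a \<odot> v) *s u) * g' v + f' v * g v"
  have "polyfun ?h" using mult * by (intro polyfun_intros polyfun_affine)
  moreover have "f v * g v = f (v - (a \<odot> v) *s u) * g (v - (a \<odot> v) *s u) + (a \<odot> v) * ?h v" for v
  proof -
    have "f v * g v = (f (v - (a \<odot> v) *s u) + (a \<odot> v) * f' v) * g v" using *(2)[of v] by simp
    also have "\<dots> = f (v - (a \<odot> v) *s u) * g v + (a \<odot> v) * f' v * g v" by (simp add: algebra_simps)
    also have "f (v - (a \<odot> v) *s u) * g v = f (v - (a \<odot> v) *s u) * (g (v - (a \<odot> v) *s u) + (a \<odot> v) * g' v)"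
      using *(4)[of v] by simp
    finally show ?thesis by (simp add: algebra_simps)
  qed
  ultimately show ?case by blast
qed

lemma polyfun_divide_linear:
  assumes "polyfun f" "a \<odot> u = 1" "\<And>v. a \<odot> v = 0 \<Longrightarrow> f v = 0"
  obtains g where "polyfun g" "\<And>v. f v = (a \<odot> v) * g v"
proof -
  obtain g where g: "polyfun g" "\<forall>v. f v = f (v - (a \<odot> v) *s u) + (a \<odot> v) * g v"
    using polyfun_split_linear[OF assms(1)] by blast
  have 0: "f (v - (a \<odot> v) *s u) = 0" for v by (rule assms(3)) (simp add: assms(2))
  show ?thesis
  proof
    show "f v = (a \<odot> v) * g v" for v using g(2)[rule_format, of v] unfolding 0 by simp
  qed (rule g(1))
qed

lemma ex_scalar_product_eq_1:
  assumes "a \<odot> v \<noteq> (0 :: complex)"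
  obtains u where "a \<odot> u = 1"
  using assms by (intro that[of "(1 / (a \<odot> v)) *s v"]) simp

section \<open>Directional derivatives\<close>

definition ddir :: "complex ^ 'n \<Rightarrow> (complex ^ 'n \<Rightarrow> complex) \<Rightarrow> complex ^ 'n \<Rightarrow> complex" where
  "ddir b f x = deriv (\<lambda>t. f (x + t *s b)) 0"

lemma ddir_eqI:
  "((\<lambda>t. f (x + t *s b)) has_field_derivative D) (at 0) \<Longrightarrow> ddir b f x = D"
  unfolding ddir_def by (rule DERIV_imp_deriv)

lemma polyfun_ddir:
  assumes "polyfun f"
  shows "((\<lambda>t. f (x + t *s b)) has_field_derivative ddir b f x) (at 0)"
proof -
  obtain p where p: "\<And>t. f (x + t *s b) = poly p t" using polyfun_line[OF assms] by blast
  have "((\<lambda>t. f (x + t *s b)) has_field_derivative poly (pderiv p) 0) (at 0)"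
    unfolding p by (rule poly_DERIV)
  then show ?thesis using ddir_eqI by metis
qed

lemma ddir_const [simp]: "ddir b (\<lambda>v. c) x = 0"
  by (rule ddir_eqI) simp

lemma ddir_add: "polyfun f \<Longrightarrow> polyfun g \<Longrightarrow> ddir b (\<lambda>v. f v + g v) x = ddir b f x + ddir b g x"
  by (rule ddir_eqI) (intro DERIV_add polyfun_ddir)

lemma ddir_mult:
  assumes "polyfun f" "polyfun g"
  shows "ddir b (\<lambda>v. f v * g v) x = f x * ddir b g x + ddir b f x * g x"
  by (rule ddir_eqI) (use DERIV_mult[OF polyfun_ddir[OF assms(1)] polyfun_ddir[OF assms(2)], of x b x b] in
      \<open>simp add: algebra_simps\<close>)

lemma ddir_power:
  assumes "polyfun f"
  shows "ddir b (\<lambda>v. f v ^ k) x = of_nat k * f x ^ (k - 1) * ddir b f x"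
  by (rule ddir_eqI) (use DERIV_power[OF polyfun_ddir[OF assms], of x b k] in \<open>simp add: algebra_simps\<close>)

lemma ddir_scalar_product [simp]: "ddir b (\<lambda>v. a \<odot> v) x = a \<odot> b"
  by (rule ddir_eqI) (auto intro!: derivative_eq_intros)

lemma ddir_coord [simp]: "ddir b (\<lambda>v. v $ i) x = b $ i"
  by (rule ddir_eqI) (auto intro!: derivative_eq_intros)

lemma polyfun_ddir_polyfun:
  assumes "polyfun f"
  shows "polyfun (ddir b f)"
  using assms
proof induction
  case (const c)
  have "ddir b (\<lambda>v. c) = (\<lambda>v. 0)" by auto
  then show ?case by (simp add: polyfun.const)
next
  case (coord i)
  have "ddir b (\<lambda>v. v $ i) = (\<lambda>v. b $ i)" by auto
  then show ?case by (simp add: polyfun.const)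
next
  case (add f g)
  then have "ddir b (\<lambda>v. f v + g v) = (\<lambda>v. ddir b f v + ddir b g v)" by (auto simp: ddir_add)
  then show ?case using add by (simp add: polyfun.add)
next
  case (mult f g)
  then have "ddir b (\<lambda>v. f v * g v) = (\<lambda>v. f v * ddir b g v + ddir b f v * g v)" by (auto simp: ddir_mult)
  then show ?case using mult by (auto intro: polyfun_intros)
qed

lemma ddir_add_direction: "polyfun f \<Longrightarrow> ddir (a + b) f x = ddir a f x + ddir b f x"
  by (induction rule: polyfun.induct) (auto simp: ddir_add ddir_mult algebra_simps)

lemma ddir_scale_direction: "polyfun f \<Longrightarrow> ddir (c *s b) f x = c * ddir b f x"
  by (induction rule: polyfun.induct) (auto simp: ddir_add ddir_mult algebra_simps)

lemma ddir_zero_direction [simp]: "polyfun f \<Longrightarrow> ddir 0 f x = 0"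
  by (induction rule: polyfun.induct) (auto simp: ddir_add ddir_mult)

lemma ddir_sum_direction:
  "polyfun f \<Longrightarrow> ddir (\<Sum>i\<in>I. c i *s b i) f x = (\<Sum>i\<in>I. c i * ddir (b i) f x)"
  by (induction I rule: infinite_finite_induct) (auto simp: ddir_add_direction ddir_scale_direction)

text \<open>Chain rule for f (t x + s b) = t^k f (x + (s/t) b); the quotient s/t is the reason for
  excluding t = 0.\<close>

lemma ddir_homogeneous:
  assumes "polyfun f" "\<And>v. f (t *s v) = t ^ k * f v" "t \<noteq> 0" "k > 0"
  shows "ddir b f (t *s x) = t ^ (k - 1) * ddir b f x"
proof -
  have "((\<lambda>s. t ^ k * f (x + (s * inverse t) *s b)) has_field_derivative t ^ k * (ddir b f x * inverse t)) (at 0)"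
    by (intro DERIV_cmult DERIV_chain2[where f = "\<lambda>t. f (x + t *s b)"])
       (auto intro!: derivative_eq_intros simp: polyfun_ddir[OF assms(1)])
  moreover have "t ^ k * f (x + (s * inverse t) *s b) = f (t *s x + s *s b)" for s
  proof -
    have "t *s (x + (s * inverse t) *s b) = t *s x + s *s b"
      using assms(3) by (simp add: vec.scale_right_distrib)
    then show ?thesis by (metis assms(2))
  qed
  moreover have "t ^ k * (ddir b f x * inverse t) = t ^ (k - 1) * ddir b f x"
    using assms(3,4) by (simp add: power_diff field_simps)
  ultimately show ?thesis by (intro ddir_eqI) simp
qed

lemma ddir_translate:
  assumes "\<And>v. f (v + u) = f v"
  shows "ddir b f (x + u) = ddir b f x"
proof -
  have "x + u + t *s b = (x + t *s b) + u" for t by (simp add: algebra_simps)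
  then show ?thesis unfolding ddir_def by (simp only: assms)
qed

section \<open>Formal partial derivatives as directional derivatives\<close>

lemma mpderiv_supset:
  assumes "finite A" "Poly_Mapping.keys F \<subseteq> A"
  shows "mpderiv i F = (\<Sum>m\<in>A. Poly_Mapping.single (m - Poly_Mapping.single i 1)
     (of_nat (Poly_Mapping.lookup m i) * Poly_Mapping.lookup F m))"
  unfolding mpderiv_def
  by (rule sum.mono_neutral_left) (use assms in \<open>auto simp: in_keys_iff\<close>)

lemma mpderiv_add: "mpderiv i (F + G) = mpderiv i F + mpderiv i G"
proof -
  let ?A = "Poly_Mapping.keys F \<union> Poly_Mapping.keys G"
  have "Poly_Mapping.keys (F + G) \<subseteq> ?A" by (rule keys_add)
  then show ?thesis
    by (simp add: mpderiv_supset[of ?A] lookup_add sum.distrib single_add algebra_simps)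
qed

lemma mpderiv_single:
  "mpderiv i (Poly_Mapping.single m c) =
    Poly_Mapping.single (m - Poly_Mapping.single i 1) (of_nat (Poly_Mapping.lookup m i) * c)"
  by (simp add: mpderiv_def)

lemma monom_value_UNIV: "monom_value m (x :: 'i::finite \<Rightarrow> 'a::comm_semiring_1) = (\<Prod>i\<in>UNIV. x i ^ Poly_Mapping.lookup m i)"
  by (rule monom_value_supset) auto

lemma ddir_monom_value:
  "ddir b (\<lambda>v. monom_value m (($) v)) x =
    (\<Sum>i\<in>UNIV. of_nat (Poly_Mapping.lookup m i) * monom_value (m - Poly_Mapping.single i 1) (($) x) * b $ i)"
proof (rule ddir_eqI)
  have "((\<lambda>t. \<Prod>i\<in>UNIV. (x $ i + t * b $ i) ^ Poly_Mapping.lookup m i) has_field_derivative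
    (\<Sum>i\<in>UNIV. (of_nat (Poly_Mapping.lookup m i) * b $ i * x $ i ^ (Poly_Mapping.lookup m i - 1)) *
        (\<Prod>j\<in>UNIV - {i}. x $ j ^ Poly_Mapping.lookup m j))) (at 0)"
  proof -
    have "((\<lambda>t. (x $ i + t * b $ i) ^ Poly_Mapping.lookup m i) has_field_derivative
        of_nat (Poly_Mapping.lookup m i) * b $ i * x $ i ^ (Poly_Mapping.lookup m i - 1)) (at 0)" for i
      by (auto intro!: derivative_eq_intros)
    from has_field_derivative_prod[where A = UNIV, OF this] show ?thesis by simp
  qed
  moreover have "of_nat (Poly_Mapping.lookup m i) * b $ i * x $ i ^ (Poly_Mapping.lookup m i - 1) *
        (\<Prod>j\<in>UNIV - {i}. x $ j ^ Poly_Mapping.lookup m j)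
      = of_nat (Poly_Mapping.lookup m i) * monom_value (m - Poly_Mapping.single i 1) (($) x) * b $ i" for i
  proof -
    have "monom_value (m - Poly_Mapping.single i 1) (($) x) =
        x $ i ^ (Poly_Mapping.lookup m i - 1) * (\<Prod>j\<in>UNIV - {i}. x $ j ^ Poly_Mapping.lookup m j)"
      unfolding monom_value_UNIV
      by (subst prod.remove[of _ i]) (auto simp: lookup_minus lookup_single when_def intro!: prod.cong)
    then show ?thesis by simp
  qed
  ultimately show "((\<lambda>t. monom_value m (($) (x + t *s b))) has_field_derivative
     (\<Sum>i\<in>UNIV. of_nat (Poly_Mapping.lookup m i) * monom_value (m - Poly_Mapping.single i 1) (($) x) * b $ i)) (at 0)"
    by (simp only: monom_value_UNIV[of m] vector_add_component vector_smult_component)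
qed

lemma polyfun_monom_value: "polyfun (\<lambda>v. monom_value m (($) v))"
  unfolding monom_value_def by (intro polyfun_intros)

lemma sum_mpderiv_eq_ddir:
  "(\<Sum>i\<in>UNIV. meval (mpderiv i F) (($) x) * b $ i) = ddir b (\<lambda>v. meval F (($) v)) x"
proof (induction F rule: mpoly_induct)
  case (single m c)
  show ?case
    by (simp add: ddir_mult polyfun.const polyfun_monom_value ddir_monom_value mpderiv_single
        sum_distrib_left mult_ac)
next
  case (add F G)
  then show ?case
    by (simp add: mpderiv_add ddir_add[OF polyfun_meval polyfun_meval] sum.distrib algebra_simps)
qed

section \<open>The equation along a subspace of star points\<close>

lemma ex_scalar_product_extend:
  fixes B :: "(complex ^ 'n) set"
  assumes "vec.independent B"
  obtains m where "\<And>b. b \<in> B \<Longrightarrow> m \<odot> b = f b"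
proof -
  fix i0 :: 'n
  \<comment> \<open>The prescribed values are put on a single axis, so that a linear map into
    \<open>complex ^ 'n\<close> stands for a functional; \<open>m\<close> is the corresponding row
    of its matrix.\<close>
  obtain g where g: "Vector_Spaces.linear (*s) (*s) g" "\<forall>x\<in>B. g x = f x *s axis i0 (1::complex)"
    using vec.linear_independent_extend[OF assms, of "\<lambda>x. f x *s axis i0 1"] by blast
  define m where "m = (\<chi> i. g (axis i 1) $ i0)"
  have "m \<odot> v = g v $ i0" for v
  proof -
    have "g v = g (\<Sum>i\<in>UNIV. v $ i *s axis i 1)" by (simp add: basis_expansion)
    also have "\<dots> = (\<Sum>i\<in>UNIV. v $ i *s g (axis i 1))"
      using g(1) by (simp add: vec.linear_sum vec.linear_scale)
    finally show ?thesis by (simp add: m_def scalar_product_def mult.commute)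
  qed
  then have "m \<odot> b = f b" if "b \<in> B" for b
    using g(2) that by (simp add: axis_def)
  then show ?thesis by (rule that)
qed

lemma ex_scalar_product_separating:
  assumes "vec.subspace W" "u \<notin> W"
  obtains m :: "complex ^ 'n" where "\<And>w. w \<in> W \<Longrightarrow> m \<odot> w = 0" "m \<odot> u = 1"
proof -
  obtain B where B: "B \<subseteq> W" "vec.independent B" "W \<subseteq> vec.span B"
    using vec.maximal_independent_subset[of W] by blast
  have sp: "vec.span B = W" using B assms(1) by (metis vec.span_minimal subset_antisym)
  then have "vec.independent (insert u B)"
    using B(2) assms(2) by (simp add: vec.independent_insert)
  then obtain m where m: "\<And>b. b \<in> insert u B \<Longrightarrow> m \<odot> b = (if b = u then 1 else 0)"
    using ex_scalar_product_extend[of "insert u B" "\<lambda>b. if b = u then 1 else 0"] by blast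
  have "m \<odot> w = 0" if "w \<in> W" for w
  proof -
    have "w \<in> vec.span B" using that sp by simp
    then show ?thesis
    proof (induction rule: vec.span_induct_alt)
      case (step c x y)
      then have "x \<noteq> u" using B(1) assms(2) by auto
      then show ?case using step m[of x] by simp
    qed simp
  qed
  then show ?thesis using that[of m] m[of u] by simp
qed

lemma subspace_scalar_product: "vec.subspace {v :: complex ^ 'n. a \<odot> v = 0}"
  by (simp add: vec.subspace_def)

lemma dim_insert_subspace:
  fixes W :: "(complex ^ 'n) set"
  assumes "vec.subspace W" "u \<notin> W"
  shows "vec.dim (vec.span (insert u W)) = vec.dim W + 1"
  using assms by (simp add: vec.dim_insert vec.span_eq_iff[THEN iffD2])

lemma mem_span_insert_subspace:
  fixes W :: "(complex ^ 'n) set"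
  assumes "vec.subspace W"
  shows "v \<in> vec.span (insert u W) \<longleftrightarrow> (\<exists>k. v - k *s u \<in> W)"
  using assms by (simp add: vec.span_breakdown_eq vec.span_eq_iff[THEN iffD2])

lemma subspace_eq_span_insert:
  fixes W :: "(complex ^ 'n) set"
  assumes "vec.subspace W" "vec.subspace H" "W \<subseteq> H" "u \<in> H" "u \<notin> W" "vec.dim H = vec.dim W + 1"
  shows "H = vec.span (insert u W)"
proof -
  have "vec.span (insert u W) \<subseteq> H" using assms by (intro vec.span_minimal) auto
  moreover have "vec.dim H \<le> vec.dim (vec.span (insert u W))"
    using assms dim_insert_subspace[OF assms(1,5)] by linarith
  ultimately show ?thesis using assms(2) vec.subspace_dim_equal vec.subspace_span by metis
qed

lemma dim_hyperplane:
  fixes a :: "complex ^ 'n"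
  assumes "a \<odot> u \<noteq> 0"
  shows "vec.dim {v. a \<odot> v = 0} + 1 = CARD('n)"
proof -
  let ?H = "{v. a \<odot> v = 0}"
  have "v \<in> vec.span (insert u ?H)" for v
    unfolding mem_span_insert_subspace[OF subspace_scalar_product]
    by (rule exI[of _ "(a \<odot> v) / (a \<odot> u)"]) (use assms in simp)
  then have "vec.span (insert u ?H) = UNIV" by auto
  then show ?thesis
    using dim_insert_subspace[OF subspace_scalar_product, of u a] assms
    by (simp add: card_cart_basis)
qed

lemma coord_system_expand:
  assumes "coord_system W k b" "x \<in> W"
  obtains y where "x = (\<Sum>j<k. y j *s b j)"
proof -
  have "x \<in> vec.span (b ` {..<k})" using assms by (simp add: coord_system_def)
  then obtain u where "x = (\<Sum>v\<in>b ` {..<k}. u v *s v)"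
    unfolding vec.span_finite[OF finite_imageI[OF finite_lessThan]] by auto
  then have "x = (\<Sum>j<k. u (b j) *s b j)"
    using assms(1) by (simp add: coord_system_def sum.reindex)
  then show ?thesis by (rule that)
qed

lemma coord_system_mem: "coord_system W k b \<Longrightarrow> (\<Sum>j<k. y j *s b j) \<in> W"
  unfolding coord_system_def
  by (auto intro!: vec.span_sum vec.span_scale intro: vec.span_base)

lemma meval_cong_mvars:
  assumes "\<And>i. i \<in> mvars F \<Longrightarrow> x i = y i"
  shows "meval F x = meval F y"
proof -
  have "x i = y i" if "m \<in> Poly_Mapping.keys F" "i \<in> Poly_Mapping.keys m" for m i
    using assms that by (auto simp: mvars_def)
  then show ?thesis unfolding meval_def monom_value_def
    by (intro sum.cong prod.cong arg_cong2[of _ _ _ _ "(*)"]) auto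
qed

lemma meval_line_through_0:
  obtains p where "\<And>t. meval F (\<lambda>i. t * x i) = poly p t"
proof -
  have "\<exists>p. \<forall>t. meval F (\<lambda>i. t * x i) = poly p t"
  proof (induction F rule: mpoly_induct)
    case (single m c)
    have "monom_value m (\<lambda>i. t * x i) = t ^ mdeg m * monom_value m x" for t
      by (simp add: monom_value_def mdeg_def power_mult_distrib prod.distrib flip: power_sum)
    then show ?case
      by (intro exI[of _ "monom (c * monom_value m x) (mdeg m)"]) (simp add: poly_monom)
  next
    case (add F G)
    then show ?case by (metis meval_add poly_add)
  qed
  then show ?thesis using that by blast
qed

text \<open>A quotient of two forms of equal degree is a scalar, namely the constant term of H. On
  the ray through a point with G nonzero, F and G scale by the same power of t, so H is constant on
  the ray and equals its value at the origin.\<close>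

lemma meval_homogeneous_quotient:
  assumes "homogeneous d F" "homogeneous d G" "F = G * H"
  shows "meval F x = meval H (\<lambda>i. 0) * meval G x"
proof (cases "meval G x = 0")
  case True
  then show ?thesis using assms(3) by simp
next
  case False
  obtain p where p: "\<And>t. meval H (\<lambda>i. t * x i) = poly p t" using meval_line_through_0 by blast
  \<comment> \<open>The polynomial \<open>[:0, 1:]\<close> encodes the condition t \<noteq> 0 in the
    form that \<open>poly_eq_0_if_eventually\<close> expects; the device recurs below.\<close>
  have "poly (p - [:meval H x:]) t = 0" if "poly [:0, 1:] t \<noteq> 0" for t
  proof -
    have t: "t \<noteq> 0" using that by simp
    have "t ^ d * meval F x = (t ^ d * meval G x) * poly p t"
      unfolding meval_homogeneous[OF assms(1), of t x, symmetric]
        meval_homogeneous[OF assms(2), of t x, symmetric] p[symmetric]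
      by (simp add: assms(3))
    then have "meval G x * meval H x = meval G x * poly p t"
      using t assms(3) by simp
    then show ?thesis using False by simp
  qed
  then have "p - [:meval H x:] = 0" by (rule poly_eq_0_if_eventually[of "[:0, 1:]", rotated]) auto
  then have "p = [:meval H x:]" by simp
  then have "meval H (\<lambda>i. 0) = meval H x" using p[of 0] by simp
  then show ?thesis using assms(3) by simp
qed

text \<open>All that is used of a star point. G divides the restriction, so the two agree up to a
  scalar; G is free of the coordinate belonging to \<open>b 0 = P\<close>, so moving along P changes
  nothing. Divisibility in the other direction, with G nonzero, keeps \<phi> from vanishing on the
  tangent hyperplane.\<close>

lemma star_pointD:
  fixes F :: "'n::finite mpoly"
  defines "\<phi> \<equiv> \<lambda>v. meval F (($) v)"
  assumes "star_point d F P" "homogeneous d F" "CARD('n) \<ge> 2"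
  shows "\<exists>b. ddir b \<phi> P \<noteq> 0"
    and "ddir x \<phi> P = 0 \<Longrightarrow> \<phi> (x + t *s P) = \<phi> x"
    and "\<exists>x. ddir x \<phi> P = 0 \<and> \<phi> x \<noteq> 0"
proof -
  define N where "N = CARD('n) - 1"
  let ?T = "tangent_hyperplane F P"
  have T: "x \<in> ?T \<longleftrightarrow> ddir x \<phi> P = 0" for x
    by (simp add: tangent_hyperplane_def sum_mpderiv_eq_ddir \<phi>_def)
  obtain b G where bG: "coord_system ?T N b" "b 0 = P" "G \<noteq> 0" "homogeneous d G" "mvars G \<subseteq> {1..<N}"
    "G dvd restrict_poly F N b" "restrict_poly F N b dvd G"
    using assms(2) unfolding star_point_def by (auto simp: Let_def N_def)
  obtain H where H: "restrict_poly F N b = G * H" using bG(6) by (rule dvdE)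
  have eq: "\<phi> (\<Sum>j<N. y j *s b j) = meval H (\<lambda>i. 0) * meval G y" for y
    unfolding \<phi>_def meval_restrict_poly[symmetric]
    by (rule meval_homogeneous_quotient[OF homogeneous_restrict_poly[OF assms(3)] bG(4) H])
  have "smooth_point F P" using assms(2) by (simp add: star_point_def)
  then obtain i where "meval (mpderiv i F) (($) P) \<noteq> 0" by (auto simp: smooth_point_def)
  moreover have "ddir (axis i 1) \<phi> P = meval (mpderiv i F) (($) P)"
    unfolding \<phi>_def sum_mpderiv_eq_ddir[symmetric]
    by (simp add: axis_def if_distrib sum.delta cong: if_cong)
  ultimately show "\<exists>b. ddir b \<phi> P \<noteq> 0" by metis
  show "\<phi> (x + t *s P) = \<phi> x" if x: "ddir x \<phi> P = 0"
  proof -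
    \<comment> \<open>Otherwise P = \<open>b 0\<close> would not be among the basis vectors
      \<open>b j\<close> with j < N.\<close>
    have "N > 0" using assms(4) by (simp add: N_def)
    obtain y where y: "x = (\<Sum>j<N. y j *s b j)"
      using coord_system_expand[OF bG(1)] T x by blast
    have "x + t *s P = (\<Sum>j<N. (y j + (if j = 0 then t else 0)) *s b j)"
      using \<open>N > 0\<close> unfolding y
      by (simp add: vec.scale_left_distrib sum.distrib if_distrib[of "\<lambda>c. c *s _"] sum.delta bG(2) cong: if_cong)
    then have "\<phi> (x + t *s P) = meval H (\<lambda>i. 0) * meval G (\<lambda>j. y j + (if j = 0 then t else 0))"
      by (simp only: eq)
    also have "meval G (\<lambda>j. y j + (if j = 0 then t else 0)) = meval G y"
      by (rule meval_cong_mvars) (use bG(5) in auto)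
    finally show ?thesis by (simp add: y eq)
  qed
  have "\<exists>y. meval G y \<noteq> 0" using bG(3) meval_eq_0_imp by blast
  then obtain y where y: "meval G y \<noteq> 0" by blast
  then have "\<phi> (\<Sum>j<N. y j *s b j) \<noteq> 0"
    using meval_dvd[OF bG(7), of y] unfolding \<phi>_def meval_restrict_poly by blast
  moreover have "ddir (\<Sum>j<N. y j *s b j) \<phi> P = 0"
    using coord_system_mem[OF bG(1)] T by blast
  ultimately show "\<exists>x. ddir x \<phi> P = 0 \<and> \<phi> x \<noteq> 0" by blast
qed

text \<open>The hyperplane \<open>\<alpha> = 0\<close> meets the hypersurface \<open>\<phi> = 0\<close> in the \<open>d\<close>-fold subspace \<open>\<Lambda>\<close>.\<close>

definition total_tangency ::
  "nat \<Rightarrow> (complex ^ 'n \<Rightarrow> complex) \<Rightarrow> (complex ^ 'n) set \<Rightarrow> complex ^ 'n \<Rightarrow> complex ^ 'n \<Rightarrow>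
    (complex ^ 'n \<Rightarrow> complex) \<Rightarrow> complex \<Rightarrow> bool" where
  "total_tangency d \<phi> \<Lambda> \<alpha> \<mu> A c \<longleftrightarrow>
     polyfun A \<and> c \<noteq> 0 \<and> (\<exists>u. \<alpha> \<odot> u = 0 \<and> \<mu> \<odot> u = 1) \<and> (\<exists>a. \<alpha> \<odot> a = 1 \<and> \<mu> \<odot> a = 0) \<and>
     \<Lambda> = {v. \<alpha> \<odot> v = 0 \<and> \<mu> \<odot> v = 0} \<and> (\<forall>v. \<phi> v = (\<alpha> \<odot> v) * A v + c * (\<mu> \<odot> v) ^ d) \<and>
     (\<exists>P\<in>\<Lambda>. A P \<noteq> 0)"

lemma three_power_less_four_power: "e \<ge> 2 \<Longrightarrow> 3 ^ e + 1 < (4 :: nat) ^ e"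
  by (induction e rule: dec_induct) auto

text \<open>
  The Gauss map is constant along a linear subspace of star points: the \<open>2 \<times> 2\<close> minors
  \<open>W P x\<close> of its differential forms satisfy \<open>W (P + s x) (P + t x) = (t - s)\<^bsup>d-1\<^esup> W P x\<close>, which
  is compatible with the Pluecker relation for four points only if \<open>d - 1 = 1\<close> or \<open>W = 0\<close>.
\<close>

lemma gauss_map_constant:
  fixes \<phi> :: "complex ^ 'n \<Rightarrow> complex"
  assumes \<phi>: "polyfun \<phi>" and hom: "\<And>t v. \<phi> (t *s v) = t ^ d * \<phi> v" and d: "d \<ge> 3"
    and \<Lambda>: "vec.subspace \<Lambda>" and zero: "\<And>v. v \<in> \<Lambda> \<Longrightarrow> \<phi> v = 0"
    and g: "polyfun g" "P1 \<in> \<Lambda>" "g P1 \<noteq> 0"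
    and cone: "\<And>P x t. P \<in> \<Lambda> \<Longrightarrow> g P \<noteq> 0 \<Longrightarrow> ddir x \<phi> P = 0 \<Longrightarrow> \<phi> (x + t *s P) = \<phi> x"
    and P: "P \<in> \<Lambda>" and x: "x \<in> \<Lambda>"
  shows "ddir b \<phi> P * ddir a \<phi> x = ddir a \<phi> P * ddir b \<phi> x"
proof -
  define W where "W P x = ddir b \<phi> P * ddir a \<phi> x - ddir a \<phi> P * ddir b \<phi> x" for P x
  have pf: "polyfun (ddir c \<phi>)" for c by (rule polyfun_ddir_polyfun[OF \<phi>])
  have tangent: "ddir x \<phi> v = 0" if "v \<in> \<Lambda>" "x \<in> \<Lambda>" for v x
  proof (rule ddir_eqI)
    have "(\<lambda>t. \<phi> (v + t *s x)) = (\<lambda>t. 0)"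
      using that \<Lambda> by (auto intro!: zero vec.subspace_add vec.subspace_scale)
    then show "((\<lambda>t. \<phi> (v + t *s x)) has_field_derivative 0) (at 0)" by simp
  qed
  have W_translate: "W P (x + t *s P) = W P x" if P: "P \<in> \<Lambda>" and x: "x \<in> \<Lambda>" for P x t
  proof -
    have "W v (x + t *s v) - W v x = 0" if v: "v \<in> \<Lambda>" "g v \<noteq> 0" for v
    proof -
      \<comment> \<open>This combination of a and b is annihilated by the differential of \<phi> at
        v, since \<open>W v v = 0\<close>. Hence every x + s u is tangent at v, the cone property
        applies to it, and differentiating in s yields the claim about W.\<close>
      define u where "u = ddir b \<phi> v *s a + (- ddir a \<phi> v) *s b"
      have u: "ddir u \<phi> z = W v z" for z
        by (simp add: u_def W_def ddir_add_direction[OF \<phi>] ddir_scale_direction[OF \<phi>] del: vec.scale_minus_left)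
      have "\<phi> ((x + t *s v) + s *s u) = \<phi> (x + s *s u)" for s
      proof -
        have "ddir (x + s *s u) \<phi> v = 0"
          using tangent[OF v(1) x] u[of v]
          by (simp add: ddir_add_direction[OF \<phi>] ddir_scale_direction[OF \<phi>] W_def)
        from cone[OF v this, of t] show ?thesis by (simp add: add_ac)
      qed
      then have "ddir u \<phi> (x + t *s v) = ddir u \<phi> x" by (simp add: ddir_def)
      then show ?thesis by (simp add: u)
    qed
    then have "W P (x + t *s P) - W P x = 0"
      by (rule polyfun_dense[OF g(1) _ \<Lambda> g(2,3) _ P, rotated])
         (auto simp: W_def intro!: polyfun_intros pf polyfun_compose[OF pf])
    then show ?thesis by simp
  qed
  have W_anti: "W P x = - W x P" for P x by (simp add: W_def)
  have W_scale: "W P (s *s x) = s ^ (d - 1) * W P x" if "s \<noteq> 0" for P s x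
    using that d by (simp add: W_def ddir_homogeneous[OF \<phi> hom] algebra_simps)
  have W_line: "W (P + s *s x) (P + t *s x) = (t - s) ^ (d - 1) * W P x" if "t \<noteq> s" for s t
  proof -
    have Ps: "P + s *s x \<in> \<Lambda>" and tx: "(t - s) *s x \<in> \<Lambda>"
      using P x vec.subspace_add[OF \<Lambda>] vec.subspace_scale[OF \<Lambda>] by blast+
    have "P + t *s x = (t - s) *s x + 1 *s (P + s *s x)" by (simp add: algebra_simps)
    then have "W (P + s *s x) (P + t *s x) = W (P + s *s x) ((t - s) *s x)"
      by (simp only: W_translate[OF Ps tx])
    also have "\<dots> = (t - s) ^ (d - 1) * W (P + s *s x) x" using that by (intro W_scale) simp
    also have "W (P + s *s x) x = - W x (P + s *s x)" by (rule W_anti)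
    also have "W x (P + s *s x) = W x P" by (rule W_translate[OF x P])
    also have "- W x P = W P x" using W_anti[of P x] by simp
    finally show ?thesis .
  qed
  define Q where "Q s = P + s *s x" for s
  \<comment> \<open>With e = d - 1, the parameters 0, 1, 2, 3 give the three products 1, 2^e 2^e and
    3^e times the square of \<open>W P x\<close>. The equation 1 + 3^e = 4^e holds for e = 1 and
    fails for e \<ge> 2; this is where d \<ge> 3 enters.\<close>
  have "W (Q 0) (Q 1) * W (Q 2) (Q 3) - W (Q 0) (Q 2) * W (Q 1) (Q 3) + W (Q 0) (Q 3) * W (Q 1) (Q 2) = 0"
    unfolding W_def by algebra
  moreover have "W (Q s) (Q t) = (t - s) ^ (d - 1) * W P x" if "t \<noteq> s" for s t
    using W_line[OF that] by (simp add: Q_def)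
  ultimately have "W P x * W P x * (1 - 2 ^ (d - 1) * 2 ^ (d - 1) + 3 ^ (d - 1)) = 0"
    by (simp add: algebra_simps)
  moreover have "1 - 2 ^ (d - 1) * 2 ^ (d - 1) + 3 ^ (d - 1) \<noteq> (0 :: complex)"
  proof
    assume "1 - 2 ^ (d - 1) * 2 ^ (d - 1) + 3 ^ (d - 1) = (0 :: complex)"
    then have "(of_nat (3 ^ (d - 1) + 1) :: complex) = of_nat (4 ^ (d - 1))"
      by (simp add: algebra_simps flip: power_mult_distrib)
    then have "(3 ^ (d - 1) + 1 :: nat) = 4 ^ (d - 1)" by (simp only: of_nat_eq_iff)
    moreover have "2 \<le> d - 1" using d by linarith
    ultimately show False using three_power_less_four_power[of "d - 1"] by linarith
  qed
  ultimately have "W P x = 0" by simp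
  then show ?thesis by (simp add: W_def)
qed

text \<open>General points of \<Lambda> share one tangent hyperplane, so on it \<phi> is invariant
  under a dense part of \<Lambda> and then under all of \<Lambda>. The quotient of the hyperplane by
  \<Lambda> is a line, on which a form of degree d is a multiple of the d-th power of the coordinate
  \<mu>.\<close>

lemma star_subspace_total_tangency:
  fixes F :: "'n::finite mpoly"
  defines "\<phi> \<equiv> \<lambda>v. meval F (($) v)"
  assumes F: "homogeneous d F" and d: "d \<ge> 3" and S: "\<Lambda> \<in> star_subspaces d F"
  obtains \<alpha> \<mu> A c where "total_tangency d \<phi> \<Lambda> \<alpha> \<mu> A c"
proof -
  have \<phi>: "polyfun \<phi>" unfolding \<phi>_def by (rule polyfun_meval)
  have hom: "\<phi> (t *s v) = t ^ d * \<phi> v" for t v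
  proof -
    have "($) (t *s v) = (\<lambda>i. t * v $ i)" by (rule ext) simp
    then show ?thesis by (simp add: \<phi>_def meval_homogeneous[OF F])
  qed
  have \<Lambda>: "vec.subspace \<Lambda>" and dim: "vec.dim \<Lambda> + 2 = CARD('n)"
    and zeros: "\<Lambda> - {0} \<subseteq> proj_zeros F" and gen: "general_element \<Lambda> (star_point d F)"
    using S by (auto simp: star_subspaces_def proj_dim_def card_cart_basis)
  have card: "CARD('n) \<ge> 2" using dim by simp
  have zero: "\<phi> v = 0" if "v \<in> \<Lambda>" for v
  proof (cases "v = 0")
    case True
    then show ?thesis using hom[of 0 0] d by (simp add: power_0_left)
  qed (use that zeros in \<open>auto simp: proj_zeros_def \<phi>_def\<close>)
  obtain g P1 where g: "polyfun g" "P1 \<in> \<Lambda>" "g P1 \<noteq> 0"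
    and star: "\<And>v. v \<in> \<Lambda> \<Longrightarrow> g v \<noteq> 0 \<Longrightarrow> star_point d F v"
  proof -
    obtain U K where U: "U = {v \<in> \<Lambda>. v \<noteq> 0 \<and> (\<exists>f\<in>K. meval f (($) v) \<noteq> 0)}" "U \<noteq> {}"
      "\<forall>P\<in>U. star_point d F P"
      using gen unfolding general_element_def zariski_open_in_def by blast
    then obtain P1 f where P1: "P1 \<in> \<Lambda>" "P1 \<noteq> 0" "f \<in> K" "meval f (($) P1) \<noteq> 0" by auto
    obtain i where i: "P1 $ i \<noteq> 0" using P1(2) by (auto simp: vec_eq_iff)
    show ?thesis
    \<comment> \<open>The coordinate factor excludes the origin, which lies in the vector subspace
      \<Lambda> but represents no point.\<close>
    proof (rule that[of "\<lambda>v. meval f (($) v) * v $ i" P1])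
      show "polyfun (\<lambda>v. meval f (($) v) * v $ i)" by (intro polyfun_intros polyfun_meval)
      show "star_point d F v" if "v \<in> \<Lambda>" "meval f (($) v) * v $ i \<noteq> 0" for v
      proof -
        have "v \<noteq> 0" using that by auto
        then have "v \<in> U" using that P1 U(1) by auto
        then show ?thesis using U(3) by blast
      qed
    qed (use P1 i in auto)
  qed
  have star_props:
    "\<exists>b. ddir b \<phi> P \<noteq> 0"
    "ddir x \<phi> P = 0 \<Longrightarrow> \<phi> (x + t *s P) = \<phi> x"
    "\<exists>x. ddir x \<phi> P = 0 \<and> \<phi> x \<noteq> 0" if "P \<in> \<Lambda>" "g P \<noteq> 0" for P x t
    unfolding \<phi>_def using star_pointD[OF star[OF that] F card] by auto
  have cone: "\<phi> (x + t *s P) = \<phi> x" if "P \<in> \<Lambda>" "g P \<noteq> 0" "ddir x \<phi> P = 0" for P x t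
    using star_props(2)[OF that(1,2,3)] .
  have const: "ddir b \<phi> P * ddir a \<phi> x = ddir a \<phi> P * ddir b \<phi> x"
    if "P \<in> \<Lambda>" "x \<in> \<Lambda>" for P x a b
    by (rule gauss_map_constant[OF \<phi> hom d \<Lambda> _ g _ that]) (use zero cone in blast)+
  obtain b0 where b0: "ddir b0 \<phi> P1 \<noteq> 0" using star_props(1)[OF g(2,3)] by blast
  define \<alpha> where "\<alpha> = (\<chi> i. meval (mpderiv i F) (($) P1))"
  have \<alpha>: "\<alpha> \<odot> v = ddir v \<phi> P1" for v
    by (simp add: \<alpha>_def scalar_product_def \<phi>_def flip: sum_mpderiv_eq_ddir)
  let ?H = "{v. \<alpha> \<odot> v = 0}"
  have translate: "\<phi> (x + P) = \<phi> x" if x: "\<alpha> \<odot> x = 0" and P: "P \<in> \<Lambda>" for x P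
  proof -
    have "\<phi> (x + v) - \<phi> x = 0" if v: "v \<in> \<Lambda>" "g v \<noteq> 0" for v
    proof -
      have "ddir x \<phi> v * ddir b0 \<phi> P1 = 0"
        using const[OF v(1) g(2), of x b0] x by (simp add: \<alpha>)
      then have "ddir x \<phi> v = 0" using b0 by simp
      from cone[OF v this, of 1] show ?thesis by simp
    qed
    then have "\<phi> (x + P) - \<phi> x = 0"
      by (rule polyfun_dense[OF g(1) _ \<Lambda> g(2,3) _ P, rotated])
         (auto intro!: polyfun_intros polyfun_compose[OF \<phi>])
    then show ?thesis by simp
  qed
  have \<Lambda>H: "\<Lambda> \<subseteq> ?H"
  proof
    fix x assume x: "x \<in> \<Lambda>"
    have "(\<lambda>t. \<phi> (P1 + t *s x)) = (\<lambda>t. 0)"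
      using x g(2) \<Lambda> by (auto intro!: zero vec.subspace_add vec.subspace_scale)
    then have "ddir x \<phi> P1 = 0" by (intro ddir_eqI) simp
    then show "x \<in> ?H" by (simp add: \<alpha>)
  qed
  have dimH: "vec.dim ?H = vec.dim \<Lambda> + 1"
    using dim_hyperplane[of \<alpha> b0] b0 dim by (simp add: \<alpha>)
  then obtain u where u: "\<alpha> \<odot> u = 0" "u \<notin> \<Lambda>"
    using \<Lambda>H by (metis (mono_tags, lifting) add_cancel_left_right mem_Collect_eq subsetI subset_antisym zero_neq_one)
  have H: "?H = vec.span (insert u \<Lambda>)"
    using u by (intro subspace_eq_span_insert[OF \<Lambda> subspace_scalar_product \<Lambda>H _ _ dimH]) auto
  obtain \<mu> where \<mu>: "\<And>w. w \<in> \<Lambda> \<Longrightarrow> \<mu> \<odot> w = 0" "\<mu> \<odot> u = 1"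
    using ex_scalar_product_separating[OF \<Lambda> u(2)] by blast
  have onH: "v - (\<mu> \<odot> v) *s u \<in> \<Lambda>" if v: "\<alpha> \<odot> v = 0" for v
  proof -
    obtain k where k: "v - k *s u \<in> \<Lambda>"
      using v H mem_span_insert_subspace[OF \<Lambda>] by (metis (mono_tags, lifting) mem_Collect_eq)
    then have "\<mu> \<odot> v = k" using \<mu>(1)[OF k] \<mu>(2) by simp
    then show ?thesis using k by simp
  qed
  define c where "c = \<phi> u"
  have \<phi>H: "\<phi> v = c * (\<mu> \<odot> v) ^ d" if v: "\<alpha> \<odot> v = 0" for v
    using translate[OF _ onH[OF v], of "(\<mu> \<odot> v) *s u"] u by (simp add: hom c_def)
  have c: "c \<noteq> 0" using star_props(3)[OF g(2,3)] \<phi>H by (auto simp: \<alpha>)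
  obtain a' where a': "\<alpha> \<odot> a' = 1" using ex_scalar_product_eq_1[of \<alpha> b0] b0 by (auto simp: \<alpha>)
  have "polyfun (\<lambda>v. \<phi> v - c * (\<mu> \<odot> v) ^ d)" by (intro polyfun_intros \<phi>)
  then obtain A where A: "polyfun A" "\<And>v. \<phi> v - c * (\<mu> \<odot> v) ^ d = (\<alpha> \<odot> v) * A v"
    by (rule polyfun_divide_linear[OF _ a']) (use \<phi>H in auto)
  have \<phi>A: "\<phi> v = (\<alpha> \<odot> v) * A v + c * (\<mu> \<odot> v) ^ d" for v using A(2)[of v] by (simp add: algebra_simps)
  \<comment> \<open>\<alpha> was defined as the differential of \<phi> at P1, whereas the normal
    form gives \<open>A P1\<close> times \<alpha> for it.\<close>
  have "\<alpha> \<odot> b0 = (\<alpha> \<odot> b0) * A P1"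
  proof -
    have P1: "\<alpha> \<odot> P1 = 0" "\<mu> \<odot> P1 = 0" using \<Lambda>H g(2) \<mu> by auto
    have eq: "\<phi> = (\<lambda>v. (\<alpha> \<odot> v) * A v + c * (\<mu> \<odot> v) ^ d)" using \<phi>A by auto
    have "\<alpha> \<odot> b0 = ddir b0 (\<lambda>v. (\<alpha> \<odot> v) * A v + c * (\<mu> \<odot> v) ^ d) P1"
      using \<alpha>[of b0] unfolding eq .
    also have "\<dots> = (\<alpha> \<odot> b0) * A P1"
      using A(1) P1 d by (simp add: ddir_add ddir_mult ddir_power polyfun_intros)
    finally show ?thesis .
  qed
  then have "A P1 \<noteq> 0" using b0 by (auto simp: \<alpha>)
  moreover have "\<Lambda> = {v. \<alpha> \<odot> v = 0 \<and> \<mu> \<odot> v = 0}" using \<Lambda>H \<mu>(1) onH by fastforce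
  moreover have "\<alpha> \<odot> (a' - (\<mu> \<odot> a') *s u) = 1 \<and> \<mu> \<odot> (a' - (\<mu> \<odot> a') *s u) = 0"
    using a' u \<mu>(2) by simp
  ultimately have "total_tangency d \<phi> \<Lambda> \<alpha> \<mu> A c"
    unfolding total_tangency_def using A(1) c u(1) \<mu>(2) \<phi>A g(2) by blast
  then show ?thesis by (rule that)
qed

section \<open>Many subspaces of star points\<close>

text \<open>The hypothesis reads r(t) = t^(d-1) p(1/t), so r grows at most like t^(d-1). Multiplying
  by a power of t turns p(1/t) into the reflected polynomial, and degrees can be compared.\<close>

lemma poly_degree_less_if_growth:
  fixes r p :: "complex poly"
  assumes "\<And>t. t \<noteq> 0 \<Longrightarrow> t * poly r t = t ^ d * poly p (inverse t)" and "r \<noteq> 0"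
  shows "degree r < d"
proof -
  let ?e = "degree p"
  have "poly (monom 1 (Suc ?e) * r - monom 1 d * reflect_poly p) t = 0" if "poly [:0, 1:] t \<noteq> 0" for t
  proof -
    have "t \<noteq> 0" using that by simp
    then show ?thesis using assms(1)[of t] by (simp add: poly_monom poly_reflect_poly_nz)
  qed
  then have "monom 1 (Suc ?e) * r - monom 1 d * reflect_poly p = 0"
    by (rule poly_eq_0_if_eventually[of "[:0, 1:]", rotated]) auto
  then have eq: "monom 1 (Suc ?e) * r = monom 1 d * reflect_poly p" by simp
  have "Suc ?e + degree r = degree (monom 1 (Suc ?e) * r)"
    using assms(2) by (simp add: degree_mult_eq degree_monom_eq)
  also have "\<dots> = degree (monom 1 d * reflect_poly p)" by (simp only: eq)
  also have "\<dots> \<le> d + ?e"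
    by (rule order.trans[OF degree_mult_le]) (simp add: degree_monom_eq degree_reflect_poly_le)
  finally show ?thesis by simp
qed

lemma polyfun_prod_nonzero:
  assumes "finite I" "\<And>i. i \<in> I \<Longrightarrow> polyfun (f i)" "vec.subspace W"
    and "\<And>i. i \<in> I \<Longrightarrow> \<exists>v\<in>W. f i v \<noteq> 0"
  shows "\<exists>v\<in>W. (\<Prod>i\<in>I. f i v) \<noteq> 0"
  using assms(1,2,4)
proof (induction I rule: finite_induct)
  case empty
  then show ?case using vec.subspace_0[OF assms(3)] by auto
next
  case (insert j I)
  have "polyfun (\<lambda>v. \<Prod>i\<in>I. f i v)" using insert.prems by (intro polyfun_prod) auto
  moreover have "polyfun (f j)" using insert.prems by auto
  moreover have "\<exists>v\<in>W. (\<Prod>i\<in>I. f i v) \<noteq> 0" using insert by auto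
  moreover have "\<exists>v\<in>W. f j v \<noteq> 0" using insert.prems by auto
  ultimately have "\<exists>v\<in>W. f j v * (\<Prod>i\<in>I. f i v) \<noteq> 0"
    using polyfun_dense2[of "f j" "\<lambda>v. \<Prod>i\<in>I. f i v" W] assms(3) by blast
  then show ?case using insert.hyps by simp
qed

text \<open>The forms are divided out one at a time. The product of the earlier ones is not
  identically zero on the next hyperplane, so by density the quotient reached so far still vanishes
  there.\<close>

lemma polyfun_divide_prod_linear:
  assumes "finite I" "polyfun f" "\<And>i v. i \<in> I \<Longrightarrow> \<alpha> i \<odot> v = 0 \<Longrightarrow> f v = 0"
    and "\<And>i. i \<in> I \<Longrightarrow> \<exists>u. \<alpha> i \<odot> u = 1"
    and "\<And>i j. i \<in> I \<Longrightarrow> j \<in> I \<Longrightarrow> i \<noteq> j \<Longrightarrow> \<exists>v. \<alpha> i \<odot> v = 0 \<and> \<alpha> j \<odot> v \<noteq> 0"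
  shows "\<exists>g. polyfun g \<and> (\<forall>v. f v = (\<Prod>i\<in>I. \<alpha> i \<odot> v) * g v)"
  using assms(1,3-)
proof (induction I rule: finite_induct)
  case empty
  then show ?case using assms(2) by auto
next
  case (insert j I)
  have "\<exists>g. polyfun g \<and> (\<forall>v. f v = (\<Prod>i\<in>I. \<alpha> i \<odot> v) * g v)"
    by (rule insert.IH) (use insert.prems in blast)+
  then obtain g where g: "polyfun g" "\<forall>v. f v = (\<Prod>i\<in>I. \<alpha> i \<odot> v) * g v" by blast
  let ?H = "{v. \<alpha> j \<odot> v = 0}"
  have "\<exists>v\<in>?H. (\<Prod>i\<in>I. \<alpha> i \<odot> v) \<noteq> 0"
  proof (rule polyfun_prod_nonzero[OF insert.hyps(1)])
    show "\<exists>v\<in>?H. \<alpha> i \<odot> v \<noteq> 0" if "i \<in> I" for i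
      using insert.prems(3)[of j i] insert.hyps(2) that by auto
  qed (intro subspace_scalar_product polyfun_intros)+
  moreover have "polyfun (\<lambda>v. \<Prod>i\<in>I. \<alpha> i \<odot> v)" by (intro polyfun_intros)
  moreover have "(\<Prod>i\<in>I. \<alpha> i \<odot> v) * g v = 0" if "v \<in> ?H" for v
    using that g(2) insert.prems(1)[of j v] by simp
  ultimately have g0: "g v = 0" if "\<alpha> j \<odot> v = 0" for v
    using polyfun_dense2[of "\<lambda>v. \<Prod>i\<in>I. \<alpha> i \<odot> v" g ?H] g(1) subspace_scalar_product that by blast
  obtain u where "\<alpha> j \<odot> u = 1" using insert.prems(2)[of j] by auto
  then obtain g' where "polyfun g'" "\<And>v. g v = (\<alpha> j \<odot> v) * g' v"
    using polyfun_divide_linear[OF g(1) _ g0] by blast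
  then show ?case using g(2) insert.hyps by (intro exI[of _ g']) (simp add: mult_ac)
qed

lemma total_tangencyD:
  assumes "total_tangency d \<phi> \<Lambda> \<alpha> \<mu> A c"
  shows "polyfun A" "c \<noteq> 0" "\<exists>u. \<alpha> \<odot> u = 0 \<and> \<mu> \<odot> u = 1" "\<exists>a. \<alpha> \<odot> a = 1 \<and> \<mu> \<odot> a = 0"
    "v \<in> \<Lambda> \<longleftrightarrow> \<alpha> \<odot> v = 0 \<and> \<mu> \<odot> v = 0" "\<phi> v = (\<alpha> \<odot> v) * A v + c * (\<mu> \<odot> v) ^ d"
    "\<exists>P\<in>\<Lambda>. A P \<noteq> 0"
  using assms unfolding total_tangency_def by auto

lemma total_tangency_subspace:
  assumes "total_tangency d \<phi> \<Lambda> \<alpha> \<mu> A c"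
  shows "vec.subspace \<Lambda>"
  using total_tangencyD(5)[OF assms] by (auto simp: vec.subspace_def)

text \<open>If \<alpha>' vanished on \<Lambda>, then so would c' \<mu>'^d, because \<phi> is zero on
  \<Lambda>; thus \<Lambda> would be contained in \<Lambda>' and equal to it by dimension.\<close>

lemma total_tangency_distinct:
  assumes "total_tangency d \<phi> \<Lambda> \<alpha> \<mu> A c" "total_tangency d \<phi> \<Lambda>' \<alpha>' \<mu>' A' c'"
    and "\<Lambda> \<noteq> \<Lambda>'" "vec.dim \<Lambda> = vec.dim \<Lambda>'" "d > 0"
  shows "\<exists>v\<in>\<Lambda>. \<alpha>' \<odot> v \<noteq> 0"
proof (rule ccontr)
  assume neg: "\<not> ?thesis"
  have "\<Lambda> \<subseteq> \<Lambda>'"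
  proof
    fix v assume v: "v \<in> \<Lambda>"
    then have "\<phi> v = 0" using total_tangencyD(5,6)[OF assms(1), of v] assms(5) by simp
    moreover have "\<alpha>' \<odot> v = 0" using neg v by auto
    ultimately show "v \<in> \<Lambda>'"
      using total_tangencyD(2)[OF assms(2)] total_tangencyD(5,6)[OF assms(2), of v] by simp
  qed
  then have "\<Lambda> = \<Lambda>'"
    using vec.subspace_dim_equal total_tangency_subspace assms by (metis order_refl)
  then show False using assms(3) by simp
qed

text \<open>Degree in v is measured on the ray t v. There K(t v) = t^d (\<phi>(v + u/t) -
  \<phi>(v)), where the bracket is a multiple of 1/t, so the growth is at most t^(d-1). The linear
  forms dividing K contribute t^(card I), which is too much unless K vanishes on the ray.\<close>

lemma translation_invariant_if_many_tangencies:
  assumes \<phi>: "polyfun \<phi>" and hom: "\<And>t v. \<phi> (t *s v) = t ^ d * \<phi> v" and d: "d > 0"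
    and I: "finite I" "card I \<ge> d"
    and T: "\<And>i. i \<in> I \<Longrightarrow> total_tangency d \<phi> (\<Lambda> i) (\<alpha> i) (\<mu> i) (A i) (c i)"
    and distinct: "\<And>i j. i \<in> I \<Longrightarrow> j \<in> I \<Longrightarrow> i \<noteq> j \<Longrightarrow> \<exists>v\<in>\<Lambda> i. \<alpha> j \<odot> v \<noteq> 0"
    and u: "\<And>i. i \<in> I \<Longrightarrow> u \<in> \<Lambda> i"
  shows "\<phi> (v + u) = \<phi> v"
proof -
  define K where "K v = \<phi> (v + u) - \<phi> v" for v
  have pfK: "polyfun K" unfolding K_def by (intro polyfun_intros polyfun_affine \<phi>)
  have "K v = 0" if "i \<in> I" "\<alpha> i \<odot> v = 0" for i v
    using that u[OF that(1)] total_tangencyD(5,6)[OF T[OF that(1)]] by (simp add: K_def)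
  moreover have "\<exists>v. \<alpha> i \<odot> v = 0 \<and> \<alpha> j \<odot> v \<noteq> 0" if "i \<in> I" "j \<in> I" "i \<noteq> j" for i j
    using distinct[OF that] total_tangencyD(5)[OF T[OF that(1)]] by blast
  moreover have "\<exists>u. \<alpha> i \<odot> u = 1" if "i \<in> I" for i
    using total_tangencyD(4)[OF T[OF that]] by blast
  ultimately have "\<exists>g. polyfun g \<and> (\<forall>v. K v = (\<Prod>i\<in>I. \<alpha> i \<odot> v) * g v)"
    by (intro polyfun_divide_prod_linear[OF I(1) pfK]) blast+
  then obtain g where g: "polyfun g" "\<And>v. K v = (\<Prod>i\<in>I. \<alpha> i \<odot> v) * g v" by blast
  obtain q where q: "\<And>t. g (0 + t *s v) = poly q t" using polyfun_line[OF g(1)] by blast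
  obtain p where p: "\<And>t. \<phi> (v + t *s u) = poly p t" using polyfun_line[OF \<phi>] by blast
  obtain p' where p': "p - [:\<phi> v:] = [:0, 1:] * p'"
  proof -
    have "poly (p - [:\<phi> v:]) 0 = 0" using p[of 0] by simp
    then show ?thesis using that unfolding poly_eq_0_iff_dvd by (auto elim!: dvdE)
  qed
  define r where "r = monom (\<Prod>i\<in>I. \<alpha> i \<odot> v) (card I) * q"
  have r: "poly r t = K (t *s v)" for t
    using q[of t] by (simp add: g(2) r_def poly_monom prod.distrib mult_ac)
  have "t * poly r t = t ^ d * poly p' (inverse t)" if t: "t \<noteq> 0" for t
  proof -
    have "t *s (v + inverse t *s u) = t *s v + u" using t by (simp add: vec.scale_right_distrib)
    then have "K (t *s v) = t ^ d * (\<phi> (v + inverse t *s u) - \<phi> v)"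
      by (simp only: K_def right_diff_distrib flip: hom)
    also have "\<phi> (v + inverse t *s u) - \<phi> v = poly (p - [:\<phi> v:]) (inverse t)" by (simp add: p)
    also have "\<dots> = inverse t * poly p' (inverse t)" by (simp add: p')
    finally show ?thesis using t by (simp add: r)
  qed
  then have "r = 0 \<or> degree r < d" using poly_degree_less_if_growth by blast
  then have "r = 0"
  proof
    assume deg: "degree r < d"
    show "r = 0"
    proof (rule ccontr)
      assume "r \<noteq> 0"
      then have "degree r = card I + degree q"
        by (simp add: r_def degree_mult_eq degree_monom_eq)
      then show False using deg I by simp
    qed
  qed
  then have "K (1 *s v) = 0" using r[of 1] by simp
  then show ?thesis by (simp add: K_def)
qed

section \<open>Ideals generated by two polynomial functions\<close>

definition ideal2 :: "(complex ^ 'n \<Rightarrow> complex) \<Rightarrow> (complex ^ 'n \<Rightarrow> complex) \<Rightarrow> (complex ^ 'n \<Rightarrow> complex) set" where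
  "ideal2 f h = {g. \<exists>p q. polyfun p \<and> polyfun q \<and> (\<forall>v. g v = p v * f v + q v * h v)}"

lemma ideal2I: "polyfun p \<Longrightarrow> polyfun q \<Longrightarrow> (\<And>v. g v = p v * f v + q v * h v) \<Longrightarrow> g \<in> ideal2 f h"
  unfolding ideal2_def by blast

lemma ideal2E:
  assumes "g \<in> ideal2 f h"
  obtains p q where "polyfun p" "polyfun q" "\<And>v. g v = p v * f v + q v * h v"
  using assms unfolding ideal2_def by blast

text \<open>On the hyperplane \<alpha> = 0 the linear form \<mu> is prime and does not divide B,
  because B is nonzero at a point with \<mu> = 0. Hence \<mu>^j divides g, one factor per induction
  step.\<close>

lemma cancel_on_hyperplane:
  assumes "polyfun B" "polyfun g" "polyfun w" "P \<in> {v. \<alpha> \<odot> v = 0 \<and> \<mu> \<odot> v = 0}" "B P \<noteq> 0"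
    and a: "\<alpha> \<odot> a = 1" "\<mu> \<odot> a = 0" and u: "\<alpha> \<odot> u = 0" "\<mu> \<odot> u = 1"
    and "\<And>v. \<alpha> \<odot> v = 0 \<Longrightarrow> B v * g v = w v * (\<mu> \<odot> v) ^ j"
  shows "\<exists>g'. polyfun g' \<and> (\<forall>v. \<alpha> \<odot> v = 0 \<longrightarrow> g v = g' v * (\<mu> \<odot> v) ^ j \<and> w v = B v * g' v)"
  using assms(2,10)
proof (induction j arbitrary: g)
  case 0
  then show ?case by (intro exI[of _ g]) auto
next
  case (Suc j)
  let ?\<Lambda> = "{v. \<alpha> \<odot> v = 0 \<and> \<mu> \<odot> v = 0}" and ?H = "{v. \<alpha> \<odot> v = 0}"
  have \<Lambda>: "vec.subspace ?\<Lambda>" by (auto simp: vec.subspace_def)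
  have g0: "g v = 0" if "v \<in> ?\<Lambda>" for v
  proof (rule polyfun_dense[OF assms(1) Suc.prems(1) \<Lambda> assms(4,5) _ that])
    show "g v = 0" if "v \<in> ?\<Lambda>" "B v \<noteq> 0" for v using Suc.prems(2)[of v] that by simp
  qed
  \<comment> \<open>\<pi> projects to \<alpha> = 0 and preserves \<mu>, since
    \<open>\<mu> \<odot> a = 0\<close>. Composing with it extends g from the hyperplane to a
    function that vanishes wherever \<mu> does, so that \<mu> can be divided out.\<close>
  define \<pi> where "\<pi> v = v - (\<alpha> \<odot> v) *s a" for v
  have "polyfun (\<lambda>v. g (\<pi> v))" unfolding \<pi>_def by (intro polyfun_affine Suc.prems)
  moreover have "g (\<pi> v) = 0" if "\<mu> \<odot> v = 0" for v
    by (rule g0) (use that a in \<open>simp add: \<pi>_def\<close>)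
  ultimately obtain g2 where g2: "polyfun g2" "\<And>v. g (\<pi> v) = (\<mu> \<odot> v) * g2 v"
    using polyfun_divide_linear[OF _ u(2)] by blast
  have gH: "g v = (\<mu> \<odot> v) * g2 v" if "\<alpha> \<odot> v = 0" for v
    using that g2(2)[of v] by (simp add: \<pi>_def)
  have "B v * g2 v - w v * (\<mu> \<odot> v) ^ j = 0" if "\<alpha> \<odot> v = 0" for v
  proof (rule polyfun_dense[where f = "\<lambda>v. \<mu> \<odot> v" and W = ?H and p = u and g = "\<lambda>v. B v * g2 v - w v * (\<mu> \<odot> v) ^ j"])
    show "polyfun (\<lambda>v. B v * g2 v - w v * (\<mu> \<odot> v) ^ j)"
      using assms g2 by (intro polyfun_intros)
    fix v assume v: "v \<in> ?H" "\<mu> \<odot> v \<noteq> 0"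
    then have "(\<mu> \<odot> v) * (B v * g2 v) = (\<mu> \<odot> v) * (w v * (\<mu> \<odot> v) ^ j)"
      using Suc.prems(2)[of v] gH[of v] by (simp add: mult_ac)
    then show "B v * g2 v - w v * (\<mu> \<odot> v) ^ j = 0" using v by simp
  qed (use that u in \<open>auto intro: polyfun_intros subspace_scalar_product\<close>)
  then have "B v * g2 v = w v * (\<mu> \<odot> v) ^ j" if "\<alpha> \<odot> v = 0" for v using that by simp
  then obtain g' where "polyfun g'"
    "\<forall>v. \<alpha> \<odot> v = 0 \<longrightarrow> g2 v = g' v * (\<mu> \<odot> v) ^ j \<and> w v = B v * g' v"
    using Suc.IH[OF g2(1)] by blast
  then show ?case using gH by (intro exI[of _ g']) auto
qed

text \<open>In other words, the ideal \<open>(\<phi>, \<alpha>\<^sup>k)\<close> is primary with radical the ideal of \<open>\<Lambda>\<close>.\<close>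

lemma ideal2_cancel:
  assumes T: "total_tangency d \<phi> \<Lambda> \<alpha> \<mu> A c" and B: "polyfun B" "P \<in> \<Lambda>" "B P \<noteq> 0"
    and g: "polyfun g" "(\<lambda>v. B v * g v) \<in> ideal2 \<phi> (\<lambda>v. (\<alpha> \<odot> v) ^ k)"
  shows "g \<in> ideal2 \<phi> (\<lambda>v. (\<alpha> \<odot> v) ^ k)"
  using g
proof (induction k arbitrary: g)
  case 0
  then show ?case by (intro ideal2I[of "\<lambda>_. 0" g]) (auto intro: polyfun_intros)
next
  case (Suc k)
  note TD = total_tangencyD[OF T]
  obtain a where a: "\<alpha> \<odot> a = 1" "\<mu> \<odot> a = 0" using TD(4) by blast
  obtain u where u: "\<alpha> \<odot> u = 0" "\<mu> \<odot> u = 1" using TD(3) by blast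
  have \<phi>: "polyfun \<phi>"
  proof -
    have "\<phi> = (\<lambda>v. (\<alpha> \<odot> v) * A v + c * (\<mu> \<odot> v) ^ d)" using TD(6) by auto
    then show ?thesis using TD(1) by (simp add: polyfun_intros)
  qed
  obtain p q where pq: "polyfun p" "polyfun q"
    "\<And>v. B v * g v = p v * \<phi> v + q v * (\<alpha> \<odot> v) ^ Suc k"
    using Suc.prems(2) by (rule ideal2E) blast
  \<comment> \<open>Modulo \<alpha> the function \<phi> becomes c \<mu>^d. Cancelling B there shows
    g = w \<mu>^d, so (w/c) \<phi> agrees with g on the hyperplane, and likewise p agrees with B
    w/c.\<close>
  have "\<exists>w. polyfun w \<and> (\<forall>v. \<alpha> \<odot> v = 0 \<longrightarrow> g v = w v * (\<mu> \<odot> v) ^ d \<and> p v * c = B v * w v)"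
    by (rule cancel_on_hyperplane[OF B(1) Suc.prems(1) _ _ B(3) a u])
       (use B(2) TD(5,6) pq in \<open>auto intro: polyfun_intros\<close>)
  then obtain w where w: "polyfun w" "\<And>v. \<alpha> \<odot> v = 0 \<Longrightarrow> g v = w v * (\<mu> \<odot> v) ^ d"
    "\<And>v. \<alpha> \<odot> v = 0 \<Longrightarrow> p v * c = B v * w v" by blast
  define w' where "w' v = w v * inverse c" for v
  have w': "polyfun w'" unfolding w'_def using w(1) by (intro polyfun_intros)
  have "g v - w' v * \<phi> v = 0" if "\<alpha> \<odot> v = 0" for v
    using that w(2)[OF that] TD(2,6) by (simp add: w'_def)
  moreover have "polyfun (\<lambda>v. g v - w' v * \<phi> v)" using Suc.prems(1) w' \<phi> by (intro polyfun_intros)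
  ultimately obtain g1 where g1: "polyfun g1" "\<And>v. g v - w' v * \<phi> v = (\<alpha> \<odot> v) * g1 v"
    using polyfun_divide_linear[OF _ a(1), of "\<lambda>v. g v - w' v * \<phi> v"] by blast
  have "p v - B v * w' v = 0" if "\<alpha> \<odot> v = 0" for v
    using w(3)[OF that] TD(2) by (simp add: w'_def field_simps)
  moreover have "polyfun (\<lambda>v. p v - B v * w' v)" using B(1) w' pq(1) by (intro polyfun_intros)
  ultimately obtain p1 where p1: "polyfun p1" "\<And>v. p v - B v * w' v = (\<alpha> \<odot> v) * p1 v"
    using polyfun_divide_linear[OF _ a(1), of "\<lambda>v. p v - B v * w' v"] by blast
  \<comment> \<open>Subtracting B w' \<phi> from the given relation leaves a multiple of \<alpha> on
    both sides. Cancelling \<alpha> lowers the exponent by one; the cancellation holds off the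
    hyperplane and extends by density.\<close>
  have "(\<lambda>v. B v * g1 v) \<in> ideal2 \<phi> (\<lambda>v. (\<alpha> \<odot> v) ^ k)"
  proof (rule ideal2I[OF p1(1) pq(2)])
    have *: "B v * g1 v - (p1 v * \<phi> v + q v * (\<alpha> \<odot> v) ^ k) = 0" if "\<alpha> \<odot> v \<noteq> 0" for v
    proof -
      have "(\<alpha> \<odot> v) * (B v * g1 v - (p1 v * \<phi> v + q v * (\<alpha> \<odot> v) ^ k)) =
          B v * ((\<alpha> \<odot> v) * g1 v) - ((\<alpha> \<odot> v) * p1 v) * \<phi> v - q v * (\<alpha> \<odot> v) ^ Suc k"
        by (simp add: algebra_simps)
      also have "\<dots> = 0"
        unfolding g1(2)[symmetric] p1(2)[symmetric] using pq(3)[of v] by (simp add: algebra_simps)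
      finally show ?thesis using that by simp
    qed
    have pf: "polyfun (\<lambda>v. B v * g1 v - (p1 v * \<phi> v + q v * (\<alpha> \<odot> v) ^ k))"
      using B(1) g1(1) p1(1) pq(2) \<phi> by (intro polyfun_intros)
    have "B v * g1 v - (p1 v * \<phi> v + q v * (\<alpha> \<odot> v) ^ k) = 0" for v
      by (rule polyfun_dense[OF polyfun_scalar_product pf vec.subspace_UNIV, of a \<alpha>])
         (use * a in auto)
    then show "B v * g1 v = p1 v * \<phi> v + q v * (\<alpha> \<odot> v) ^ k" for v by (metis eq_iff_diff_eq_0)
  qed
  from Suc.IH[OF g1(1) this] obtain p2 q2 where 2: "polyfun p2" "polyfun q2"
    "\<And>v. g1 v = p2 v * \<phi> v + q2 v * (\<alpha> \<odot> v) ^ k" by (rule ideal2E) blast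
  have "g v = (w' v + (\<alpha> \<odot> v) * p2 v) * \<phi> v + q2 v * (\<alpha> \<odot> v) ^ Suc k" for v
    using g1(2)[of v] unfolding 2(3)[of v] by (simp add: algebra_simps)
  then show ?case
    by (rule ideal2I[rotated 2]) (use 2 w' in \<open>auto intro!: polyfun_intros\<close>)
qed

lemma power_mod_polyfun:
  assumes "polyfun x" "polyfun y" "polyfun f"
  shows "\<exists>z. polyfun z \<and> (\<forall>v. (x v * f v + y v) ^ n = z v * f v + y v ^ n)"
proof (induction n)
  case 0
  then show ?case by (intro exI[of _ "\<lambda>_. 0"]) (auto intro: polyfun_intros)
next
  case (Suc n)
  then obtain z where z: "polyfun z" "\<And>v. (x v * f v + y v) ^ n = z v * f v + y v ^ n" by blast
  have "polyfun (\<lambda>v. (x v * f v + y v) * z v + x v * y v ^ n)"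
    using assms z(1) by (intro polyfun_intros)
  moreover have "(x v * f v + y v) ^ Suc n = ((x v * f v + y v) * z v + x v * y v ^ n) * f v + y v ^ Suc n" for v
    unfolding power_Suc z(2) by (simp add: algebra_simps)
  ultimately show ?case by blast
qed

text \<open>Modulo \<phi>, \<mu>^d is -(A/c) \<alpha>. The d-th power of A h = y \<mu>^k contains
  \<mu>^(kd) = (\<mu>^d)^k, hence a multiple of \<alpha>^k, and A^d cancels since A is nonzero
  somewhere on \<Lambda>.\<close>

lemma power_mem_ideal2:
  assumes T: "total_tangency d \<phi> \<Lambda> \<alpha> \<mu> A c" and \<phi>: "polyfun \<phi>"
    and h: "polyfun h" and x: "polyfun x" and y: "polyfun y"
    and eq: "\<And>v. A v * h v = x v * \<phi> v + y v * (\<mu> \<odot> v) ^ k"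
  shows "(\<lambda>v. h v ^ d) \<in> ideal2 \<phi> (\<lambda>v. (\<alpha> \<odot> v) ^ k)"
proof -
  note TD = total_tangencyD[OF T]
  obtain P where P: "P \<in> \<Lambda>" "A P \<noteq> 0" using TD(7) by blast
  have "polyfun (\<lambda>v. y v * (\<mu> \<odot> v) ^ k)" using y by (intro polyfun_intros)
  from power_mod_polyfun[OF x this \<phi>, of d] obtain z1 where z1: "polyfun z1"
    "\<And>v. (x v * \<phi> v + y v * (\<mu> \<odot> v) ^ k) ^ d = z1 v * \<phi> v + (y v * (\<mu> \<odot> v) ^ k) ^ d" by blast
  define e where "e v = (- inverse c * A v) * (\<alpha> \<odot> v)" for v
  have e: "polyfun e" unfolding e_def by (intro polyfun_intros TD(1))
  have \<mu>d: "(\<mu> \<odot> v) ^ d = inverse c * \<phi> v + e v" for v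
    using TD(2) unfolding e_def TD(6)[of v] by (simp add: field_simps)
  obtain z2 where z2: "polyfun z2" "\<And>v. (inverse c * \<phi> v + e v) ^ k = z2 v * \<phi> v + e v ^ k"
    using power_mod_polyfun[OF polyfun.const e \<phi>] by blast
  have "(\<lambda>v. A v ^ d * h v ^ d) \<in> ideal2 \<phi> (\<lambda>v. (\<alpha> \<odot> v) ^ k)"
  proof (rule ideal2I[of "\<lambda>v. z1 v + y v ^ d * z2 v" "\<lambda>v. y v ^ d * (- inverse c * A v) ^ k"])
    fix v
    have "((\<mu> \<odot> v) ^ k) ^ d = ((\<mu> \<odot> v) ^ d) ^ k" by (simp add: mult.commute flip: power_mult)
    also have "\<dots> = z2 v * \<phi> v + (- inverse c * A v) ^ k * (\<alpha> \<odot> v) ^ k"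
      unfolding \<mu>d z2(2) by (simp only: e_def power_mult_distrib)
    finally have "(y v * (\<mu> \<odot> v) ^ k) ^ d = y v ^ d * (z2 v * \<phi> v + (- inverse c * A v) ^ k * (\<alpha> \<odot> v) ^ k)"
      by (simp only: power_mult_distrib)
    moreover have "A v ^ d * h v ^ d = (A v * h v) ^ d" by (simp only: power_mult_distrib)
    ultimately show "A v ^ d * h v ^ d = (z1 v + y v ^ d * z2 v) * \<phi> v + y v ^ d * (- inverse c * A v) ^ k * (\<alpha> \<odot> v) ^ k"
      unfolding eq z1(2) by (simp only: algebra_simps)
  qed (use z1 z2 y TD(1) in \<open>auto intro!: polyfun_intros\<close>)
  then show ?thesis
    by (rule ideal2_cancel[OF T _ P(1), rotated 3]) (use P h TD(1) in \<open>auto intro: polyfun_intros\<close>)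
qed

text \<open>If g = p \<phi> + q w with w the product so far, membership for the next index j puts w
  q into the ideal of \<phi> and \<alpha>_j^k. Since w is not identically zero on \<Lambda>_j, it
  cancels, and q supplies the missing factor.\<close>

lemma ideal2_prod:
  assumes "finite I"
    and T: "\<And>i. i \<in> I \<Longrightarrow> total_tangency d \<phi> (\<Lambda> i) (\<alpha> i) (\<mu> i) (A i) (c i)"
    and distinct: "\<And>i j. i \<in> I \<Longrightarrow> j \<in> I \<Longrightarrow> i \<noteq> j \<Longrightarrow> \<exists>v\<in>\<Lambda> i. \<alpha> j \<odot> v \<noteq> 0"
    and g: "polyfun g" "\<And>i. i \<in> I \<Longrightarrow> g \<in> ideal2 \<phi> (\<lambda>v. (\<alpha> i \<odot> v) ^ k)"
  shows "g \<in> ideal2 \<phi> (\<lambda>v. \<Prod>i\<in>I. (\<alpha> i \<odot> v) ^ k)"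
  using assms(1,2,3,5)
proof (induction I rule: finite_induct)
  case empty
  then show ?case by (intro ideal2I[of "\<lambda>_. 0" g]) (auto intro: polyfun_intros g)
next
  case (insert j I)
  let ?w = "\<lambda>v. \<Prod>i\<in>I. (\<alpha> i \<odot> v) ^ k"
  have w: "polyfun ?w" by (intro polyfun_intros)
  have "g \<in> ideal2 \<phi> ?w" using insert by (simp add: insert.IH)
  then obtain p q where pq: "polyfun p" "polyfun q" "\<And>v. g v = p v * \<phi> v + q v * ?w v"
    by (rule ideal2E) blast
  obtain p' q' where pq': "polyfun p'" "polyfun q'" "\<And>v. g v = p' v * \<phi> v + q' v * (\<alpha> j \<odot> v) ^ k"
    using insert.prems(3)[of j] by (auto elim!: ideal2E)
  have "\<exists>v\<in>\<Lambda> j. ?w v \<noteq> 0"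
  proof (rule polyfun_prod_nonzero[OF insert.hyps(1)])
    show "\<exists>v\<in>\<Lambda> j. (\<alpha> i \<odot> v) ^ k \<noteq> 0" if "i \<in> I" for i
      using insert.prems(2)[of j i] that insert.hyps(2) by auto
    show "vec.subspace (\<Lambda> j)" by (rule total_tangency_subspace) (rule insert.prems(1), simp)
  qed (intro polyfun_intros)
  then obtain P where P: "P \<in> \<Lambda> j" "?w P \<noteq> 0" by blast
  have "(\<lambda>v. ?w v * q v) \<in> ideal2 \<phi> (\<lambda>v. (\<alpha> j \<odot> v) ^ k)"
  proof (rule ideal2I[of "\<lambda>v. p' v - p v" q'])
    show "?w v * q v = (p' v - p v) * \<phi> v + q' v * (\<alpha> j \<odot> v) ^ k" for v
      using pq(3)[of v] pq'(3)[of v] by (simp add: algebra_simps)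
  qed (use pq pq' in \<open>auto intro: polyfun_intros\<close>)
  then have "q \<in> ideal2 \<phi> (\<lambda>v. (\<alpha> j \<odot> v) ^ k)"
    by (rule ideal2_cancel[OF insert.prems(1)[OF insertI1] w P pq(2)])
  then obtain p'' q'' where 2: "polyfun p''" "polyfun q''" "\<And>v. q v = p'' v * \<phi> v + q'' v * (\<alpha> j \<odot> v) ^ k"
    by (rule ideal2E) blast
  show ?case
  proof (rule ideal2I[of "\<lambda>v. p v + p'' v * ?w v" q''])
    show "g v = (p v + p'' v * ?w v) * \<phi> v + q'' v * (\<Prod>i\<in>insert j I. (\<alpha> i \<odot> v) ^ k)" for v
      unfolding pq(3)[of v] 2(3)[of v] using insert.hyps by (simp add: algebra_simps)
  qed (use pq 2 w in \<open>auto intro: polyfun.intros\<close>)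
qed

text \<open>On the ray through a zero v of \<phi> the membership reads t^e g(v) = t^(k card I) times
  a polynomial in t. Dividing by t^e and setting t = 0 gives g(v) = 0.\<close>

lemma vanish_if_ideal2_prod:
  assumes "g \<in> ideal2 \<phi> (\<lambda>v. \<Prod>i\<in>I. (\<alpha> i \<odot> v) ^ k)"
    and \<phi>: "\<And>t v. \<phi> (t *s v) = t ^ d * \<phi> v" and g: "\<And>t. t \<noteq> 0 \<Longrightarrow> g (t *s v) = t ^ e * g v"
    and "e < k * card I" "\<phi> v = 0"
  shows "g v = 0"
proof -
  obtain p q where pq: "polyfun p" "polyfun q" "\<And>v. g v = p v * \<phi> v + q v * (\<Prod>i\<in>I. (\<alpha> i \<odot> v) ^ k)"
    using assms(1) by (rule ideal2E) blast
  obtain r where r: "\<And>t. q (0 + t *s v) = poly r t" using polyfun_line[OF pq(2)] by blast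
  let ?w = "\<Prod>i\<in>I. (\<alpha> i \<odot> v) ^ k"
  have w: "(\<Prod>i\<in>I. (\<alpha> i \<odot> (t *s v)) ^ k) = t ^ (k * card I) * ?w" for t
    by (simp add: power_mult_distrib prod.distrib power_mult)
  define s where "s = [:g v:] - monom ?w (k * card I - e) * r"
  have "poly s t = 0" if "poly [:0, 1:] t \<noteq> 0" for t
  proof -
    have t: "t \<noteq> 0" using that by simp
    have "t ^ e * g v = t ^ (k * card I) * ?w * poly r t"
      using pq(3)[of "t *s v"] r[of t] unfolding g[OF t] \<phi> w assms(5) by simp
    also have "\<dots> = t ^ e * (t ^ (k * card I - e) * ?w * poly r t)"
      using assms(4) by (simp flip: power_add mult.assoc)
    finally have "g v = t ^ (k * card I - e) * ?w * poly r t" using t by simp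
    then show ?thesis by (simp add: s_def poly_monom)
  qed
  then have "s = 0" by (rule poly_eq_0_if_eventually[of "[:0, 1:]", rotated]) auto
  then have "poly s 0 = 0" by simp
  then show ?thesis using assms(4) by (simp add: s_def poly_monom)
qed

section \<open>The Hessian\<close>

text \<open>
  For fixed small \<open>s \<noteq> 0\<close>, the point \<open>q + s u + r a\<close> lies on the hypersurface iff
  \<open>r = - c s\<^sup>d / A (q + s u + r a)\<close>, and Brouwer's theorem solves this for \<open>r\<close>.
\<close>

lemma hypersurface_point_near_tangency:
  assumes T: "total_tangency d \<phi> \<Lambda> \<alpha> \<mu> A c" and d: "d > 0"
    and \<Psi>: "polyfun \<Psi>" and q: "q \<in> \<Lambda>" "A q \<noteq> 0" "\<Psi> q \<noteq> 0"
  shows "\<exists>x. \<phi> x = 0 \<and> \<mu> \<odot> x \<noteq> 0 \<and> \<Psi> x \<noteq> 0"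
proof -
  note TD = total_tangencyD[OF T]
  obtain a where a: "\<alpha> \<odot> a = 1" "\<mu> \<odot> a = 0" using TD(4) by blast
  obtain u where u: "\<alpha> \<odot> u = 0" "\<mu> \<odot> u = 1" using TD(3) by blast
  have q0: "\<alpha> \<odot> q = 0" "\<mu> \<odot> q = 0" using q(1) TD(5) by auto
  define X where "X z = q + fst z *s u + snd z *s a" for z :: "complex \<times> complex"
  have cont: "continuous_on UNIV (\<lambda>z. f (X z))" if "polyfun f" for f
    unfolding X_def by (rule polyfun_continuous[OF that]) (auto intro!: continuous_intros)
  \<comment> \<open>Within S the denominator A of the fixed-point map stays above \<eta> in
    norm.\<close>
  define \<eta> where "\<eta> = norm (A q) / 2"
  have \<eta>: "\<eta> > 0" "norm (A q) > \<eta>" using q(2) by (auto simp: \<eta>_def)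
  define S where "S = {z. \<Psi> (X z) \<noteq> 0} \<inter> {z. norm (A (X z)) > \<eta>}"
  have "open S"
    unfolding S_def
    by (intro open_Int open_Collect_neq open_Collect_less continuous_on_norm cont \<Psi> TD(1) continuous_on_const)
  moreover have "(0, 0) \<in> S" using q \<eta> by (simp add: S_def X_def)
  ultimately obtain e where e: "e > 0" "ball (0, 0) e \<subseteq> S" by (meson open_contains_ball)
  \<comment> \<open>Both s and r have norm at most e/3, so (s, r) stays in the ball. Since
    \<open>\<sigma> ^ d\<close> is at most \<sigma>, the last bound imposed on \<sigma> makes f map
    the disc of radius r0 into itself.\<close>
  define r0 where "r0 = e / 3"
  have r0: "r0 > 0" using e by (simp add: r0_def)
  define \<sigma> where "\<sigma> = min 1 (min r0 (r0 * \<eta> / norm c))"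
  have \<sigma>: "\<sigma> > 0" "\<sigma> \<le> 1" "\<sigma> \<le> r0" "\<sigma> \<le> r0 * \<eta> / norm c"
    using r0 \<eta> TD(2) by (auto simp: \<sigma>_def)
  define s where "s = complex_of_real \<sigma>"
  have inO: "(s, r) \<in> S" if "norm r \<le> r0" for r
  proof -
    have "norm (s, r) \<le> norm s + norm r" by (rule norm_Pair_le)
    also have "\<dots> < e" using \<sigma> that r0 e by (simp add: s_def r0_def)
    finally have "(s, r) \<in> ball (0, 0) e" by (simp flip: zero_prod_def)
    then show ?thesis using e by blast
  qed
  define f where "f r = - (c * s ^ d) / A (X (s, r))" for r
  have A0: "A (X (s, r)) \<noteq> 0" if "norm r \<le> r0" for r
    using inO[OF that] \<eta> by (auto simp: S_def)
  have "\<exists>r. norm r \<le> r0 \<and> f r = r"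
  proof -
    have "continuous_on (cball 0 r0) (\<lambda>r. A (X (s, r)))"
      unfolding X_def by (rule polyfun_continuous[OF TD(1)]) (auto intro!: continuous_intros)
    then have "continuous_on (cball 0 r0) f"
      unfolding f_def using A0 by (intro continuous_intros) auto
    moreover have "norm (f r) \<le> r0" if "norm r \<le> r0" for r
    proof -
      have "\<eta> \<le> norm (A (X (s, r)))" using inO[OF that] by (simp add: S_def)
      have "norm (f r) = norm c * \<sigma> ^ d / norm (A (X (s, r)))"
        using \<sigma> by (simp add: f_def norm_divide norm_mult norm_power s_def)
      also have "\<dots> \<le> norm c * \<sigma> / \<eta>"
      proof (rule frac_le)
        have "\<sigma> ^ d \<le> \<sigma> ^ 1" using \<sigma> d by (intro power_decreasing) auto
        then show "norm c * \<sigma> ^ d \<le> norm c * \<sigma>" by (simp add: mult_left_mono)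
      qed (use \<eta> \<sigma> \<open>\<eta> \<le> _\<close> in auto)
      also have "\<dots> \<le> r0" using \<sigma>(4) \<eta> TD(2) by (simp add: field_simps)
      finally show ?thesis .
    qed
    ultimately obtain r where "r \<in> cball 0 r0" "f r = r"
      using brouwer[of "cball 0 r0" f] r0 by auto
    then show ?thesis by auto
  qed
  then obtain r where r: "norm r \<le> r0" "f r = r" by blast
  have "\<alpha> \<odot> X (s, r) = r" "\<mu> \<odot> X (s, r) = s" using a u q0 by (auto simp: X_def)
  moreover have "f r * A (X (s, r)) = - (c * s ^ d)" using A0[OF r(1)] by (simp add: f_def)
  ultimately have "\<alpha> \<odot> X (s, r) = r" "\<mu> \<odot> X (s, r) = s" "\<phi> (X (s, r)) = 0"
    using TD(6)[of "X (s, r)"] by (simp_all add: r(2))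
  moreover have "s \<noteq> 0" using \<sigma> by (simp add: s_def)
  moreover have "\<Psi> (X (s, r)) \<noteq> 0" using inO[OF r(1)] by (simp add: S_def)
  ultimately show ?thesis by (intro exI[of _ "X (s, r)"]) simp
qed

text \<open>Only three directions enter, later a basis of a complement of L. The full matrix of
  second derivatives of a cone is degenerate along a nonzero vertex.\<close>

definition hessian :: "(3 \<Rightarrow> complex ^ 'n) \<Rightarrow> (complex ^ 'n \<Rightarrow> complex) \<Rightarrow> complex ^ 'n \<Rightarrow> complex" where
  "hessian b \<phi> x = det (\<chi> i j. ddir (b j) (ddir (b i) \<phi>) x :: complex ^ 3 ^ 3)"

text \<open>The matrix is the Gram matrix of the quadratic form 2 l a + K m^2. In the coordinates l,
  a, m that form has determinant -K, and the change of coordinates contributes the square.\<close>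

lemma det_rank_one_perturbation:
  fixes l a m :: "3 \<Rightarrow> complex"
  shows "det (\<chi> i j. l i * a j + a i * l j + K * m i * m j :: complex ^ 3 ^ 3) =
    - K * (det (\<chi> j i. if j = 1 then l i else if j = 2 then a i else m i :: complex ^ 3 ^ 3))\<^sup>2"
  unfolding det_3 by (simp add: power2_eq_square) algebra

lemma polyfun_det_3:
  assumes "\<And>i j. polyfun (\<lambda>x. M x i j)"
  shows "polyfun (\<lambda>x. det (\<chi> i j. M x i j :: complex ^ 3 ^ 3))"
  unfolding det_3 by (simp add: assms polyfun_intros)

lemma polyfun_hessian: "polyfun \<phi> \<Longrightarrow> polyfun (hessian b \<phi>)"
  unfolding hessian_def by (intro polyfun_det_3 polyfun_ddir_polyfun)

lemma hessian_homogeneous: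
  assumes \<phi>: "polyfun \<phi>" and hom: "\<And>t v. \<phi> (t *s v) = t ^ d * \<phi> v" and d: "d \<ge> 3" and t: "t \<noteq> 0"
  shows "hessian b \<phi> (t *s x) = t ^ (3 * (d - 2)) * hessian b \<phi> x"
proof -
  have "ddir (b i) \<phi> (t *s v) = t ^ (d - 1) * ddir (b i) \<phi> v" for i v
    using d by (intro ddir_homogeneous[OF \<phi> hom t]) auto
  then have "ddir (b j) (ddir (b i) \<phi>) (t *s x) = t ^ (d - 1 - 1) * ddir (b j) (ddir (b i) \<phi>) x" for i j
    using d by (intro ddir_homogeneous[OF polyfun_ddir_polyfun[OF \<phi>] _ t]) auto
  moreover have "d - 1 - 1 = d - 2" by simp
  ultimately have eq: "ddir (b j) (ddir (b i) \<phi>) (t *s x) = t ^ (d - 2) * ddir (b j) (ddir (b i) \<phi>) x" for i j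
    by metis
  have "t ^ (3 * (d - 2)) = t ^ (d - 2) * t ^ (d - 2) * t ^ (d - 2)"
    by (simp add: mult.commute[of 3] power_mult power3_eq_cube)
  then show ?thesis unfolding hessian_def det_3 by (simp add: eq algebra_simps)
qed

lemma ddir_total_tangency:
  assumes "total_tangency d \<phi> \<Lambda> \<alpha> \<mu> A c"
  shows "ddir b \<phi> x = (\<alpha> \<odot> b) * A x + (\<alpha> \<odot> x) * ddir b A x + c * of_nat d * (\<mu> \<odot> x) ^ (d - 1) * (\<mu> \<odot> b)"
proof -
  have "\<phi> = (\<lambda>v. (\<alpha> \<odot> v) * A v + c * (\<mu> \<odot> v) ^ d)" using total_tangencyD(6)[OF assms] by auto
  then show ?thesis
    using total_tangencyD(1)[OF assms]
    by (simp add: ddir_add ddir_mult ddir_power polyfun_intros algebra_simps)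
qed

lemma ddir2_total_tangency:
  assumes "total_tangency d \<phi> \<Lambda> \<alpha> \<mu> A c" "\<alpha> \<odot> x = 0"
  shows "ddir b' (ddir b \<phi>) x = (\<alpha> \<odot> b) * ddir b' A x + ddir b A x * (\<alpha> \<odot> b') +
    (c * of_nat d * of_nat (d - 1) * (\<mu> \<odot> x) ^ (d - 2)) * (\<mu> \<odot> b) * (\<mu> \<odot> b')"
proof -
  have A: "polyfun A" "\<And>b. polyfun (ddir b A)"
    using total_tangencyD(1)[OF assms(1)] polyfun_ddir_polyfun by auto
  have eq: "ddir b \<phi> = (\<lambda>x. (\<alpha> \<odot> b) * A x + (\<alpha> \<odot> x) * ddir b A x + (c * of_nat d * (\<mu> \<odot> b)) * (\<mu> \<odot> x) ^ (d - 1))"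
    using ddir_total_tangency[OF assms(1), of b] by (auto simp: algebra_simps)
  have "d - 1 - 1 = d - 2" by simp
  then show ?thesis
    unfolding eq using assms(2)
    by (simp add: ddir_add ddir_mult ddir_power A polyfun_intros algebra_simps)
qed

text \<open>For each i there is a relation A h = x \<phi> + y \<mu>^(d-2) with y nonzero at a point
  of \<Lambda>_i. The relation puts h^d into the ideals; the nonvanishing of y contradicts h = 0 on
  X.\<close>

lemma card_total_tangencies_le:
  fixes \<phi> :: "complex ^ 'n \<Rightarrow> complex" and b :: "3 \<Rightarrow> complex ^ 'n"
  assumes \<phi>: "polyfun \<phi>" and hom: "\<And>t v. \<phi> (t *s v) = t ^ d * \<phi> v" and d: "d \<ge> 3"
    and I: "finite I"
    and T: "\<And>i. i \<in> I \<Longrightarrow> total_tangency d \<phi> (\<Lambda> i) (\<alpha> i) (\<mu> i) (A i) (c i)"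
    and distinct: "\<And>i j. i \<in> I \<Longrightarrow> j \<in> I \<Longrightarrow> i \<noteq> j \<Longrightarrow> \<exists>v\<in>\<Lambda> i. \<alpha> j \<odot> v \<noteq> 0"
    and L: "vec.subspace L" and inv: "\<And>v u. u \<in> L \<Longrightarrow> \<phi> (v + u) = \<phi> v"
    and L\<Lambda>: "\<And>i. i \<in> I \<Longrightarrow> L \<subseteq> \<Lambda> i" "\<And>i. i \<in> I \<Longrightarrow> vec.dim (\<Lambda> i) = vec.dim L + 1"
    and span: "\<And>x. \<exists>k. x - (\<Sum>i\<in>UNIV. k i *s b i) \<in> L"
    and indep: "\<And>k i. (\<Sum>i\<in>UNIV. k i *s b i) \<in> L \<Longrightarrow> k i = 0"
  shows "card I \<le> 3 * d"
proof (rule ccontr)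
  assume "\<not> ?thesis"
  then have card: "card I > 3 * d" by simp
  let ?h = "hessian b \<phi>"
  have h: "polyfun ?h" by (rule polyfun_hessian[OF \<phi>])
  define \<delta> where "\<delta> i x = det (\<chi> j k. if j = 1 then \<alpha> i \<odot> b k else if j = 2 then ddir (b k) (A i) x
      else \<mu> i \<odot> b k :: complex ^ 3 ^ 3)" for i x
  have ex: "\<exists>x y. polyfun x \<and> polyfun y \<and>
      (\<forall>v. A i v * ?h v = x v * \<phi> v + y v * (\<mu> i \<odot> v) ^ (d - 2)) \<and> (\<exists>q\<in>\<Lambda> i. A i q \<noteq> 0 \<and> y q \<noteq> 0)"
    if i: "i \<in> I" for i
  proof -
    note TD = total_tangencyD[OF T[OF i]]
    obtain a where a: "\<alpha> i \<odot> a = 1" "\<mu> i \<odot> a = 0" using TD(4) by blast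
    have \<Lambda>: "vec.subspace (\<Lambda> i)" by (rule total_tangency_subspace[OF T[OF i]])
    have A_eq: "A i v = ddir a \<phi> v" if "v \<in> \<Lambda> i" for v
      using ddir_total_tangency[OF T[OF i], of a v] that TD(5)[of v] a by simp
    obtain p where p: "p \<in> \<Lambda> i" "p \<notin> L"
    proof -
      have "\<Lambda> i \<noteq> L" using L\<Lambda>(2)[OF i] by auto
      then show ?thesis using that L\<Lambda>(1)[OF i] by blast
    qed
    \<comment> \<open>Projecting p along L gives a point q of \<Lambda>_i outside L that is a
      combination of the three directions b. Together with L it spans \<Lambda>_i.\<close>
    obtain \<kappa> where \<kappa>: "p - (\<Sum>k\<in>UNIV. \<kappa> k *s b k) \<in> L" using span by blast
    define q where "q = (\<Sum>k\<in>UNIV. \<kappa> k *s b k)"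
    have pq: "p - q \<in> L" using \<kappa> by (simp add: q_def)
    have qL: "q \<notin> L"
    proof
      assume "q \<in> L"
      then have "(p - q) + q \<in> L" using pq L by (intro vec.subspace_add)
      then show False using p by simp
    qed
    have q: "q \<in> \<Lambda> i"
    proof -
      have "p - q \<in> \<Lambda> i" using pq L\<Lambda>(1)[OF i] by blast
      from vec.subspace_diff[OF \<Lambda> p(1) this] show ?thesis by simp
    qed
    have \<Lambda>_eq: "\<Lambda> i = vec.span (insert q L)"
      by (rule subspace_eq_span_insert[OF L \<Lambda> L\<Lambda>(1)[OF i] q qL L\<Lambda>(2)[OF i]])
    have A_scale: "A i (t *s q) = t ^ (d - 1) * A i q" for t
    proof (cases "t = 0")
      case True
      have "ddir a \<phi> 0 = 0"
      proof (rule ddir_eqI)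
        have "((\<lambda>t. t ^ d * \<phi> a) has_field_derivative of_nat d * 0 ^ (d - 1) * \<phi> a) (at 0)"
          by (auto intro!: derivative_eq_intros)
        then show "((\<lambda>t. \<phi> (0 + t *s a)) has_field_derivative 0) (at 0)"
          using d by (simp add: hom power_0_left)
      qed
      then show ?thesis using True A_eq[of 0] vec.subspace_0[OF \<Lambda>] d by (simp add: power_0_left)
    next
      case False
      then have "ddir a \<phi> (t *s q) = t ^ (d - 1) * ddir a \<phi> q"
        using d by (intro ddir_homogeneous[OF \<phi> hom]) auto
      then show ?thesis using A_eq[OF q] A_eq[OF vec.subspace_scale[OF \<Lambda> q]] by simp
    qed
    \<comment> \<open>On \<Lambda>_i, A is the derivative of \<phi> along a, hence invariant under L
      and homogeneous; a zero at q would make it vanish on all of \<Lambda>_i.\<close>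
    have Aq: "A i q \<noteq> 0"
    proof
      assume 0: "A i q = 0"
      obtain P where P: "P \<in> \<Lambda> i" "A i P \<noteq> 0" using TD(7) by blast
      then obtain k where k: "P - k *s q \<in> L" using \<Lambda>_eq mem_span_insert_subspace[OF L] by blast
      have "ddir a \<phi> (k *s q + (P - k *s q)) = ddir a \<phi> (k *s q)"
        by (rule ddir_translate) (rule inv[OF k])
      then have "A i P = A i (k *s q)"
        using A_eq[OF P(1)] A_eq[OF vec.subspace_scale[OF \<Lambda> q]] by simp
      then show False using P(2) 0 by (simp add: A_scale)
    qed
    have euler: "ddir q (A i) q = of_nat (d - 1) * A i q"
    proof (rule ddir_eqI)
      have "q + t *s q = (1 + t) *s q" for t by (simp add: vec.scale_left_distrib)
      then have "(\<lambda>t. A i (q + t *s q)) = (\<lambda>t. (1 + t) ^ (d - 1) * A i q)"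
        by (simp only: A_scale)
      then show "((\<lambda>t. A i (q + t *s q)) has_field_derivative of_nat (d - 1) * A i q) (at 0)"
        by (auto intro!: derivative_eq_intros)
    qed
    \<comment> \<open>A kernel vector of the matrix yields w in \<Lambda>_i along which A has
      derivative zero at q. Independence modulo L forces w = k q, and Euler's relation then gives k
      (d - 1) A(q) = 0.\<close>
    have \<delta>q: "\<delta> i q \<noteq> 0"
    proof
      let ?M = "\<chi> j k. if j = 1 then \<alpha> i \<odot> b k else if j = 2 then ddir (b k) (A i) q
        else \<mu> i \<odot> b k :: complex ^ 3 ^ 3"
      assume "\<delta> i q = 0"
      then have "\<not> invertible ?M" by (simp add: \<delta>_def invertible_det_nz)
      then obtain z where z: "?M *v z = 0" "z \<noteq> 0"
        by (auto simp: invertible_left_inverse matrix_left_invertible_ker)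
      define w where "w = (\<Sum>k\<in>UNIV. z $ k *s b k)"
      have comp: "(\<Sum>k\<in>UNIV. ?M $ j $ k * z $ k) = 0" for j
        using z(1) by (simp add: matrix_vector_mult_def vec_eq_iff)
      have 1: "\<alpha> i \<odot> w = 0" using comp[of 1] by (simp add: w_def mult.commute)
      have 2: "ddir w (A i) q = 0"
        using comp[of 2] by (simp add: w_def ddir_sum_direction[OF TD(1)] mult.commute)
      have 3: "\<mu> i \<odot> w = 0" using comp[of 3] by (simp add: w_def mult.commute)
      have "w \<in> \<Lambda> i" using 1 3 TD(5) by simp
      then obtain k where k: "w - k *s q \<in> L" using \<Lambda>_eq mem_span_insert_subspace[OF L] by blast
      have "w - k *s q = (\<Sum>j\<in>UNIV. (z $ j - k * \<kappa> j) *s b j)"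
        by (simp add: w_def q_def vec.scale_sum_right vec.scale_left_diff_distrib sum_subtractf)
      then have zk: "z $ j = k * \<kappa> j" for j using indep[of "\<lambda>j. z $ j - k * \<kappa> j" j] k by simp
      then have "w = k *s q" by (simp add: w_def q_def vec.scale_sum_right)
      then have "k * (of_nat (d - 1) * A i q) = 0"
        using 2 euler by (simp add: ddir_scale_direction[OF TD(1)])
      then have "k = 0" using Aq d by (simp del: of_nat_diff)
      then show False using zk z(2) by (simp add: vec_eq_iff)
    qed
    define K where "K = c i * of_nat d * of_nat (d - 1)"
    have K: "K \<noteq> 0" using TD(2) d by (simp add: K_def del: of_nat_diff)
    have \<delta>: "polyfun (\<delta> i)"
      unfolding \<delta>_def
    proof (rule polyfun_det_3)
      show "polyfun (\<lambda>x. if j = 1 then \<alpha> i \<odot> b k else if j = 2 then ddir (b k) (A i) x else \<mu> i \<odot> b k)"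
        for j k :: 3
        using TD(1) by (cases "j = 1"; cases "j = 2") (simp_all add: polyfun.const polyfun_ddir_polyfun)
    qed
    have "?h v + K * (\<mu> i \<odot> v) ^ (d - 2) * (\<delta> i v)\<^sup>2 = 0" if v: "\<alpha> i \<odot> v = 0" for v
    proof -
      have "?h v = - (K * (\<mu> i \<odot> v) ^ (d - 2)) * (\<delta> i v)\<^sup>2"
        unfolding hessian_def ddir2_total_tangency[OF T[OF i] v] \<delta>_def K_def
        by (rule det_rank_one_perturbation)
      then show ?thesis by simp
    qed
    moreover have "polyfun (\<lambda>v. ?h v + K * (\<mu> i \<odot> v) ^ (d - 2) * (\<delta> i v)\<^sup>2)"
      by (intro polyfun_intros h \<delta>)
    ultimately obtain h1 where h1: "polyfun h1"
      "\<And>v. ?h v + K * (\<mu> i \<odot> v) ^ (d - 2) * (\<delta> i v)\<^sup>2 = (\<alpha> i \<odot> v) * h1 v"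
      using polyfun_divide_linear[OF _ a(1)] by blast
    \<comment> \<open>Multiply h = \<alpha> h1 - K \<mu>^(d-2) \<delta>^2 by A and replace \<alpha>
      A by \<phi> - c \<mu>^d. Writing \<mu>^d as \<mu>^(d-2) \<mu>^2 leaves y as the cofactor of
      \<mu>^(d-2).\<close>
    define y where "y v = - (K * (\<delta> i v)\<^sup>2 * A i v) - c i * (\<mu> i \<odot> v)\<^sup>2 * h1 v" for v
    have "A i v * ?h v = h1 v * \<phi> v + y v * (\<mu> i \<odot> v) ^ (d - 2)" for v
    proof -
      have "d = (d - 2) + 2" using d by simp
      then have \<mu>d: "(\<mu> i \<odot> v) ^ d = (\<mu> i \<odot> v) ^ (d - 2) * (\<mu> i \<odot> v)\<^sup>2" by (metis power_add)
      have hv: "?h v = (\<alpha> i \<odot> v) * h1 v - K * (\<mu> i \<odot> v) ^ (d - 2) * (\<delta> i v)\<^sup>2"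
        using h1(2)[of v] by (simp add: algebra_simps)
      show ?thesis
        unfolding TD(6)[of v] \<mu>d y_def hv by (simp add: algebra_simps)
    qed
    moreover have "polyfun y" unfolding y_def by (intro polyfun_intros \<delta> TD(1) h1(1))
    moreover have "y q \<noteq> 0" using K \<delta>q Aq q TD(5)[of q] by (simp add: y_def)
    ultimately show ?thesis using h1(1) q Aq by blast
  qed
  have "(\<lambda>v. ?h v ^ d) \<in> ideal2 \<phi> (\<lambda>v. \<Prod>i\<in>I. (\<alpha> i \<odot> v) ^ (d - 2))"
  proof (rule ideal2_prod[OF I T distinct])
    show "(\<lambda>v. ?h v ^ d) \<in> ideal2 \<phi> (\<lambda>v. (\<alpha> i \<odot> v) ^ (d - 2))" if i: "i \<in> I" for i
    proof -
      obtain x y where "polyfun x" "polyfun y"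
        "\<And>v. A i v * ?h v = x v * \<phi> v + y v * (\<mu> i \<odot> v) ^ (d - 2)" using ex[OF i] by blast
      then show ?thesis by (rule power_mem_ideal2[OF T[OF i] \<phi> h])
    qed
  qed (assumption | intro polyfun_intros h)+
  then have van: "?h v ^ d = 0" if "\<phi> v = 0" for v
  proof (rule vanish_if_ideal2_prod[OF _ hom _ _ that])
    show "?h (t *s v) ^ d = t ^ (3 * (d - 2) * d) * ?h v ^ d" if "t \<noteq> 0" for t
      unfolding hessian_homogeneous[OF \<phi> hom d that] by (simp add: power_mult_distrib power_mult)
    show "3 * (d - 2) * d < (d - 2) * card I" using card d by simp
  qed
  obtain i where i: "i \<in> I" using card by fastforce
  obtain x y q where xy: "polyfun y" "\<And>v. A i v * ?h v = x v * \<phi> v + y v * (\<mu> i \<odot> v) ^ (d - 2)"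
    "q \<in> \<Lambda> i" "A i q \<noteq> 0" "y q \<noteq> 0" using ex[OF i] by blast
  have "d > 0" using d by simp
  \<comment> \<open>At such a point of X the relation reads A h = y \<mu>^(d-2), whose right side is
    nonzero although h vanishes.\<close>
  from hypersurface_point_near_tangency[OF T[OF i] this xy(1,3,4,5)]
  obtain v where "\<phi> v = 0" "\<mu> i \<odot> v \<noteq> 0" "y v \<noteq> 0" by blast
  then show False using xy(2)[of v] van[of v] \<open>d > 0\<close> by simp
qed

section \<open>Cones\<close>

text \<open>Independence in the quotient by L, expressed without forming the quotient space.\<close>

definition independent_mod ::
  "(complex ^ 'n) set \<Rightarrow> complex ^ 'n \<Rightarrow> complex ^ 'n \<Rightarrow> complex ^ 'n \<Rightarrow> bool" where
  "independent_mod L p q r \<longleftrightarrow>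
     (\<forall>x y z. x *s p + y *s q + z *s r \<in> L \<longrightarrow> x = 0 \<and> y = 0 \<and> z = 0)"

lemma independent_modD:
  assumes "independent_mod L p q r" "x *s p + y *s q + z *s r \<in> L"
  shows "x = 0" "y = 0" "z = 0"
  using assms unfolding independent_mod_def by blast+

lemma independent_mod_rotate: "independent_mod L p q r \<Longrightarrow> independent_mod L q r p"
  unfolding independent_mod_def by (metis add.commute add.left_commute)

lemma sum_lessThan_3: "(\<Sum>j<3. f j) = f 0 + f 1 + f (2 :: nat)"
  by (simp add: numeral_3_eq_3 numeral_2_eq_2)

lemma independent_mod_not_mem:
  assumes "vec.subspace L" "independent_mod L p q r"
  shows "r \<notin> L" "q \<notin> vec.span (insert r L)" "p \<notin> vec.span (insert q (vec.span (insert r L)))"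
proof -
  show "r \<notin> L" using independent_modD(3)[OF assms(2), of 0 0 1] by auto
  have "q - k *s r \<notin> L" for k
    using independent_modD(2)[OF assms(2), of 0 1 "-k"] by auto
  then show "q \<notin> vec.span (insert r L)"
    by (simp add: mem_span_insert_subspace[OF assms(1)])
  have "p - j *s q - k *s r \<notin> L" for j k
    using independent_modD(1)[OF assms(2), of 1 "-j" "-k"] by auto
  then show "p \<notin> vec.span (insert q (vec.span (insert r L)))"
    by (simp add: mem_span_insert_subspace[OF assms(1)] mem_span_insert_subspace[OF vec.subspace_span])
qed

lemma independent_mod_spans:
  fixes L :: "(complex ^ 'n) set"
  assumes L: "vec.subspace L" "vec.dim L + 3 = CARD('n)" and i: "independent_mod L p q r"
  shows "\<exists>x y z. v - (x *s p + y *s q + z *s r) \<in> L"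
proof -
  let ?W = "vec.span (insert p (vec.span (insert q (vec.span (insert r L)))))"
  note n = independent_mod_not_mem[OF L(1) i]
  have "vec.dim ?W = vec.dim L + 3"
    using dim_insert_subspace[OF L(1) n(1)] dim_insert_subspace[OF vec.subspace_span n(2)]
      dim_insert_subspace[OF vec.subspace_span n(3)] by linarith
  then have "vec.dim ?W = vec.dim (UNIV :: (complex ^ 'n) set)"
    using L(2) by (simp add: card_cart_basis)
  then have "?W = UNIV" by (metis vec.dim_eq_full vec.dim_UNIV vec.dimension_def vec.span_span)
  then have "v \<in> ?W" by simp
  then obtain x y z where "v - x *s p - y *s q - z *s r \<in> L"
    by (auto simp: mem_span_insert_subspace[OF L(1)] mem_span_insert_subspace[OF vec.subspace_span])
  then show ?thesis by (metis diff_diff_eq)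
qed

lemma ex_independent_mod:
  fixes L :: "(complex ^ 'n) set"
  assumes L: "vec.subspace L" "vec.dim L + 3 = CARD('n)"
  obtains p q r where "independent_mod L p q r"
proof -
  have ex: "\<exists>v. v \<notin> W" if "vec.dim W < CARD('n)" for W :: "(complex ^ 'n) set"
    using that by (metis UNIV_eq_I less_irrefl vec_dim_card)
  obtain r where r: "r \<notin> L" using ex[of L] L(2) by auto
  note dr = dim_insert_subspace[OF L(1) r]
  obtain q where q: "q \<notin> vec.span (insert r L)"
    using ex[of "vec.span (insert r L)"] dr L(2) by auto
  note dq = dim_insert_subspace[OF vec.subspace_span q]
  obtain p where p: "p \<notin> vec.span (insert q (vec.span (insert r L)))"
    using ex[of "vec.span (insert q (vec.span (insert r L)))"] dr dq L(2) by auto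
  have "x = 0 \<and> y = 0 \<and> z = 0" if e: "x *s p + y *s q + z *s r \<in> L" for x y z
  proof -
    have inv: "a \<in> W" if "c *s a \<in> W" "vec.subspace W" "c \<noteq> 0" for a c and W :: "(complex ^ 'n) set"
      using vec.subspace_scale[OF that(2,1), of "inverse c"] that(3) by simp
    let ?W1 = "vec.span (insert r L)" and ?W2 = "vec.span (insert q (vec.span (insert r L)))"
    have W: "L \<subseteq> ?W1" "r \<in> ?W1" "?W1 \<subseteq> ?W2" "q \<in> ?W2" by (auto intro: vec.span_base)
    have x: "x = 0"
    proof (rule ccontr)
      assume "x \<noteq> 0"
      have "x *s p + y *s q + z *s r - y *s q - z *s r \<in> ?W2"
        using e W by (intro vec.subspace_diff vec.subspace_scale vec.subspace_span) auto
      then have "x *s p \<in> ?W2" by simp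
      then show False using inv \<open>x \<noteq> 0\<close> p by blast
    qed
    have y: "y = 0"
    proof (rule ccontr)
      assume "y \<noteq> 0"
      have "x *s p + y *s q + z *s r - z *s r \<in> ?W1"
        using e W by (intro vec.subspace_diff vec.subspace_scale vec.subspace_span) auto
      then have "y *s q \<in> ?W1" using x by simp
      then show False using inv \<open>y \<noteq> 0\<close> q by blast
    qed
    have "z *s r \<in> L" using e x y by simp
    then have "z = 0" using inv r L(1) by blast
    then show ?thesis using x y by simp
  qed
  then have "independent_mod L p q r" unfolding independent_mod_def by blast
  then show ?thesis by (rule that)
qed

lemma coord_system_if_independent_mod:
  assumes "vec.subspace L" "independent_mod L (b 0) (b 1) (b 2)"
  shows "coord_system (vec.span (b ` {..<3})) 3 b"
    and "complementary_plane L (vec.span (b ` {..<3}))"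
proof -
  have 0: "k j = 0" if "(\<Sum>j<3. k j *s b j) \<in> L" "j < 3" for k j
  proof -
    have "k 0 = 0" "k 1 = 0" "k 2 = 0"
      using independent_modD[OF assms(2)] that(1) unfolding sum_lessThan_3 by blast+
    moreover have "j = 0 \<or> j = 1 \<or> j = 2" using that(2) by auto
    ultimately show ?thesis by auto
  qed
  have inj: "inj_on b {..<3}"
  proof (rule inj_onI, rule ccontr)
    fix i j :: nat assume ij: "i \<in> {..<3}" "j \<in> {..<3}" "b i = b j" "i \<noteq> j"
    let ?k = "\<lambda>l. (if l = i then 1 else 0) - (if l = j then 1 else 0) :: complex"
    have "(\<Sum>l<3. ?k l *s b l) = 0"
      using ij by (simp add: vec.scale_left_diff_distrib sum_subtractf
          if_distrib[of "\<lambda>c. c *s _"] sum.delta cong: if_cong)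
    then have "?k i = 0" using ij vec.subspace_0[OF assms(1)] by (intro 0) auto
    then show False using ij by simp
  qed
  have "vec.independent (b ` {..<3})"
  proof (rule vec.independent_if_scalars_zero)
    fix f x assume f: "(\<Sum>x\<in>b ` {..<3}. f x *s x) = 0" "x \<in> b ` {..<3}"
    then have "(\<Sum>j<3. f (b j) *s b j) \<in> L"
      using vec.subspace_0[OF assms(1)] by (simp add: sum.reindex[OF inj])
    then show "f x = 0" using 0[of "\<lambda>j. f (b j)"] f(2) by auto
  qed simp
  then show c: "coord_system (vec.span (b ` {..<3})) 3 b" by (simp add: coord_system_def inj)
  have "vec.dim (vec.span (b ` {..<3})) = 3"
    using \<open>vec.independent _\<close> by (simp add: vec.dim_eq_card_independent card_image[OF inj])
  moreover have "x = 0" if "x \<in> vec.span (b ` {..<3})" "x \<in> L" for x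
  proof -
    obtain y where "x = (\<Sum>j<3. y j *s b j)" using coord_system_expand[OF c \<open>x \<in> vec.span _\<close>] by blast
    then show ?thesis using 0[of y] that(2) by simp
  qed
  ultimately show "complementary_plane L (vec.span (b ` {..<3}))"
    unfolding complementary_plane_def proj_dim_def using assms(1)
    by (auto simp: vec.subspace_0 vec.span_zero)
qed

lemma independent_mod_if_complementary:
  assumes "complementary_plane L V" "coord_system V 3 b"
  shows "independent_mod L (b 0) (b 1) (b 2)"
  unfolding independent_mod_def
proof (intro allI impI)
  fix x y z assume L: "x *s b 0 + y *s b 1 + z *s b 2 \<in> L"
  define k where "k j = (if j = 0 then x else if j = 1 then y else z)" for j :: nat
  have eq: "x *s b 0 + y *s b 1 + z *s b 2 = (\<Sum>j<3. k j *s b j)" by (simp add: sum_lessThan_3 k_def)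
  then have "(\<Sum>j<3. k j *s b j) = 0"
    using L coord_system_mem[OF assms(2), of k] assms(1) by (auto simp: complementary_plane_def)
  moreover have inj: "inj_on b {..<3}" using assms(2) by (simp add: coord_system_def)
  \<comment> \<open>Independence of the set of basis vectors concerns coefficients indexed by
    vectors; the index is recovered through the inverse of \<open>b\<close>.\<close>
  moreover from this have "(\<Sum>j<3. k (the_inv_into {..<3} b (b j)) *s b j) = (\<Sum>j<3. k j *s b j)"
    by (intro sum.cong) (simp_all add: the_inv_into_f_f)
  ultimately have "(\<Sum>v\<in>b ` {..<3}. k (the_inv_into {..<3} b v) *s v) = 0"
    by (simp add: sum.reindex)
  moreover have "vec.independent (b ` {..<3})" using assms(2) by (simp add: coord_system_def)
  ultimately have "k (the_inv_into {..<3} b (b j)) = 0" if "j < 3" for j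
    using vec.independentD[of "b ` {..<3}" "b ` {..<3}" "\<lambda>v. k (the_inv_into {..<3} b v)" "b j"] that by auto
  then have "k j = 0" if "j < 3" for j using that inj by (simp add: the_inv_into_f_f)
  from this[of 0] this[of 1] this[of 2] show "x = 0 \<and> y = 0 \<and> z = 0" by (simp add: k_def)
qed

text \<open>A zero off L projects along L to a point of the curve. Points of L itself lie on every
  generator of the cone, but only if the curve has a point at all; the zero p off L guarantees
  this.\<close>

lemma zeros_eq_proj_cone:
  fixes L :: "(complex ^ 'n) set"
  assumes L: "vec.subspace L" "vec.dim L + 3 = CARD('n)" and i: "independent_mod L (b 0) (b 1) (b 2)"
    and hom: "\<And>t v. \<phi> (t *s v) = t ^ d * \<phi> v" and d: "d > 0"
    and inv: "\<And>v u. u \<in> L \<Longrightarrow> \<phi> (v + u) = \<phi> v"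
    and G: "\<And>y. meval G y = \<phi> (\<Sum>j<3. y j *s b j)"
    and p: "p \<notin> L" "\<phi> p = 0"
  shows "{v. v \<noteq> 0 \<and> \<phi> v = 0} = proj_cone L (curve_in_coords b G)"
proof -
  have split: "\<exists>y. v - (\<Sum>j<3. y j *s b j) \<in> L" for v
  proof -
    obtain x y z where "v - (x *s b 0 + y *s b 1 + z *s b 2) \<in> L"
      using independent_mod_spans[OF L i] by blast
    then show ?thesis
      unfolding sum_lessThan_3
      by (intro exI[of _ "\<lambda>j. if j = 0 then x else if j = 1 then y else z"]) simp
  qed
  have curve: "\<exists>w\<in>curve_in_coords b G. v - w \<in> L" if v: "v \<notin> L" "\<phi> v = 0" for v
  proof -
    obtain y where y: "v - (\<Sum>j<3. y j *s b j) \<in> L" using split by blast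
    let ?w = "\<Sum>j<3. y j *s b j"
    have "?w \<noteq> 0" using y v(1) by auto
    moreover have "\<phi> ?w = 0" using inv[OF y, of ?w] v(2) by simp
    ultimately have "?w \<in> curve_in_coords b G" unfolding curve_in_coords_def G by blast
    then show ?thesis using y by blast
  qed
  show ?thesis
  proof (intro equalityI subsetI)
    fix v assume v: "v \<in> {v. v \<noteq> 0 \<and> \<phi> v = 0}"
    obtain w where w: "w \<in> curve_in_coords b G" "v \<in> vec.span (insert w L)"
    proof (cases "v \<in> L")
      case True
      then show ?thesis using curve[OF p] that by (meson insertI2 vec.span_base)
    next
      case False
      then obtain w where w: "w \<in> curve_in_coords b G" "v - w \<in> L" using curve v by blast
      then have "v - 1 *s w \<in> L" by simp
      then show ?thesis using that[OF w(1)] unfolding mem_span_insert_subspace[OF L(1)] by blast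
    qed
    then show "v \<in> proj_cone L (curve_in_coords b G)" using v by (auto simp: proj_cone_def)
  next
    fix v assume "v \<in> proj_cone L (curve_in_coords b G)"
    then obtain w where w: "w \<in> curve_in_coords b G" "v \<in> vec.span (insert w L)" "v \<noteq> 0"
      by (auto simp: proj_cone_def)
    then obtain k where k: "v - k *s w \<in> L" using mem_span_insert_subspace[OF L(1)] by blast
    have "\<phi> w = 0" using w(1) G by (auto simp: curve_in_coords_def)
    then have "\<phi> (k *s w + (v - k *s w)) = 0" unfolding inv[OF k] hom by simp
    then show "v \<in> {v. v \<noteq> 0 \<and> \<phi> v = 0}" using w(3) by simp
  qed
qed

section \<open>Star subspaces through a common subspace\<close>

lemma meval_vec_homogeneous:
  assumes "homogeneous d F"
  shows "meval F (($) (t *s v)) = t ^ d * meval F (($) v)"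
proof -
  have "($) (t *s v) = (\<lambda>i. t * v $ i)" by (rule ext) simp
  then show ?thesis by (simp add: meval_homogeneous[OF assms])
qed

lemma star_subspacesD:
  fixes F :: "'n::finite mpoly"
  assumes "\<Lambda> \<in> star_subspaces d F"
  shows "vec.subspace \<Lambda>" "vec.dim \<Lambda> + 2 = CARD('n)"
  using assms by (auto simp: star_subspaces_def proj_dim_def card_cart_basis)

text \<open>At a point P of \<Lambda> with A nonzero the differential of \<phi> is A(P) \<alpha>,
  and invariance makes it vanish on L. So \<alpha> is zero on L, where \<phi> = \<phi>(0) = 0 then
  forces \<mu> = 0 too.\<close>

lemma subset_if_translation_invariant:
  assumes T: "total_tangency d \<phi> \<Lambda> \<alpha> \<mu> A c" and d: "d \<ge> 2"
    and L: "vec.subspace L" and inv: "\<And>v u. u \<in> L \<Longrightarrow> \<phi> (v + u) = \<phi> v"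
  shows "L \<subseteq> \<Lambda>"
proof
  note TD = total_tangencyD[OF T]
  fix u assume u: "u \<in> L"
  obtain P where P: "P \<in> \<Lambda>" "A P \<noteq> 0" using TD(7) by blast
  have "(\<lambda>t. \<phi> (P + t *s u)) = (\<lambda>t. \<phi> P)" using inv vec.subspace_scale[OF L u] by auto
  then have "ddir u \<phi> P = 0" by (intro ddir_eqI) simp
  then have \<alpha>: "\<alpha> \<odot> u = 0"
    using ddir_total_tangency[OF T, of u P] P TD(5)[of P] d by (simp add: power_0_left)
  have "\<phi> u = \<phi> 0" using inv[OF u, of 0] by simp
  then have "\<mu> \<odot> u = 0" using TD(2,6) \<alpha> d by (simp add: power_0_left)
  then show "u \<in> \<Lambda>" using \<alpha> TD(5) by simp
qed

text \<open>Finiteness is not known beforehand, so invariance and the bound are first obtained from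
  finite sets of subspaces; a uniform bound on these gives finiteness.\<close>

theorem star_subspaces_through_common_subspace:
  fixes F :: "'n::finite mpoly"
  assumes F: "homogeneous d F" and d: "d \<ge> 3" and ne: "star_subspaces d F \<noteq> {}"
    and L: "vec.subspace L" "vec.dim L + 3 = CARD('n)"
    and sub: "\<And>\<Lambda>. \<Lambda> \<in> star_subspaces d F \<Longrightarrow> L \<subseteq> \<Lambda>"
  shows "infinite (star_subspaces d F) \<or> card (star_subspaces d F) \<ge> d \<Longrightarrow>
      cone_over_plane_curve (proj_zeros F) L"
    and "finite (star_subspaces d F)" "card (star_subspaces d F) \<le> 3 * d"
proof -
  let ?S = "star_subspaces d F"
  define \<phi> where "\<phi> v = meval F (($) v)" for v
  have \<phi>: "polyfun \<phi>" unfolding \<phi>_def by (rule polyfun_meval)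
  have hom: "\<phi> (t *s v) = t ^ d * \<phi> v" for t v
    unfolding \<phi>_def by (rule meval_vec_homogeneous[OF F])
  \<comment> \<open>The data of each tangency are packed into one tuple, so that a single choice
    function selects them.\<close>
  have "\<forall>\<Lambda>. \<exists>X. \<Lambda> \<in> ?S \<longrightarrow>
      total_tangency d \<phi> \<Lambda> (fst X) (fst (snd X)) (fst (snd (snd X))) (snd (snd (snd X)))"
  proof
    fix \<Lambda>
    show "\<exists>X. \<Lambda> \<in> ?S \<longrightarrow>
      total_tangency d \<phi> \<Lambda> (fst X) (fst (snd X)) (fst (snd (snd X))) (snd (snd (snd X)))"
    proof (cases "\<Lambda> \<in> ?S")
      case True
      obtain \<alpha> \<mu> A c where "total_tangency d \<phi> \<Lambda> \<alpha> \<mu> A c"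
        using star_subspace_total_tangency[OF F d True] unfolding \<phi>_def by blast
      then show ?thesis by (intro exI[of _ "(\<alpha>, \<mu>, A, c)"]) simp
    qed simp
  qed
  from choice[OF this] obtain X where X: "\<forall>\<Lambda>. \<Lambda> \<in> ?S \<longrightarrow> total_tangency d \<phi> \<Lambda>
      (fst (X \<Lambda>)) (fst (snd (X \<Lambda>))) (fst (snd (snd (X \<Lambda>)))) (snd (snd (snd (X \<Lambda>))))" by blast
  define \<alpha> \<mu> A c where "\<alpha> \<Lambda> = fst (X \<Lambda>)" and "\<mu> \<Lambda> = fst (snd (X \<Lambda>))"
    and "A \<Lambda> = fst (snd (snd (X \<Lambda>)))" and "c \<Lambda> = snd (snd (snd (X \<Lambda>)))" for \<Lambda>
  have T: "total_tangency d \<phi> \<Lambda> (\<alpha> \<Lambda>) (\<mu> \<Lambda>) (A \<Lambda>) (c \<Lambda>)" if "\<Lambda> \<in> ?S" for \<Lambda>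
    using X that unfolding \<alpha>_def \<mu>_def A_def c_def by blast
  have dims: "vec.dim \<Lambda> = vec.dim L + 1" if "\<Lambda> \<in> ?S" for \<Lambda>
    using star_subspacesD(2)[OF that] L(2) by simp
  have distinct: "\<exists>v\<in>\<Lambda>. \<alpha> \<Lambda>' \<odot> v \<noteq> 0" if "\<Lambda> \<in> ?S" "\<Lambda>' \<in> ?S" "\<Lambda> \<noteq> \<Lambda>'" for \<Lambda> \<Lambda>'
    using total_tangency_distinct[OF T[OF that(1)] T[OF that(2)] that(3)] that d by (simp add: dims)
  have inv: "\<phi> (v + u) = \<phi> v" if I: "I \<subseteq> ?S" "finite I" "card I \<ge> d" and u: "u \<in> L" for I u v
    by (rule translation_invariant_if_many_tangencies[OF \<phi> hom _ I(2,3),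
          where \<Lambda> = "\<lambda>\<Lambda>. \<Lambda>" and \<alpha> = \<alpha> and \<mu> = \<mu> and A = A and c = c])
       (use d in simp, (use I u sub T distinct in blast)+)
  obtain p q r where i: "independent_mod L p q r" using ex_independent_mod[OF L] by blast
  have le: "card I \<le> 3 * d" if I: "I \<subseteq> ?S" "finite I" for I
  proof (rule ccontr)
    \<comment> \<open>A finite set violating the bound has at least d elements and thereby supplies
      the invariance under L that the Hessian argument requires.\<close>
    assume neg: "\<not> ?thesis"
    define b where "b k = (if k = 1 then p else if k = 2 then q else r)" for k :: 3
    have sum_b: "(\<Sum>k\<in>UNIV. k' k *s b k) = k' 1 *s p + k' 2 *s q + k' 3 *s r" for k'
      by (simp add: sum_3 b_def)
    have "card I \<le> 3 * d"
    proof (rule card_total_tangencies_le[OF \<phi> hom d I(2) _ _ L(1), where b = b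
          and \<Lambda> = "\<lambda>\<Lambda>. \<Lambda>" and \<alpha> = \<alpha> and \<mu> = \<mu> and A = A and c = c])
      show "total_tangency d \<phi> \<Lambda> (\<alpha> \<Lambda>) (\<mu> \<Lambda>) (A \<Lambda>) (c \<Lambda>)" "L \<subseteq> \<Lambda>" "vec.dim \<Lambda> = vec.dim L + 1"
        if "\<Lambda> \<in> I" for \<Lambda> using that I(1) T sub dims by blast+
      show "\<exists>v\<in>\<Lambda>. \<alpha> \<Lambda>' \<odot> v \<noteq> 0" if "\<Lambda> \<in> I" "\<Lambda>' \<in> I" "\<Lambda> \<noteq> \<Lambda>'" for \<Lambda> \<Lambda>'
        using that I(1) distinct by blast
      show "\<exists>k. x - (\<Sum>j\<in>UNIV. k j *s b j) \<in> L" for x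
      proof -
        obtain x' y z where "x - (x' *s p + y *s q + z *s r) \<in> L"
          using independent_mod_spans[OF L i] by blast
        then show ?thesis unfolding sum_b
          by (intro exI[of _ "\<lambda>k. if k = 1 then x' else if k = 2 then y else z"]) simp
      qed
      show "k j = 0" if "(\<Sum>j\<in>UNIV. k j *s b j) \<in> L" for k j
        using independent_modD[OF i that[unfolded sum_b]] exhaust_3[of j] by auto
      show "\<phi> (v + u) = \<phi> v" if "u \<in> L" for u v
        using inv[OF I _ that] neg by simp
    qed
    then show False using neg by simp
  qed
  show fin: "finite ?S"
  proof (rule ccontr)
    assume "infinite ?S"
    then obtain I where "I \<subseteq> ?S" "finite I" "card I = Suc (3 * d)"
      using infinite_arbitrarily_large by blast
    then show False using le[of I] by simp
  qed
  then show "card ?S \<le> 3 * d" by (rule le[OF order_refl])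
  assume many: "infinite ?S \<or> card ?S \<ge> d"
  have inv: "\<phi> (v + u) = \<phi> v" if "u \<in> L" for u v
    by (rule inv[OF order_refl fin _ that]) (use many fin in simp)
  define b where "b k = (if k = 0 then p else if k = 1 then q else r)" for k :: nat
  have i: "independent_mod L (b 0) (b 1) (b 2)" using i by (simp add: b_def)
  let ?V = "vec.span (b ` {..<3})" and ?G = "restrict_poly F 3 b"
  obtain \<Lambda> where \<Lambda>: "\<Lambda> \<in> ?S" using ne by blast
  have "\<not> \<Lambda> \<subseteq> L"
    using vec.dim_subset[of \<Lambda> L] dims[OF \<Lambda>] by auto
  then obtain p' where p': "p' \<in> \<Lambda>" "p' \<notin> L" by blast
  have "\<phi> p' = 0" using total_tangencyD(5,6)[OF T[OF \<Lambda>], of p'] p' d by simp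
  moreover have "meval ?G y = \<phi> (\<Sum>j<3. y j *s b j)" for y
    unfolding \<phi>_def by (rule meval_restrict_poly)
  moreover have "d > 0" using d by simp
  ultimately have "{v. v \<noteq> 0 \<and> \<phi> v = 0} = proj_cone L (curve_in_coords b ?G)"
    using zeros_eq_proj_cone[where \<phi> = \<phi> and L = L and b = b and d = d and G = ?G and p = p'] L i hom inv p'(2)
    by blast
  then have "proj_zeros F = proj_cone L (curve_in_coords b ?G)" by (simp add: proj_zeros_def \<phi>_def)
  moreover have "plane_curve ?V (curve_in_coords b ?G)"
  proof -
    \<comment> \<open>If \<phi> vanished on the plane, then by invariance everywhere; but it equals
      c at the vector u with \<alpha> = 0 and \<mu> = 1.\<close>
    have "?G \<noteq> 0"
    proof
      assume "?G = 0"
      then have 0: "\<phi> (\<Sum>j<3. y j *s b j) = 0" for y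
        using meval_restrict_poly[of F 3 b y] by (simp add: \<phi>_def)
      have "\<phi> v = 0" for v
      proof -
        obtain x y z where k: "v - (x *s b 0 + y *s b 1 + z *s b 2) \<in> L"
          using independent_mod_spans[OF L i] by blast
        have "x *s b 0 + y *s b 1 + z *s b 2 = (\<Sum>j<3. (if j = 0 then x else if j = 1 then y else z) *s b j)"
          by (simp add: sum_lessThan_3)
        then show ?thesis using inv[OF k, of "x *s b 0 + y *s b 1 + z *s b 2"] 0 by simp
      qed
      moreover obtain u where "\<alpha> \<Lambda> \<odot> u = 0" "\<mu> \<Lambda> \<odot> u = 1"
        using total_tangencyD(3)[OF T[OF \<Lambda>]] by blast
      ultimately show False using total_tangencyD(2)[OF T[OF \<Lambda>]] total_tangencyD(6)[OF T[OF \<Lambda>], of u] by simp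
    qed
    then show ?thesis unfolding plane_curve_def
      using coord_system_if_independent_mod(1)[OF L(1) i] d homogeneous_restrict_poly[OF F]
        mvars_restrict_poly[of F 3 b]
      by (intro exI[of _ b] exI[of _ ?G] exI[of _ d]) auto
  qed
  ultimately show "cone_over_plane_curve (proj_zeros F) L"
    unfolding cone_over_plane_curve_def using coord_system_if_independent_mod(2)[OF L(1) i] by blast
qed

section \<open>The Fermat form\<close>

lemma ex_dual_functional:
  fixes p :: "complex ^ 'n"
  assumes "vec.subspace L" "independent_mod L p q r"
  obtains g where "g \<odot> p = 1" "g \<odot> q = 0" "g \<odot> r = 0" "\<And>u. u \<in> L \<Longrightarrow> g \<odot> u = 0"
proof -
  let ?W = "vec.span (insert q (vec.span (insert r L)))"
  have W: "q \<in> ?W" "r \<in> ?W" "L \<subseteq> ?W" by (auto intro: vec.span_base)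
  obtain g where "\<And>w. w \<in> ?W \<Longrightarrow> g \<odot> w = 0" "g \<odot> p = 1"
    using ex_scalar_product_separating[OF vec.subspace_span independent_mod_not_mem(3)[OF assms]] by blast
  then show ?thesis using W that[of g] by blast
qed

definition linear_form :: "complex ^ 'n \<Rightarrow> 'n::finite mpoly" where
  "linear_form g = (\<Sum>i\<in>UNIV. mConst (g $ i) * mVar i)"

lemma meval_linear_form [simp]: "meval (linear_form g) (($) v) = g \<odot> v"
  by (simp add: linear_form_def scalar_product_def)

lemma homogeneous_linear_form: "homogeneous 1 (linear_form g)"
  unfolding linear_form_def by (rule homogeneous_linear)

lemma meval_vec_eqD:
  assumes "\<And>v :: complex ^ 'n. meval F (($) v) = meval G (($) v)"
  shows "F = G"
proof (rule meval_eqD)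
  fix x :: "'n \<Rightarrow> complex"
  have "($) (\<chi> i. x i) = x" by (rule ext) simp
  then show "meval F x = meval G x" using assms[of "\<chi> i. x i"] by simp
qed

lemma is_unit_if_meval_constant:
  fixes G :: "'n::finite mpoly"
  assumes "\<And>v. meval G (($) v) = c" "c \<noteq> 0"
  shows "G dvd 1"
proof -
  have "1 = G * mConst (inverse c)" by (rule meval_vec_eqD) (use assms in simp)
  then show ?thesis by (rule dvdI)
qed

text \<open>Since p(0) is nonzero, every factor X of the monomial must come from q; these are
  stripped off one by one.\<close>

lemma degree_factor_of_monom:
  fixes p q :: "complex poly"
  assumes "p * q = monom c d" "c \<noteq> 0" "poly p 0 \<noteq> 0"
  shows "degree p = 0"
  using assms(1)
proof (induction d arbitrary: q)
  case 0
  then have "p \<noteq> 0" "q \<noteq> 0" using assms(2) by (auto simp: monom_eq_0_iff)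
  then have "degree p + degree q = degree (monom c 0)" by (simp flip: 0 add: degree_mult_eq)
  then show ?case by (simp add: degree_monom_eq assms(2))
next
  case (Suc d)
  have "poly p 0 * poly q 0 = 0"
    using arg_cong[OF Suc.prems, of "\<lambda>p. poly p 0"] by (simp add: poly_monom)
  then obtain q' where q': "q = [:0, 1:] * q'" using assms(3) by (auto simp: poly_eq_0_iff_dvd elim!: dvdE)
  have "[:0, 1:] * (p * q') = [:0, 1:] * monom c d"
    using Suc.prems by (simp add: q' monom_Suc mult.left_commute)
  then have "p * q' = monom c d" by (simp only: mult_cancel_left) simp
  then show ?case by (rule Suc.IH)
qed

lemma poly_const_if_factor_of_monom:
  fixes p q :: "complex poly"
  assumes "\<And>t. poly p t * poly q t = c * t ^ d" "c \<noteq> 0" "poly p 0 \<noteq> 0"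
  shows "poly p t = poly p 0"
proof -
  have "poly (p * q - monom c d) t = 0" for t using assms(1) by (simp add: poly_monom)
  then have "p * q - monom c d = 0" using poly_all_0_iff_0 by blast
  then have "degree p = 0" using assms(2,3) by (intro degree_factor_of_monom) auto
  then obtain a where "p = [:a:]" by (rule degree_eq_zeroE)
  then show ?thesis by simp
qed

lemma ex_root_minus_one: "d > 0 \<Longrightarrow> \<exists>\<zeta>::complex. \<zeta> ^ d = - 1"
  using card_nth_roots[of "-1" d] by (metis (mono_tags, lifting) card.empty empty_Collect_eq less_irrefl neg_equal_0_iff_equal zero_neq_one)

text \<open>The \<gamma> are the coordinates of the plane with basis b, extended by zero along L, so
  the Fermat form in them is an equation of the cone with vertex L.\<close>

locale fermat_coords =
  fixes L :: "(complex ^ 'n) set" and b \<gamma> :: "nat \<Rightarrow> complex ^ 'n" and d :: nat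
  assumes L: "vec.subspace L" "vec.dim L + 3 = CARD('n)"
    and indep: "independent_mod L (b 0) (b 1) (b 2)"
    and dual: "\<And>i j. i < 3 \<Longrightarrow> j < 3 \<Longrightarrow> \<gamma> i \<odot> b j = (if i = j then 1 else 0)"
    and \<gamma>L: "\<And>i u. i < 3 \<Longrightarrow> u \<in> L \<Longrightarrow> \<gamma> i \<odot> u = 0"
    and d: "d \<ge> 3"
begin

definition fermat :: "complex ^ 'n \<Rightarrow> complex" where
  "fermat v = (\<gamma> 0 \<odot> v) ^ d + (\<gamma> 1 \<odot> v) ^ d + (\<gamma> 2 \<odot> v) ^ d"

definition fermat_poly :: "'n mpoly" where
  "fermat_poly = linear_form (\<gamma> 0) ^ d + linear_form (\<gamma> 1) ^ d + linear_form (\<gamma> 2) ^ d"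

lemma meval_fermat_poly: "meval fermat_poly (($) v) = fermat v"
  by (simp add: fermat_poly_def fermat_def)

lemma dual_simps [simp]:
  "\<gamma> 0 \<odot> b 0 = 1" "\<gamma> 0 \<odot> b 1 = 0" "\<gamma> 0 \<odot> b 2 = 0"
  "\<gamma> 1 \<odot> b 0 = 0" "\<gamma> 1 \<odot> b 1 = 1" "\<gamma> 1 \<odot> b 2 = 0"
  "\<gamma> 2 \<odot> b 0 = 0" "\<gamma> 2 \<odot> b 1 = 0" "\<gamma> 2 \<odot> b 2 = 1"
  "\<gamma> (Suc 0) \<odot> b 0 = 0" "\<gamma> (Suc 0) \<odot> b (Suc 0) = 1" "\<gamma> (Suc 0) \<odot> b 2 = 0"
  "\<gamma> 0 \<odot> b (Suc 0) = 0" "\<gamma> 2 \<odot> b (Suc 0) = 0"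
  using dual[of 0 0] dual[of 0 1] dual[of 0 2] dual[of 1 0] dual[of 1 1] dual[of 1 2]
    dual[of 2 0] dual[of 2 1] dual[of 2 2] by simp_all

lemma polyfun_fermat: "polyfun fermat"
  unfolding fermat_def by (intro polyfun_intros)

lemma homogeneous_fermat_poly: "homogeneous d fermat_poly"
proof -
  have *: "homogeneous d (linear_form g ^ d)" for g :: "complex ^ 'n"
    using homogeneous_power[OF homogeneous_linear_form, of d g] by simp
  have "homogeneous d (F + G)" if "homogeneous d F" "homogeneous d G" for F G :: "'n mpoly"
    using that keys_add[of F G] by (auto simp: homogeneous_iff)
  then show ?thesis unfolding fermat_poly_def using * by blast
qed

lemma fermat_scale: "fermat (t *s v) = t ^ d * fermat v"
  by (simp add: fermat_def power_mult_distrib algebra_simps)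

lemma fermat_translate: "u \<in> L \<Longrightarrow> fermat (v + u) = fermat v"
  using \<gamma>L by (simp add: fermat_def)

text \<open>On the ray t v the product g h is \<open>fermat v\<close> times t^d. If that is a
  nonzero monomial, a factor with nonzero value at 0 is constant; density covers the remaining
  v.\<close>

lemma fermat_factor_constant:
  assumes "polyfun g" "polyfun h" "\<And>v. g v * h v = fermat v" "g 0 \<noteq> 0"
  shows "g v = g 0"
proof -
  have "g v - g 0 = 0" if "fermat v \<noteq> 0" for v
  proof -
    obtain p where p: "\<And>t. g (0 + t *s v) = poly p t" using polyfun_line[OF assms(1)] by blast
    obtain q where q: "\<And>t. h (0 + t *s v) = poly q t" using polyfun_line[OF assms(2)] by blast
    have "poly p t * poly q t = fermat v * t ^ d" for t
      using assms(3)[of "t *s v"] p[of t] q[of t] by (simp add: fermat_scale)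
    then have "poly p 1 = poly p 0"
      using that assms(4) p[of 0] by (intro poly_const_if_factor_of_monom) auto
    then show ?thesis using p[of 1] p[of 0] by simp
  qed
  moreover have "fermat (b 0) \<noteq> 0" using d by (simp add: fermat_def power_0_left)
  ultimately have "g v - g 0 = 0"
    using polyfun_dense[OF polyfun_fermat polyfun_diff[OF assms(1) polyfun.const] vec.subspace_UNIV,
        of "b 0" "g 0" v] by blast
  then show ?thesis by simp
qed

text \<open>
  Eisenstein's argument for the prime \<open>\<gamma>\<^sub>1 - \<zeta> \<gamma>\<^sub>2\<close>: both factors of the Fermat form would vanish
  at \<open>\<zeta> b\<^sub>1 + b\<^sub>2\<close>, which is a smooth point.
\<close>

lemma fermat_factor_vanishes:
  assumes "polyfun g" "polyfun h" "\<And>v. g v * h v = fermat v" "g 0 = 0" "\<zeta> ^ d = - 1"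
  shows "g (\<zeta> *s b 1 + b 2) = 0"
proof (rule ccontr)
  let ?w = "\<zeta> *s b 1 + b 2"
  assume gw: "g ?w \<noteq> 0"
  \<comment> \<open>On the plane of \<open>?w\<close> and \<open>b 0\<close> the last two terms
    cancel because of the choice of \<zeta>, and only a monomial in s remains.\<close>
  have f: "fermat (t *s ?w + s *s b 0) = s ^ d" for s t
    using d assms(5) by (simp add: fermat_def power_mult_distrib)
  obtain p where p: "\<And>t. g (0 + t *s ?w) = poly p t" using polyfun_line[OF assms(1)] by blast
  obtain q where q: "\<And>t. g (b 0 + t *s ?w) = poly q t" using polyfun_line[OF assms(1)] by blast
  \<comment> \<open>Where g is nonzero at t w, it is constant on the line t w + s b_0, so p and q
    agree. They then agree identically, and t = 0 gives g(b_0) = g(0) = 0, contrary to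
    \<open>fermat (b 0)\<close> being 1.\<close>
  have "poly (q - p) t = 0" if t: "poly p t \<noteq> 0" for t
  proof -
    obtain p1 where p1: "\<And>s. g (t *s ?w + s *s b 0) = poly p1 s" using polyfun_line[OF assms(1)] by blast
    obtain q1 where q1: "\<And>s. h (t *s ?w + s *s b 0) = poly q1 s" using polyfun_line[OF assms(2)] by blast
    have "poly p1 s * poly q1 s = 1 * s ^ d" for s
      using assms(3)[of "t *s ?w + s *s b 0"] unfolding f p1 q1 by simp
    moreover have "poly p1 0 \<noteq> 0" using t p[of t] p1[of 0] by simp
    ultimately have "poly p1 1 = poly p1 0" by (intro poly_const_if_factor_of_monom[where c = 1]) auto
    then show ?thesis using p[of t] q[of t] p1[of 0] p1[of 1] by (simp add: add.commute)
  qed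
  moreover have "p \<noteq> 0" using gw p[of 1] by auto
  ultimately have "q - p = 0" using poly_eq_0_if_eventually by blast
  then have "q = p" by simp
  then have "g (b 0) = 0" using p[of 0] q[of 0] assms(4) by simp
  then have "fermat (b 0) = 0" using assms(3)[of "b 0"] by simp
  then show False using d by (simp add: fermat_def power_0_left)
qed

lemma ddir_fermat:
  "ddir w fermat v = of_nat d * ((\<gamma> 0 \<odot> v) ^ (d - 1) * (\<gamma> 0 \<odot> w) +
     (\<gamma> 1 \<odot> v) ^ (d - 1) * (\<gamma> 1 \<odot> w) + (\<gamma> 2 \<odot> v) ^ (d - 1) * (\<gamma> 2 \<odot> w))"
  unfolding fermat_def by (simp add: ddir_add ddir_power polyfun_intros algebra_simps)

lemma irreducible_fermat_poly: "irreducible fermat_poly"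
proof (rule irreducibleI)
  show "fermat_poly \<noteq> 0"
  proof
    assume "fermat_poly = 0"
    then have "fermat (b 0) = 0" using meval_fermat_poly[of "b 0"] by simp
    then show False using d by (simp add: fermat_def power_0_left)
  qed
  show "\<not> fermat_poly dvd 1"
  proof
    assume "fermat_poly dvd 1"
    moreover have "meval fermat_poly (($) 0) = 0"
      unfolding meval_fermat_poly using d by (simp add: fermat_def power_0_left)
    ultimately have "meval 1 (($) (0 :: complex ^ 'n)) = 0" by (rule meval_dvd)
    then show False by simp
  qed
  fix G H :: "'n mpoly" assume GH: "fermat_poly = G * H"
  define g where "g v = meval G (($) v)" for v
  define h where "h v = meval H (($) v)" for v
  have gh: "polyfun g" "polyfun h" unfolding g_def h_def by (rule polyfun_meval)+
  have eq: "g v * h v = fermat v" "h v * g v = fermat v" for v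
    using meval_fermat_poly[of v] GH by (auto simp: g_def h_def mult.commute)
  show "G dvd 1 \<or> H dvd 1"
  proof (rule ccontr)
    assume neg: "\<not> ?thesis"
    have "g 0 = 0"
      using neg fermat_factor_constant[OF gh eq(1)] is_unit_if_meval_constant[of G "g 0"]
      unfolding g_def by blast
    moreover have "h 0 = 0"
      using neg fermat_factor_constant[OF gh(2,1) eq(2)] is_unit_if_meval_constant[of H "h 0"]
      unfolding h_def by blast
    moreover obtain \<zeta> :: complex where \<zeta>: "\<zeta> ^ d = - 1" using ex_root_minus_one[of d] d by auto
    ultimately have 0: "g (\<zeta> *s b 1 + b 2) = 0" "h (\<zeta> *s b 1 + b 2) = 0"
      using fermat_factor_vanishes gh eq by blast+
    \<comment> \<open>At a common zero of both factors the product rule gives derivative 0, whereas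
      the derivative of the Fermat form along \<open>b 1\<close> is d \<zeta>^(d-1).\<close>
    have "ddir (b 1) fermat (\<zeta> *s b 1 + b 2) = ddir (b 1) (\<lambda>v. g v * h v) (\<zeta> *s b 1 + b 2)"
      by (simp add: eq(1))
    then have "\<zeta> ^ (d - 1) = 0" using d 0 by (simp add: ddir_mult gh ddir_fermat)
    then have "\<zeta> = 0" using d by simp
    then show False using \<zeta> d by (simp add: power_0_left)
  qed
qed

text \<open>A Nullstellensatz in fixed degree. On a line in direction b_0 the Fermat form is t^d +
  \<rho>, with d distinct roots if \<rho> is nonzero. Subtracting \<kappa> times it from F cancels
  the coefficient of t^d, so a remainder of degree less than d vanishes at d points.\<close>

lemma unique_fermat_equation:
  assumes F: "homogeneous d F" and z: "\<And>v. meval F (($) v) = 0 \<longleftrightarrow> fermat v = 0"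
  obtains \<kappa> where "\<kappa> \<noteq> 0" "\<And>v. meval F (($) v) = \<kappa> * fermat v"
proof -
  define \<phi> where "\<phi> v = meval F (($) v)" for v
  have \<phi>: "polyfun \<phi>" unfolding \<phi>_def by (rule polyfun_meval)
  have hom: "\<phi> (t *s v) = t ^ d * \<phi> v" for t v
    unfolding \<phi>_def by (rule meval_vec_homogeneous[OF F])
  define \<kappa> where "\<kappa> = \<phi> (b 0)"
  define \<rho> where "\<rho> v = (\<gamma> 1 \<odot> v) ^ d + (\<gamma> 2 \<odot> v) ^ d" for v
  have "\<phi> v - \<kappa> * fermat v = 0" if \<rho>: "\<rho> v \<noteq> 0" for v
  proof -
    define w where "w = v - (\<gamma> 0 \<odot> v) *s b 0"
    have fw: "fermat (w + t *s b 0) = t ^ d + \<rho> v" for t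
      by (simp add: fermat_def w_def \<rho>_def)
    obtain p where p: "\<And>t. \<phi> (w + t *s b 0) = poly p t" using polyfun_line[OF \<phi>] by blast
    obtain s where s: "\<And>t. \<phi> (b 0 + t *s w) = poly s t" using polyfun_line[OF \<phi>] by blast
    obtain s' where s': "s - [:\<kappa>:] = [:0, 1:] * s'"
    proof -
      have "poly (s - [:\<kappa>:]) 0 = 0" using s[of 0] by (simp add: \<kappa>_def)
      then show ?thesis using that unfolding poly_eq_0_iff_dvd by (auto elim!: dvdE)
    qed
    define r where "r = p - [:\<kappa>:] * (monom 1 d + [:\<rho> v:])"
    \<comment> \<open>Homogeneity gives p(t) = t^d s(1/t) with s(0) = \<kappa>. The monomial on the
      right absorbs the constant \<kappa> \<rho>, so that the growth criterion applies to r.\<close>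
    have "t * poly r t = t ^ d * poly (s' - monom (\<kappa> * \<rho> v) (d - 1)) (inverse t)" if t: "t \<noteq> 0" for t
    proof -
      have "t *s (b 0 + inverse t *s w) = w + t *s b 0"
        using t by (simp add: vec.scale_right_distrib add.commute)
      then have "poly p t = t ^ d * poly s (inverse t)" unfolding p[symmetric] s[symmetric] by (metis hom)
      also have "poly s (inverse t) = \<kappa> + inverse t * poly s' (inverse t)"
        using arg_cong[OF s', of "\<lambda>p. poly p (inverse t)"] by (simp add: algebra_simps)
      finally have r: "poly r t = t ^ d * (inverse t * poly s' (inverse t)) - \<kappa> * \<rho> v"
        by (simp add: r_def poly_monom algebra_simps)
      have td: "t ^ d * inverse t ^ (d - 1) = t"
      proof -
        have "t ^ d = t ^ (d - 1) * t" using d by (simp flip: power_Suc2)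
        then show ?thesis using t by (simp add: power_inverse)
      qed
      have "t * poly r t = t ^ d * poly s' (inverse t) * (t * inverse t) - \<kappa> * \<rho> v * t"
        unfolding r by (simp only: algebra_simps)
      also have "\<dots> = t ^ d * poly s' (inverse t) - \<kappa> * \<rho> v * (t ^ d * inverse t ^ (d - 1))"
        unfolding td using t by simp
      also have "\<dots> = t ^ d * poly (s' - monom (\<kappa> * \<rho> v) (d - 1)) (inverse t)"
        by (simp add: poly_monom algebra_simps)
      finally show ?thesis .
    qed
    then have "r = 0 \<or> degree r < d" using poly_degree_less_if_growth by blast
    moreover have "d \<le> degree r" if "r \<noteq> 0"
    proof -
      have "{t. t ^ d = - \<rho> v} \<subseteq> {t. poly r t = 0}"
      proof
        fix t assume "t \<in> {t. t ^ d = - \<rho> v}"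
        then have "fermat (w + t *s b 0) = 0" by (simp add: fw)
        then have "poly p t = 0" using z p[of t] unfolding \<phi>_def by metis
        then show "t \<in> {t. poly r t = 0}"
          using \<open>t \<in> {t. t ^ d = - \<rho> v}\<close> by (simp add: r_def poly_monom)
      qed
      then have "card {t. t ^ d = - \<rho> v} \<le> card {t. poly r t = 0}"
        by (intro card_mono poly_roots_finite that)
      also have "\<dots> \<le> degree r" by (rule card_poly_roots_bound[OF that])
      finally show ?thesis using card_nth_roots[of "- \<rho> v" d] \<rho> d by simp
    qed
    ultimately have "r = 0" by linarith
    moreover have "v = w + (\<gamma> 0 \<odot> v) *s b 0" by (simp add: w_def)
    ultimately show ?thesis
      using p[of "\<gamma> 0 \<odot> v"] fw[of "\<gamma> 0 \<odot> v"] by (simp add: r_def poly_monom)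
  qed
  moreover have "\<rho> (b 1) \<noteq> 0" using d by (simp add: \<rho>_def power_0_left)
  moreover have "polyfun \<rho>" unfolding \<rho>_def by (intro polyfun_intros)
  moreover have "polyfun (\<lambda>v. \<phi> v - \<kappa> * fermat v)" by (intro polyfun_intros \<phi> polyfun_fermat)
  ultimately have "\<phi> v - \<kappa> * fermat v = 0" for v
    using polyfun_dense[of \<rho> "\<lambda>v. \<phi> v - \<kappa> * fermat v" UNIV "b 1"] vec.subspace_UNIV by blast
  moreover have "\<kappa> \<noteq> 0" using z[of "b 0"] d by (simp add: \<kappa>_def \<phi>_def fermat_def power_0_left)
  ultimately show ?thesis using that by (simp add: \<phi>_def)
qed

end

section \<open>Star points of the Fermat cone\<close>

text \<open>A star point demands P as first basis vector. All but the last vector are taken in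
  \<Lambda>, so a functional that vanishes on \<Lambda> and is 1 at r is the last coordinate; N
  \<ge> 2 keeps the two positions apart.\<close>

lemma coord_system_adapted:
  fixes \<Lambda> H :: "(complex ^ 'n) set"
  assumes \<Lambda>: "vec.subspace \<Lambda>" "\<Lambda> \<subseteq> H" and H: "vec.subspace H"
    and P: "P \<in> \<Lambda>" "P \<noteq> 0" and r: "r \<in> H" "r \<notin> \<Lambda>" and dim: "vec.dim H = vec.dim \<Lambda> + 1" "vec.dim H = N"
  obtains b where "coord_system H N b" "b 0 = P" "b (N - 1) = r" "\<And>j. j < N - 1 \<Longrightarrow> b j \<in> \<Lambda>" "N \<ge> 2"
proof -
  obtain B where B: "{P} \<subseteq> B" "B \<subseteq> \<Lambda>" "vec.independent B" "\<Lambda> \<subseteq> vec.span B"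
    using vec.maximal_independent_subset_extend[of "{P}" \<Lambda>] P by auto
  have fin: "finite B" by (rule vec.finiteI_independent[OF B(3)])
  have card: "card B = N - 1" using vec.basis_card_eq_dim[OF B(2,4,3)] dim by simp
  have N: "N \<ge> 2" using card card_gt_0_iff[of B] fin B(1) by auto
  have spB: "vec.span B = \<Lambda>" using B \<Lambda>(1) by (metis vec.span_minimal subset_antisym)
  obtain g where g: "bij_betw g {0..<N - 2} (B - {P})"
  proof -
    have "card (B - {P}) = N - 2" using fin B(1) card by simp
    then show ?thesis using ex_bij_betw_nat_finite[of "B - {P}"] fin that by auto
  qed
  define b where "b j = (if j = 0 then P else if j = N - 1 then r else g (j - 1))" for j
  have split: "{..<N} = insert 0 (insert (N - 1) (Suc ` {0..<N - 2}))"
  proof -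
    have "j \<in> Suc ` {0..<N - 2}" if "j < N" "j \<noteq> 0" "j \<noteq> N - 1" for j
      by (rule image_eqI[of _ _ "j - 1"]) (use that in auto)
    then show ?thesis using N by auto
  qed
  have "b ` (Suc ` {0..<N - 2}) = g ` {0..<N - 2}"
    unfolding image_image by (rule image_cong) (auto simp: b_def)
  also have "\<dots> = B - {P}" using g by (simp add: bij_betw_def)
  finally have "b ` {..<N} = insert (b 0) (insert (b (N - 1)) (B - {P}))"
    unfolding split by (simp only: image_insert)
  moreover have b01: "b 0 = P" "b (N - 1) = r" using N by (auto simp: b_def)
  moreover have "insert P (insert r (B - {P})) = insert r B" using B(1) by blast
  ultimately have img: "b ` {..<N} = insert r B" by simp
  have rB: "r \<notin> B" using r B(2) by auto
  have "card (b ` {..<N}) = card {..<N}" unfolding img using rB fin card N by simp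
  then have inj: "inj_on b {..<N}" by (rule eq_card_imp_inj_on[OF finite_lessThan])
  have "vec.independent (insert r B)" using B(3) r(2) spB by (simp add: vec.independent_insert)
  moreover have "vec.span (insert r B) = H"
  proof -
    have "vec.span (insert r B) = vec.span (insert r \<Lambda>)"
      unfolding set_eq_iff mem_span_insert_subspace[OF \<Lambda>(1)] by (simp add: vec.span_breakdown_eq spB)
    then show ?thesis using subspace_eq_span_insert[OF \<Lambda>(1) H \<Lambda>(2) r dim(1)] by simp
  qed
  ultimately have cs: "coord_system H N b" unfolding coord_system_def img using inj by blast
  have mem: "b j \<in> \<Lambda>" if "j < N - 1" for j
  proof (cases "j = 0")
    case False
    then have "g (j - 1) \<in> B - {P}" using bij_betwE[OF g] that by simp
    then show ?thesis using False that B(2) by (auto simp: b_def)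
  qed (use P in \<open>simp add: b_def\<close>)
  show ?thesis by (rule that[OF cs b01 mem N])
qed

text \<open>In adapted coordinates the restriction of F to the tangent hyperplane is c times the
  d-th power of the last coordinate, a form free of the first one.\<close>

lemma star_point_if_total_tangency:
  fixes F :: "'n::finite mpoly"
  defines "\<phi> \<equiv> \<lambda>v. meval F (($) v)"
  assumes F: "homogeneous d F" and c: "c \<noteq> 0" and \<Lambda>: "vec.subspace \<Lambda>" "vec.dim \<Lambda> + 2 = CARD('n)"
    and P: "P \<in> \<Lambda>" "P \<noteq> 0" "\<phi> P = 0" and dir: "ddir a \<phi> P \<noteq> 0"
    and tangent: "\<And>v. v \<in> \<Lambda> \<Longrightarrow> ddir v \<phi> P = 0" "ddir r \<phi> P = 0"
    and \<mu>: "\<And>v. v \<in> \<Lambda> \<Longrightarrow> \<mu> \<odot> v = 0" "\<mu> \<odot> r = 1"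
    and eq: "\<And>v. ddir v \<phi> P = 0 \<Longrightarrow> \<phi> v = c * (\<mu> \<odot> v) ^ d"
  shows "star_point d F P"
proof -
  define N where "N = CARD('n) - 1"
  define \<alpha> where "\<alpha> = (\<chi> i. meval (mpderiv i F) (($) P))"
  have \<alpha>: "\<alpha> \<odot> v = ddir v \<phi> P" for v
    by (simp add: \<alpha>_def scalar_product_def \<phi>_def flip: sum_mpderiv_eq_ddir)
  let ?H = "tangent_hyperplane F P"
  have H: "?H = {v. \<alpha> \<odot> v = 0}"
    unfolding tangent_hyperplane_def \<alpha>_def scalar_product_def by simp
  have dimH: "vec.dim ?H = N"
    using dim_hyperplane[of \<alpha> a] dir unfolding H by (simp add: \<alpha> N_def)
  have r: "r \<notin> \<Lambda>" using \<mu> by force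
  obtain b where b: "coord_system ?H N b" "b 0 = P" "b (N - 1) = r" "\<And>j. j < N - 1 \<Longrightarrow> b j \<in> \<Lambda>" "N \<ge> 2"
  proof (rule coord_system_adapted[OF \<Lambda>(1) _ _ P(1,2) _ r _ dimH])
    show "\<Lambda> \<subseteq> ?H" "r \<in> ?H" using tangent by (auto simp: H \<alpha>)
    show "vec.subspace ?H" unfolding H by (rule subspace_scalar_product)
    show "vec.dim ?H = vec.dim \<Lambda> + 1" using dimH \<Lambda>(2) by (simp add: N_def)
  qed (rule that)
  let ?G = "mConst c * mVar (N - 1) ^ d :: nat mpoly"
  have G: "restrict_poly F N b = ?G"
  proof (rule meval_eqD)
    fix y
    have "(\<Sum>j<N. y j *s b j) \<in> ?H" by (rule coord_system_mem[OF b(1)])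
    then have "meval (restrict_poly F N b) y = c * (\<mu> \<odot> (\<Sum>j<N. y j *s b j)) ^ d"
      using eq by (simp add: meval_restrict_poly \<phi>_def H \<alpha>)
    also have "\<mu> \<odot> (\<Sum>j<N. y j *s b j) = (\<Sum>j<N. if j = N - 1 then y j else 0)"
      unfolding scalar_product_sum_right
    proof (rule sum.cong[OF refl])
      fix j assume "j \<in> {..<N}"
      then have "j = N - 1 \<or> j < N - 1" by auto
      then show "\<mu> \<odot> (y j *s b j) = (if j = N - 1 then y j else 0)"
        using \<mu> b(3,4) by auto
    qed
    also have "\<dots> = y (N - 1)" using b(5) by simp
    finally show "meval (restrict_poly F N b) y = meval ?G y" by simp
  qed
  have "smooth_point F P"
  proof -
    have "\<exists>i. meval (mpderiv i F) (($) P) \<noteq> 0"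
    proof (rule ccontr)
      assume "\<not> ?thesis"
      then have "\<alpha> \<odot> a = 0" by (simp add: \<alpha>_def scalar_product_def)
      then show False using dir by (simp add: \<alpha>)
    qed
    then show ?thesis using P by (simp add: smooth_point_def proj_zeros_def \<phi>_def)
  qed
  moreover have "?G \<noteq> 0"
  proof
    assume 0: "?G = 0"
    have "c = meval ?G (\<lambda>_. 1)" by simp
    also have "\<dots> = 0" unfolding 0 by simp
    finally show False using c by simp
  qed
  moreover have "homogeneous d ?G"
    using homogeneous_mult[OF homogeneous_mConst homogeneous_power[OF homogeneous_mVar]] by fastforce
  moreover have "mvars ?G \<subseteq> {1..<N}"
    using mvars_mult[of "mConst c" "mVar (N - 1) ^ d"] mvars_power[of "mVar (N - 1)" "{N - 1}" d] b(5)
    by auto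
  ultimately show ?thesis
    unfolding star_point_def Let_def using b(1,2) G unfolding N_def by (metis dvd_refl)
qed

context fermat_coords
begin

lemma mem_L_iff: "v \<in> L \<longleftrightarrow> \<gamma> 0 \<odot> v = 0 \<and> \<gamma> 1 \<odot> v = 0 \<and> \<gamma> 2 \<odot> v = 0"
proof
  assume 0: "\<gamma> 0 \<odot> v = 0 \<and> \<gamma> 1 \<odot> v = 0 \<and> \<gamma> 2 \<odot> v = 0"
  obtain x y z where k: "v - (x *s b 0 + y *s b 1 + z *s b 2) \<in> L"
    using independent_mod_spans[OF L indep] by blast
  then have "x = 0" "y = 0" "z = 0"
    using 0 \<gamma>L[OF _ k, of 0] \<gamma>L[OF _ k, of 1] \<gamma>L[OF _ k, of 2] by simp_all
  then show "v \<in> L" using k by simp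
qed (use \<gamma>L[of 0] \<gamma>L[of 1] \<gamma>L[of 2] in auto)

text \<open>Where \<gamma>_i = \<zeta> \<gamma>_j the first two powers cancel and \<gamma>_k^d is
  left. At P the differential is proportional to \<zeta>^(d-1) \<gamma>_i + \<gamma>_j, which
  \<zeta> turns into \<zeta> \<gamma>_j - \<gamma>_i, so this hyperplane is tangent wherever
  \<gamma>_j is nonzero.\<close>

lemma star_subspace_fermat:
  fixes F :: "'n mpoly"
  assumes F: "homogeneous d F" "\<kappa> \<noteq> 0" "\<And>v. meval F (($) v) = \<kappa> * fermat v"
    and ijk: "(i, j, k) \<in> {(0, 1, 2), (1, 2, 0), (2, 0, 1)}" and \<zeta>: "\<zeta> ^ d = - 1"
  shows "{v. \<gamma> i \<odot> v = \<zeta> * (\<gamma> j \<odot> v) \<and> \<gamma> k \<odot> v = 0} \<in> star_subspaces d F"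
    (is "?\<Lambda> \<in> _")
proof -
  have lt: "i < 3" "j < 3" "k < 3" and ne: "i \<noteq> j" "j \<noteq> k" "i \<noteq> k" using ijk by auto
  have fermat: "fermat v = (\<gamma> i \<odot> v) ^ d + (\<gamma> j \<odot> v) ^ d + (\<gamma> k \<odot> v) ^ d" for v
    using ijk unfolding fermat_def by auto
  have mem: "v \<in> L \<longleftrightarrow> \<gamma> i \<odot> v = 0 \<and> \<gamma> j \<odot> v = 0 \<and> \<gamma> k \<odot> v = 0" for v
    using ijk unfolding mem_L_iff by auto
  have \<gamma>b [simp]: "\<gamma> x \<odot> b x = 1" if "x < 3" for x using dual[of x x] that by simp
  have \<gamma>b' [simp]: "\<gamma> x \<odot> b y = 0" if "x < 3" "y < 3" "x \<noteq> y" for x y using dual[of x y] that by simp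
  let ?q = "\<zeta> *s b i + b j"
  have q: "\<gamma> i \<odot> ?q = \<zeta>" "\<gamma> j \<odot> ?q = 1" "\<gamma> k \<odot> ?q = 0" using lt ne by simp_all
  have \<Lambda>: "vec.subspace ?\<Lambda>" by (auto simp: vec.subspace_def algebra_simps)
  have "?\<Lambda> = vec.span (insert ?q L)"
  proof (intro set_eqI)
    fix v
    have "v \<in> vec.span (insert ?q L) \<longleftrightarrow> (\<exists>t. v - t *s ?q \<in> L)"
      by (rule mem_span_insert_subspace[OF L(1)])
    also have "\<dots> \<longleftrightarrow> (\<exists>t. \<gamma> i \<odot> v = t * \<zeta> \<and> \<gamma> j \<odot> v = t \<and> \<gamma> k \<odot> v = 0)"
      unfolding mem by (simp only: scalar_product_diff_right scalar_product_scale_right q) auto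
    also have "\<dots> \<longleftrightarrow> v \<in> ?\<Lambda>" by (auto simp: mult.commute)
    finally show "v \<in> ?\<Lambda> \<longleftrightarrow> v \<in> vec.span (insert ?q L)" by simp
  qed
  moreover have "?q \<notin> L" using q by (simp only: mem) simp
  ultimately have dim: "vec.dim ?\<Lambda> + 2 = CARD('n)"
    using dim_insert_subspace[OF L(1), of ?q] L(2) by simp
  have zero: "fermat v = 0" if "v \<in> ?\<Lambda>" for v
    using that \<zeta> d unfolding fermat by (simp add: power_mult_distrib power_0_left)
  have ddir_F: "ddir w (\<lambda>v. meval F (($) v)) v = \<kappa> * of_nat d * ((\<gamma> i \<odot> v) ^ (d - 1) * (\<gamma> i \<odot> w) +
     (\<gamma> j \<odot> v) ^ (d - 1) * (\<gamma> j \<odot> w) + (\<gamma> k \<odot> v) ^ (d - 1) * (\<gamma> k \<odot> w))" for v w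
    unfolding F(3) fermat by (simp add: ddir_add ddir_mult ddir_power polyfun_intros algebra_simps)
  have \<zeta>0: "\<zeta> \<noteq> 0" using \<zeta> d by (auto simp: power_0_left)
  have \<zeta>d: "\<zeta> * \<zeta> ^ (d - 1) = - 1" using \<zeta> d by (metis Suc_diff_1 power_Suc less_le_trans zero_less_numeral)
  have star: "star_point d F P" if P: "P \<in> ?\<Lambda>" "\<gamma> j \<odot> P \<noteq> 0" for P
  proof (rule star_point_if_total_tangency[OF F(1,2) \<Lambda> dim P(1)])
    have "ddir w (\<lambda>v. meval F (($) v)) P = \<kappa> * of_nat d * (\<gamma> j \<odot> P) ^ (d - 1) *
        (\<zeta> ^ (d - 1) * (\<gamma> i \<odot> w) + \<gamma> j \<odot> w)" for w
      unfolding ddir_F using P(1) d by (simp add: power_mult_distrib power_0_left algebra_simps)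
    note ddir_P = this
    have t: "ddir w (\<lambda>v. meval F (($) v)) P = 0 \<longleftrightarrow> \<gamma> i \<odot> w = \<zeta> * (\<gamma> j \<odot> w)" for w
    proof -
      have "\<zeta> * (\<zeta> ^ (d - 1) * (\<gamma> i \<odot> w) + \<gamma> j \<odot> w) =
          (\<zeta> * \<zeta> ^ (d - 1)) * (\<gamma> i \<odot> w) + \<zeta> * (\<gamma> j \<odot> w)"
        by (simp only: distrib_left mult.assoc)
      also have "\<dots> = \<zeta> * (\<gamma> j \<odot> w) - \<gamma> i \<odot> w" unfolding \<zeta>d by simp
      finally have "\<zeta> * (\<zeta> ^ (d - 1) * (\<gamma> i \<odot> w) + \<gamma> j \<odot> w) = \<zeta> * (\<gamma> j \<odot> w) - \<gamma> i \<odot> w" .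
      then have "\<zeta> ^ (d - 1) * (\<gamma> i \<odot> w) + \<gamma> j \<odot> w = 0 \<longleftrightarrow> \<gamma> i \<odot> w = \<zeta> * (\<gamma> j \<odot> w)"
        using \<zeta>0 by (metis eq_iff_diff_eq_0 mult_eq_0_iff)
      then show ?thesis
        using ddir_P[of w] F(2) P(2) d by simp
    qed
    show "P \<noteq> 0" using P(2) by auto
    show "meval F (($) P) = 0" using zero[OF P(1)] by (simp add: F(3))
    show "ddir (b j) (\<lambda>v. meval F (($) v)) P \<noteq> 0" unfolding t using \<zeta>0 lt ne by simp
    show "ddir v (\<lambda>v. meval F (($) v)) P = 0" if "v \<in> ?\<Lambda>" for v unfolding t using that by simp
    show "ddir (b k) (\<lambda>v. meval F (($) v)) P = 0" unfolding t using lt ne by simp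
    show "\<gamma> k \<odot> v = 0" if "v \<in> ?\<Lambda>" for v using that by simp
    show "\<gamma> k \<odot> b k = 1" using lt by simp
    show "meval F (($) v) = \<kappa> * (\<gamma> k \<odot> v) ^ d" if "ddir v (\<lambda>v. meval F (($) v)) P = 0" for v
      using that[unfolded t] \<zeta> unfolding F(3) fermat by (simp add: power_mult_distrib)
  qed
  have "general_element ?\<Lambda> (star_point d F)"
    unfolding general_element_def zariski_open_in_def
  proof (intro exI conjI)
    show "\<forall>f\<in>{linear_form (\<gamma> j)}. \<exists>e. homogeneous e f" using homogeneous_linear_form by blast
    have "?q \<noteq> 0" using q by (metis scalar_product_zero_right zero_neq_one)
    then have "?q \<in> {v \<in> ?\<Lambda>. v \<noteq> 0 \<and> (\<exists>f\<in>{linear_form (\<gamma> j)}. meval f (($) v) \<noteq> 0)}"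
      using q by simp
    then show "{v \<in> ?\<Lambda>. v \<noteq> 0 \<and> (\<exists>f\<in>{linear_form (\<gamma> j)}. meval f (($) v) \<noteq> 0)} \<noteq> {}" by blast
    show "\<forall>P\<in>{v \<in> ?\<Lambda>. v \<noteq> 0 \<and> (\<exists>f\<in>{linear_form (\<gamma> j)}. meval f (($) v) \<noteq> 0)}. star_point d F P"
      using star by simp
  qed (rule refl)
  moreover have "?\<Lambda> - {0} \<subseteq> proj_zeros F" using zero by (auto simp: proj_zeros_def F(3))
  ultimately show ?thesis
    using \<Lambda> dim by (simp add: star_subspaces_def proj_dim_def card_cart_basis)
qed

lemma card_star_subspaces_ge:
  fixes F :: "'n mpoly"
  assumes "homogeneous d F" "\<kappa> \<noteq> 0" "\<And>v. meval F (($) v) = \<kappa> * fermat v" "finite (star_subspaces d F)"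
  shows "3 * d \<le> card (star_subspaces d F)"
proof -
  \<comment> \<open>Each pair of coordinates occurs in one order only; the opposite order would
    repeat the same subspaces with \<zeta> inverted.\<close>
  define I where "I = {(0 :: nat, 1 :: nat, 2 :: nat), (1, 2, 0), (2, 0, 1)} \<times> {\<zeta>::complex. \<zeta> ^ d = - 1}"
  define \<Lambda> where "\<Lambda> = (\<lambda>((i, j, k), \<zeta>). {v. \<gamma> i \<odot> v = \<zeta> * (\<gamma> j \<odot> v) \<and> \<gamma> k \<odot> v = 0})"
  have "inj_on \<Lambda> I"
  proof (rule inj_onI)
    fix x y assume x: "x \<in> I" and y: "y \<in> I" and eq: "\<Lambda> x = \<Lambda> y"
    obtain i j k \<zeta> where xs: "x = ((i, j, k), \<zeta>)" by (cases x) auto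
    obtain i' j' k' \<zeta>' where ys: "y = ((i', j', k'), \<zeta>')" by (cases y) auto
    have "\<zeta> \<noteq> 0" using x d by (auto simp: xs I_def power_0_left)
    \<comment> \<open>This point identifies its index: its only vanishing coordinate among the three
      is the k-th, and the ratio of the other two is \<zeta>.\<close>
    have "\<zeta> *s b i + b j \<in> \<Lambda> x" using x unfolding xs \<Lambda>_def I_def by auto
    then have "\<zeta> *s b i + b j \<in> \<Lambda> y" using eq by simp
    then show "x = y" using x y \<open>\<zeta> \<noteq> 0\<close> unfolding xs ys \<Lambda>_def I_def by auto
  qed
  moreover have "\<Lambda> ` I \<subseteq> star_subspaces d F"
    using star_subspace_fermat[OF assms(1-3)] by (auto simp: \<Lambda>_def I_def)
  ultimately have "card I \<le> card (star_subspaces d F)" by (rule card_inj_on_le) (rule assms(4))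
  moreover have "card I = 3 * d"
    using card_nth_roots[of "-1" d] d by (simp add: I_def card_cartesian_product)
  ultimately show ?thesis by simp
qed

text \<open>Only the zero set of F is given, so F is first recognised as a multiple of the Fermat
  form, which makes it invariant under L.\<close>

theorem star_subspaces_of_fermat_cone:
  assumes F: "homogeneous d F" and zeros: "proj_zeros F = proj_zeros fermat_poly"
  shows "\<forall>\<Lambda>\<in>star_subspaces d F. L \<subseteq> \<Lambda>" "finite (star_subspaces d F)"
    "card (star_subspaces d F) = 3 * d"
proof -
  have "meval F (($) v) = 0 \<longleftrightarrow> fermat v = 0" for v
  proof (cases "v = 0")
    case True
    have "meval F (($) (0 *s (0 :: complex ^ 'n))) = 0"
      using d unfolding meval_vec_homogeneous[OF F] by (simp add: power_0_left)
    then show ?thesis using True d by (simp add: fermat_def power_0_left)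
  next
    case False
    then show ?thesis
      using zeros unfolding proj_zeros_def meval_fermat_poly by (auto simp: set_eq_iff)
  qed
  then obtain \<kappa> where \<kappa>: "\<kappa> \<noteq> 0" "\<And>v. meval F (($) v) = \<kappa> * fermat v"
    by (rule unique_fermat_equation[OF F]) blast
  have sub: "L \<subseteq> \<Lambda>" if S: "\<Lambda> \<in> star_subspaces d F" for \<Lambda>
  proof -
    obtain \<alpha> \<mu> A c where T: "total_tangency d (\<lambda>v. meval F (($) v)) \<Lambda> \<alpha> \<mu> A c"
      using star_subspace_total_tangency[OF F d S] by blast
    show ?thesis
      by (rule subset_if_translation_invariant[OF T _ L(1)])
         (use d fermat_translate in \<open>simp_all add: \<kappa>(2)\<close>)
  qed
  then show "\<forall>\<Lambda>\<in>star_subspaces d F. L \<subseteq> \<Lambda>" by blast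
  obtain \<zeta> :: complex where "\<zeta> ^ d = - 1" using ex_root_minus_one[of d] d by auto
  then have "star_subspaces d F \<noteq> {}"
    using star_subspace_fermat[OF F \<kappa>, of 0 1 2 \<zeta>] by auto
  note bounds = star_subspaces_through_common_subspace(2,3)[OF F d this L sub]
  show "finite (star_subspaces d F)" by (rule bounds(1))
  then have "3 * d \<le> card (star_subspaces d F)" by (rule card_star_subspaces_ge[OF F \<kappa>])
  moreover have "card (star_subspaces d F) \<le> 3 * d" by (rule bounds(2))
  ultimately show "card (star_subspaces d F) = 3 * d" by simp
qed

end

section \<open>The Fermat cone over a given plane, and the final theorem\<close>

lemma ex_fermat_coords:
  fixes L :: "(complex ^ 'n) set"
  assumes L: "vec.subspace L" "vec.dim L + 3 = CARD('n)" and d: "d \<ge> 3"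
    and V: "complementary_plane L V" "coord_system V 3 b"
  obtains \<gamma> where "fermat_coords L b \<gamma> d"
proof -
  have i: "independent_mod L (b 0) (b 1) (b 2)" by (rule independent_mod_if_complementary[OF V])
  note i' = independent_mod_rotate[OF i] and i'' = independent_mod_rotate[OF independent_mod_rotate[OF i]]
  obtain g0 where g0: "g0 \<odot> b 0 = 1" "g0 \<odot> b 1 = 0" "g0 \<odot> b 2 = 0" "\<And>u. u \<in> L \<Longrightarrow> g0 \<odot> u = 0"
    using ex_dual_functional[OF L(1) i] by blast
  obtain g1 where g1: "g1 \<odot> b 1 = 1" "g1 \<odot> b 2 = 0" "g1 \<odot> b 0 = 0" "\<And>u. u \<in> L \<Longrightarrow> g1 \<odot> u = 0"
    using ex_dual_functional[OF L(1) i'] by blast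
  obtain g2 where g2: "g2 \<odot> b 2 = 1" "g2 \<odot> b 0 = 0" "g2 \<odot> b 1 = 0" "\<And>u. u \<in> L \<Longrightarrow> g2 \<odot> u = 0"
    using ex_dual_functional[OF L(1) i''] by blast
  define \<gamma> where "\<gamma> j = (if j = 0 then g0 else if j = 1 then g1 else g2)" for j :: nat
  have lt3: "j = 0 \<or> j = 1 \<or> j = 2" if "j < 3" for j :: nat using that by auto
  have "fermat_coords L b \<gamma> d"
  proof
    show "\<gamma> i \<odot> b j = (if i = j then 1 else 0)" if "i < 3" "j < 3" for i j
      using lt3[OF that(1)] lt3[OF that(2)] g0(1-3) g1(1-3) g2(1-3) by (elim disjE) (simp_all add: \<gamma>_def)
    show "\<gamma> i \<odot> u = 0" if "i < 3" "u \<in> L" for i u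
      using that g0(4) g1(4) g2(4) by (simp add: \<gamma>_def)
  qed (rule L i d)+
  then show ?thesis by (rule that)
qed

theorem mainTheorem4:
  fixes N d :: nat
  assumes "CARD('n::finite) = N + 1" and "d \<ge> 3"
  shows
    "(\<forall>(F :: 'n mpoly) L.
        irreducible_hypersurface d F \<and>
        (\<exists>\<Lambda>1\<in>star_subspaces d F. \<exists>\<Lambda>2\<in>star_subspaces d F. \<Lambda>1 \<noteq> \<Lambda>2) \<and>
        vec.subspace L \<and> proj_dim L = int N - 3 \<and>
        (\<forall>\<Lambda>\<in>star_subspaces d F. L \<subseteq> \<Lambda>)
        \<longrightarrow>
        (infinite (star_subspaces d F) \<or> card (star_subspaces d F) \<ge> d
           \<longrightarrow> cone_over_plane_curve (proj_zeros F) L) \<and>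
        finite (star_subspaces d F) \<and> card (star_subspaces d F) \<le> 3 * d)
     \<and>
     (\<forall>(L :: (complex ^ 'n) set) V \<Gamma>.
        vec.subspace L \<and> proj_dim L = int N - 3 \<and>
        complementary_plane L V \<and> fermat_curve d V \<Gamma>
        \<longrightarrow>
        (\<exists>F. irreducible_hypersurface d F \<and> proj_zeros F = proj_cone L \<Gamma>) \<and>
        (\<forall>F. irreducible_hypersurface d F \<and> proj_zeros F = proj_cone L \<Gamma> \<longrightarrow>
           (\<forall>\<Lambda>\<in>star_subspaces d F. L \<subseteq> \<Lambda>) \<and>
           finite (star_subspaces d F) \<and> card (star_subspaces d F) = 3 * d))"
proof -
  have dim: "vec.dim L + 3 = CARD('n)" if "proj_dim L = int N - 3" for L :: "(complex ^ 'n) set"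
    using that assms(1) by (simp add: proj_dim_def)
  show ?thesis
  proof (intro conjI[OF allI[OF allI] allI[OF allI[OF allI]]] impI)
    fix F :: "'n mpoly" and L :: "(complex ^ 'n) set"
    assume *: "irreducible_hypersurface d F \<and>
        (\<exists>\<Lambda>1\<in>star_subspaces d F. \<exists>\<Lambda>2\<in>star_subspaces d F. \<Lambda>1 \<noteq> \<Lambda>2) \<and>
        vec.subspace L \<and> proj_dim L = int N - 3 \<and> (\<forall>\<Lambda>\<in>star_subspaces d F. L \<subseteq> \<Lambda>)"
    then have F: "homogeneous d F" and ne: "star_subspaces d F \<noteq> {}" and L: "vec.subspace L" "vec.dim L + 3 = CARD('n)"
      by (auto simp: irreducible_hypersurface_def dim)
    have sub: "L \<subseteq> \<Lambda>" if "\<Lambda> \<in> star_subspaces d F" for \<Lambda> using * that by blast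
    note main = star_subspaces_through_common_subspace[OF F assms(2) ne L sub]
    show "(infinite (star_subspaces d F) \<or> card (star_subspaces d F) \<ge> d
           \<longrightarrow> cone_over_plane_curve (proj_zeros F) L) \<and>
        finite (star_subspaces d F) \<and> card (star_subspaces d F) \<le> 3 * d"
      by (intro conjI impI main) assumption+
  next
    fix L V \<Gamma> :: "(complex ^ 'n) set"
    assume *: "vec.subspace L \<and> proj_dim L = int N - 3 \<and> complementary_plane L V \<and> fermat_curve d V \<Gamma>"
    then have L: "vec.subspace L" "vec.dim L + 3 = CARD('n)" and V: "complementary_plane L V"
      by (auto simp: dim)
    obtain b where b: "coord_system V 3 b" "\<Gamma> = curve_in_coords b (mVar 0 ^ d + mVar 1 ^ d + mVar 2 ^ d)"
      using * by (auto simp: fermat_curve_def)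
    obtain \<gamma> where "fermat_coords L b \<gamma> d" by (rule ex_fermat_coords[OF L assms(2) V b(1)])
    then interpret fermat_coords L b \<gamma> d .
    obtain \<zeta> :: complex where \<zeta>: "\<zeta> ^ d = - 1" using ex_root_minus_one[of d] assms(2) by auto
    have "meval (mVar 0 ^ d + mVar 1 ^ d + mVar 2 ^ d) y = fermat (\<Sum>j<3. y j *s b j)" for y
      unfolding sum_lessThan_3 fermat_def by simp
    \<comment> \<open>A zero off L, needed so that the cone over the curve also covers L.\<close>
    moreover have "\<zeta> *s b 0 + b 1 \<notin> L" by (simp add: mem_L_iff)
    moreover have "fermat (\<zeta> *s b 0 + b 1) = 0" using \<zeta> d by (simp add: fermat_def power_0_left)
    moreover have "d > 0" using d by simp
    ultimately have "{v. v \<noteq> 0 \<and> fermat v = 0} = proj_cone L \<Gamma>"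
      unfolding b(2) using zeros_eq_proj_cone[OF L indep fermat_scale _ fermat_translate] by blast
    then have zeros: "proj_zeros fermat_poly = proj_cone L \<Gamma>"
      by (simp add: proj_zeros_def meval_fermat_poly)
    \<comment> \<open>This equation shows that the claim about all equations of the cone is not
      vacuous.\<close>
    have "irreducible_hypersurface d fermat_poly"
      unfolding irreducible_hypersurface_def
      by (intro conjI homogeneous_fermat_poly irreducible_fermat_poly)
    then show "(\<exists>F. irreducible_hypersurface d F \<and> proj_zeros F = proj_cone L \<Gamma>) \<and>
        (\<forall>F. irreducible_hypersurface d F \<and> proj_zeros F = proj_cone L \<Gamma> \<longrightarrow>
           (\<forall>\<Lambda>\<in>star_subspaces d F. L \<subseteq> \<Lambda>) \<and>
           finite (star_subspaces d F) \<and> card (star_subspaces d F) = 3 * d)"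
      using zeros star_subspaces_of_fermat_cone unfolding irreducible_hypersurface_def by metis
  qed
qed

end
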